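(* Let $G$ be a compact group and let $A,B,C,D$ be $G$-$*$-algebras with $G$-equivariant $*$-homomorphisms $\ell:A\to D$, $r:B\to D$, $p:C\to A$, $q:C\to B$ satisfying $\ell p=rq$. Assume that (1) the square is a pullback in the category of $G$-$*$-algebras, i.e. $c\mapsto (p(c),q(c))$ is an isomorphism of $C$ onto $\{(a,b)\in A\times B : \ell(a)=r(b)\}$; (2) $r$ is surjective; (3) the invariant subalgebra $C^G$ is AF; (4) the square embeds in its $C^*$ completion, i.e. $A,B,C,D$ have $C^*$ completions $\overline A,\overline B,\overline C,\overline D$ and each of the canonical maps $A\to\overline A$, $B\to\overline B$, $C\to\overline C$, $D\to\overline D$ is injective. Then the $C^*$-completed square, with the induced $G$-equivariant $*$-homomorphisms $\overline\ell:\overline A\to\overline D$, $\overline r:\overline B\to\overline D$, $\overline p:\overline C\to\overline A$, $\overline q:\overline C\to\overline B$, is a pullback of $G$-$C^*$-algebras; that is, $x\mapsto(\overline p(x),\overline q(x))$ is an isomorphism of $\overline C$ onto $\{(a,b)\in\overline A\times\overline B : \overline\ell(a)=\overline r(b)\}$.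
   Context: All algebras are over $\mathbb C$ (not necessarily unital) and involutions are conjugate-linear. For a compact group $G$, $\mathcal O(G)$ is the Hopf $*$-algebra of representative functions on $G$, i.e. the span of matrix coefficients of finite-dimensional continuous $G$-representations. A $G$-$*$-algebra is a $*$-algebra $A$ with a right $\mathcal O(G)$-comodule structure $\rho:A\to A\otimes\mathcal O(G)$ that is a $*$-homomorphism; it yields an action $g\triangleright a=(\mathrm{id}\otimes \mathrm{ev}_g)\rho(a)$ of $G$ on $A$ by $*$-automorphisms. Morphisms of $G$-$*$-algebras are the $G$-equivariant $*$-homomorphisms. The invariant subalgebra is $A^G=\{a\in A: g\triangleright a=a\ \forall g\in G\}$. A $G$-$C^*$-algebra is a $C^*$-algebra with an action of $G$ by $*$-automorphisms that is strongly continuous ($g\mapsto g\triangleright a$ is norm continuous for each $a$); morphisms are $G$-equivariant $*$-homomorphisms. The $C^*$ completion (universal $C^*$ envelope) of a $*$-algebra $M$ is a $C^*$-algebra $\overline M$ with a $*$-homomorphism $M\to\overline M$ through which every $*$-homomorphism from $M$ to a $C^*$-algebra factors uniquely via a $*$-homomorphism from $\overline M$. A $*$-homomorphism $M\to N$ then induces $\overline M\to\overline N$ by universality, and a $G$-$*$-algebra structure on $M$ induces a $G$-$C^*$-algebra structure on $\overline M$. A $*$-algebra embeddable in a $C^*$-algebra is called AF if it is the union of an upward-directed family of finite-dimensional $*$-subalgebras. *)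

theory Defs
  imports "HOL-Analysis.Analysis" "HOL-Algebra.Algebraic_Closure_Type"
begin

section \<open>Complex *-algebras\<close>

text \<open>
  The library's module records are extended by an involution.  Algebras here need not be unital:
  the \<open>one\<close> field inherited from the ring records is never constrained and never used.
\<close>

record 'a star_alg = "(complex, 'a) module" +
  invol :: "'a \<Rightarrow> 'a"

locale star_algebra = module "ring_of_type_algebra :: complex ring" A
  for A :: "('a, 'm) star_alg_scheme" (structure) +
  assumes mult_closed: "\<lbrakk>x \<in> carrier A; y \<in> carrier A\<rbrakk> \<Longrightarrow> x \<otimes> y \<in> carrier A"
    and mult_assoc: "\<lbrakk>x \<in> carrier A; y \<in> carrier A; z \<in> carrier A\<rbrakk> \<Longrightarrow> (x \<otimes> y) \<otimes> z = x \<otimes> (y \<otimes> z)"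
    and distr_l: "\<lbrakk>x \<in> carrier A; y \<in> carrier A; z \<in> carrier A\<rbrakk> \<Longrightarrow> (x \<oplus> y) \<otimes> z = x \<otimes> z \<oplus> y \<otimes> z"
    and distr_r: "\<lbrakk>x \<in> carrier A; y \<in> carrier A; z \<in> carrier A\<rbrakk> \<Longrightarrow> x \<otimes> (y \<oplus> z) = x \<otimes> y \<oplus> x \<otimes> z"
    and smult_mult_l: "\<lbrakk>x \<in> carrier A; y \<in> carrier A\<rbrakk> \<Longrightarrow> (c \<odot> x) \<otimes> y = c \<odot> (x \<otimes> y)"
    and smult_mult_r: "\<lbrakk>x \<in> carrier A; y \<in> carrier A\<rbrakk> \<Longrightarrow> x \<otimes> (c \<odot> y) = c \<odot> (x \<otimes> y)"
    and invol_closed: "x \<in> carrier A \<Longrightarrow> invol A x \<in> carrier A"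
    and invol_invol: "x \<in> carrier A \<Longrightarrow> invol A (invol A x) = x"
    and invol_add: "\<lbrakk>x \<in> carrier A; y \<in> carrier A\<rbrakk> \<Longrightarrow> invol A (x \<oplus> y) = invol A x \<oplus> invol A y"
    and invol_smult: "x \<in> carrier A \<Longrightarrow> invol A (c \<odot> x) = cnj c \<odot> invol A x"
    and invol_mult: "\<lbrakk>x \<in> carrier A; y \<in> carrier A\<rbrakk> \<Longrightarrow> invol A (x \<otimes> y) = invol A y \<otimes> invol A x"

definition star_hom :: "('a, 'm) star_alg_scheme \<Rightarrow> ('b, 'n) star_alg_scheme \<Rightarrow> ('a \<Rightarrow> 'b) set" where
  "star_hom A B = {h \<in> carrier A \<rightarrow> carrier B.
     (\<forall>x\<in>carrier A. \<forall>y\<in>carrier A. h (x \<oplus>\<^bsub>A\<^esub> y) = h x \<oplus>\<^bsub>B\<^esub> h y) \<and>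
     (\<forall>c. \<forall>x\<in>carrier A. h (c \<odot>\<^bsub>A\<^esub> x) = c \<odot>\<^bsub>B\<^esub> h x) \<and>
     (\<forall>x\<in>carrier A. \<forall>y\<in>carrier A. h (x \<otimes>\<^bsub>A\<^esub> y) = h x \<otimes>\<^bsub>B\<^esub> h y) \<and>
     (\<forall>x\<in>carrier A. h (invol A x) = invol B (h x))}"

definition star_subalgebra :: "'a set \<Rightarrow> ('a, 'm) star_alg_scheme \<Rightarrow> bool" where
  "star_subalgebra F A \<longleftrightarrow>
     submodule F (ring_of_type_algebra :: complex ring) A \<and>
     (\<forall>x\<in>F. \<forall>y\<in>F. x \<otimes>\<^bsub>A\<^esub> y \<in> F) \<and> (\<forall>x\<in>F. invol A x \<in> F)"

definition finite_dimensional :: "'a set \<Rightarrow> ('a, 'm) star_alg_scheme \<Rightarrow> bool" where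
  "finite_dimensional F A \<longleftrightarrow>
     (\<exists>S. finite S \<and> S \<subseteq> F \<and> (\<forall>x\<in>F. \<exists>c. x = (\<Oplus>\<^bsub>A\<^esub>s\<in>S. c s \<odot>\<^bsub>A\<^esub> s)))"

definition fibre_product ::
  "('a, 'm) star_alg_scheme \<Rightarrow> ('b, 'n) star_alg_scheme \<Rightarrow> ('a \<Rightarrow> 'd) \<Rightarrow> ('b \<Rightarrow> 'd) \<Rightarrow> ('a \<times> 'b) star_alg"
where
  "fibre_product A B l r =
     \<lparr>carrier = {(a, b) \<in> carrier A \<times> carrier B. l a = r b},
      monoid.mult = (\<lambda>(a, b) (a', b'). (a \<otimes>\<^bsub>A\<^esub> a', b \<otimes>\<^bsub>B\<^esub> b')),
      one = undefined,
      zero = (\<zero>\<^bsub>A\<^esub>, \<zero>\<^bsub>B\<^esub>),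
      add = (\<lambda>(a, b) (a', b'). (a \<oplus>\<^bsub>A\<^esub> a', b \<oplus>\<^bsub>B\<^esub> b')),
      smult = (\<lambda>c (a, b). (c \<odot>\<^bsub>A\<^esub> a, c \<odot>\<^bsub>B\<^esub> b)),
      invol = (\<lambda>(a, b). (invol A a, invol B b))\<rparr>"


section \<open>C*-algebras\<close>

record 'a cstar_alg = "'a star_alg" +
  cnorm :: "'a \<Rightarrow> real"

text \<open>
  The value outside the carrier is irrelevant; it is chosen so that the library's locale
  \<open>Metric_space\<close>, which demands symmetry and nonnegativity everywhere, applies.
\<close>

definition cdist :: "('a, 'm) cstar_alg_scheme \<Rightarrow> 'a \<Rightarrow> 'a \<Rightarrow> real" where
  "cdist N x y = (if x \<in> carrier N \<and> y \<in> carrier N then cnorm N (x \<ominus>\<^bsub>N\<^esub> y) else 0)"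

locale cstar_algebra = star_algebra N for N :: "('a, 'm) cstar_alg_scheme" (structure) +
  assumes norm_nonneg: "x \<in> carrier N \<Longrightarrow> 0 \<le> cnorm N x"
    and norm_eq_0: "x \<in> carrier N \<Longrightarrow> cnorm N x = 0 \<longleftrightarrow> x = \<zero>"
    and norm_triangle: "\<lbrakk>x \<in> carrier N; y \<in> carrier N\<rbrakk> \<Longrightarrow> cnorm N (x \<oplus> y) \<le> cnorm N x + cnorm N y"
    and norm_smult: "x \<in> carrier N \<Longrightarrow> cnorm N (c \<odot> x) = cmod c * cnorm N x"
    and norm_mult: "\<lbrakk>x \<in> carrier N; y \<in> carrier N\<rbrakk> \<Longrightarrow> cnorm N (x \<otimes> y) \<le> cnorm N x * cnorm N y"
    and cstar_identity: "x \<in> carrier N \<Longrightarrow> cnorm N (invol N x \<otimes> x) = (cnorm N x)\<^sup>2"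
    and complete: "Metric_space.mcomplete (carrier N) (cdist N)"

text \<open>
  A type \<open>'u\<close> serves as the universe of C*-algebras: the completion of \<open>M\<close> is a C*-algebra with
  carrier in \<open>'u\<close> that is universal among all C*-algebras with carrier in \<open>'u\<close>.  Nothing is assumed
  about \<open>'u\<close>, so it may be taken arbitrarily large.  Uniqueness of a map on the
  carrier is expressed by uniqueness among maps with the fixed value \<open>undefined\<close> outside it.
\<close>

definition is_cstar_completion ::
  "('a, 'm) star_alg_scheme \<Rightarrow> 'u cstar_alg \<Rightarrow> ('a \<Rightarrow> 'u) \<Rightarrow> bool"
where
  "is_cstar_completion M Mbar i \<longleftrightarrow>
     cstar_algebra Mbar \<and> i \<in> star_hom M Mbar \<and>
     (\<forall>(N :: 'u cstar_alg) f. cstar_algebra N \<longrightarrow> f \<in> star_hom M N \<longrightarrow>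
        (\<exists>!h. h \<in> star_hom Mbar N \<and> h \<in> extensional (carrier Mbar) \<and>
              (\<forall>x\<in>carrier M. h (i x) = f x)))"

definition completion_map ::
  "('a, 'm) star_alg_scheme \<Rightarrow> 'u cstar_alg \<Rightarrow> ('a \<Rightarrow> 'u) \<Rightarrow> 'u cstar_alg \<Rightarrow> ('b \<Rightarrow> 'u) \<Rightarrow>
   ('a \<Rightarrow> 'b) \<Rightarrow> 'u \<Rightarrow> 'u"
where
  "completion_map M Mbar i Nbar j f =
     (THE h. h \<in> star_hom Mbar Nbar \<and> h \<in> extensional (carrier Mbar) \<and>
             (\<forall>x\<in>carrier M. h (i x) = j (f x)))"

lemma star_hom_comp:
  assumes "f \<in> star_hom A B" and "g \<in> star_hom B C"
  shows "(\<lambda>x. g (f x)) \<in> star_hom A C"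
  using assms by (auto simp: star_hom_def Pi_iff)

lemma completion_map:
  assumes M: "is_cstar_completion M Mbar i" and N: "is_cstar_completion N Nbar j"
    and f: "f \<in> star_hom M N"
  shows "completion_map M Mbar i Nbar j f \<in> star_hom Mbar Nbar"
    and "completion_map M Mbar i Nbar j f \<in> extensional (carrier Mbar)"
    and "\<And>x. x \<in> carrier M \<Longrightarrow> completion_map M Mbar i Nbar j f (i x) = j (f x)"
proof -
  have "cstar_algebra Nbar" "(\<lambda>x. j (f x)) \<in> star_hom M Nbar"
    using N f star_hom_comp unfolding is_cstar_completion_def by blast+
  with M have "\<exists>!h. h \<in> star_hom Mbar Nbar \<and> h \<in> extensional (carrier Mbar) \<and>
      (\<forall>x\<in>carrier M. h (i x) = j (f x))"
    unfolding is_cstar_completion_def by simp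
  from theI'[OF this, folded completion_map_def]
  show "completion_map M Mbar i Nbar j f \<in> star_hom Mbar Nbar"
    and "completion_map M Mbar i Nbar j f \<in> extensional (carrier Mbar)"
    and "\<And>x. x \<in> carrier M \<Longrightarrow> completion_map M Mbar i Nbar j f (i x) = j (f x)"
    by auto
qed

text \<open>Embeddability, too, refers to C*-algebras with carrier in the universe \<open>'u\<close>.\<close>

definition embeds_in_cstar_algebra :: "'u itself \<Rightarrow> ('a, 'm) star_alg_scheme \<Rightarrow> bool" where
  "embeds_in_cstar_algebra _ M \<longleftrightarrow>
     (\<exists>(N :: 'u cstar_alg) h. cstar_algebra N \<and> h \<in> star_hom M N \<and> inj_on h (carrier M))"

definition AF_algebra :: "'u itself \<Rightarrow> ('a, 'm) star_alg_scheme \<Rightarrow> bool" where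
  "AF_algebra U M \<longleftrightarrow>
     star_algebra M \<and> embeds_in_cstar_algebra U M \<and>
     (\<exists>\<F>. \<F> \<noteq> {} \<and>
        (\<forall>F\<in>\<F>. star_subalgebra F M \<and> finite_dimensional F M) \<and>
        (\<forall>F1\<in>\<F>. \<forall>F2\<in>\<F>. \<exists>F3\<in>\<F>. F1 \<subseteq> F3 \<and> F2 \<subseteq> F3) \<and>
        \<Union>\<F> = carrier M)"


section \<open>Compact groups and representative functions\<close>

definition compact_group :: "('g, 'k) monoid_scheme \<Rightarrow> 'g topology \<Rightarrow> bool" where
  "compact_group G T \<longleftrightarrow>
     group G \<and> topspace T = carrier G \<and>
     continuous_map (prod_topology T T) T (\<lambda>(g, h). g \<otimes>\<^bsub>G\<^esub> h) \<and>
     continuous_map T T (\<lambda>g. inv\<^bsub>G\<^esub> g) \<and>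
     compact_space T \<and> Hausdorff_space T"

text \<open>
  A continuous representation of dimension \<open>n\<close>, written in a basis: \<open>\<pi> g i j\<close> for \<open>i, j < n\<close> are the
  entries of the matrix of \<open>g\<close>.
\<close>

definition continuous_rep ::
  "('g, 'k) monoid_scheme \<Rightarrow> 'g topology \<Rightarrow> nat \<Rightarrow> ('g \<Rightarrow> nat \<Rightarrow> nat \<Rightarrow> complex) \<Rightarrow> bool"
where
  "continuous_rep G T n \<pi> \<longleftrightarrow>
     (\<forall>i<n. \<forall>j<n. continuous_map T euclidean (\<lambda>g. \<pi> g i j)) \<and>
     (\<forall>i<n. \<forall>j<n. \<pi> \<one>\<^bsub>G\<^esub> i j = (if i = j then 1 else 0)) \<and>
     (\<forall>g\<in>carrier G. \<forall>h\<in>carrier G. \<forall>i<n. \<forall>j<n.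
        \<pi> (g \<otimes>\<^bsub>G\<^esub> h) i j = (\<Sum>k<n. \<pi> g i k * \<pi> h k j))"

text \<open>The matrix coefficients are the functions \<open>g \<mapsto> \<xi>(\<pi>(g) v)\<close> for a vector \<open>v\<close> and a functional \<open>\<xi>\<close>.\<close>

definition matrix_coefficients :: "('g, 'k) monoid_scheme \<Rightarrow> 'g topology \<Rightarrow> ('g \<Rightarrow> complex) set" where
  "matrix_coefficients G T =
     {f. \<exists>n \<pi> \<xi> v. continuous_rep G T n \<pi> \<and>
         (\<forall>g\<in>carrier G. f g = (\<Sum>i<n. \<xi> i * (\<Sum>j<n. \<pi> g i j * v j)))}"

definition representative_functions ::
  "('g, 'k) monoid_scheme \<Rightarrow> 'g topology \<Rightarrow> ('g \<Rightarrow> complex) set"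
where
  "representative_functions G T =
     {f. \<exists>(m :: nat) c u. (\<forall>k<m. u k \<in> matrix_coefficients G T) \<and>
         (\<forall>g\<in>carrier G. f g = (\<Sum>k<m. c k * u k g))}"


section \<open>G-*-algebras and G-C*-algebras\<close>

text \<open>
  The algebraic tensor product of \<open>A\<close> with \<open>\<O>(G)\<close>.  Since \<open>\<O>(G)\<close> consists of functions, the linear map
  from the tensor product to the \<open>A\<close>-valued functions on \<open>G\<close> sending \<open>a \<otimes> f\<close> to \<open>g \<mapsto> f(g) a\<close> is
  injective, and the tensor product is represented by its image.  Its *-algebra operations
  \<open>(a \<otimes> f)(b \<otimes> h) = ab \<otimes> fh\<close> and \<open>(a \<otimes> f)\<^sup>* = a\<^sup>* \<otimes> cnj f\<close> become pointwise, and
  \<open>id \<otimes> ev\<^sub>g\<close> becomes evaluation at \<open>g\<close>.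
\<close>

definition tensor_O ::
  "('a, 'm) star_alg_scheme \<Rightarrow> ('g, 'k) monoid_scheme \<Rightarrow> 'g topology \<Rightarrow> ('g \<Rightarrow> 'a) star_alg"
where
  "tensor_O A G T =
     \<lparr>carrier = {F \<in> carrier G \<rightarrow>\<^sub>E carrier A.
        \<exists>(m :: nat) a f. (\<forall>k<m. a k \<in> carrier A \<and> f k \<in> representative_functions G T) \<and>
          (\<forall>g\<in>carrier G. F g = (\<Oplus>\<^bsub>A\<^esub>k\<in>{..<m}. f k g \<odot>\<^bsub>A\<^esub> a k))},
      monoid.mult = (\<lambda>F F'. \<lambda>g\<in>carrier G. F g \<otimes>\<^bsub>A\<^esub> F' g),
      one = undefined,
      zero = (\<lambda>g\<in>carrier G. \<zero>\<^bsub>A\<^esub>),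
      add = (\<lambda>F F'. \<lambda>g\<in>carrier G. F g \<oplus>\<^bsub>A\<^esub> F' g),
      smult = (\<lambda>c F. \<lambda>g\<in>carrier G. c \<odot>\<^bsub>A\<^esub> F g),
      invol = (\<lambda>F. \<lambda>g\<in>carrier G. invol A (F g))\<rparr>"

text \<open>
  In the same way the twofold tensor product of \<open>A\<close> with \<open>\<O>(G)\<close> consists of functions of two
  variables \<open>(g, h)\<close>.  With the comultiplication \<open>(\<Delta> f)(g, h) = f (g h)\<close> and the counit
  \<open>\<epsilon> f = f 1\<close>, the element \<open>(id \<otimes> \<Delta>) F\<close> is \<open>(g, h) \<mapsto> F (g h)\<close>, \<open>(\<rho> \<otimes> id) F\<close> is
  \<open>(g, h) \<mapsto> \<rho> (F h) g\<close>, and \<open>(id \<otimes> \<epsilon>) F\<close> is \<open>F 1\<close>.  The last two conditions below are thus the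
  coassociativity and counit axioms of a right comodule.
\<close>

definition G_star_algebra ::
  "('g, 'k) monoid_scheme \<Rightarrow> 'g topology \<Rightarrow> ('a, 'm) star_alg_scheme \<Rightarrow> ('a \<Rightarrow> 'g \<Rightarrow> 'a) \<Rightarrow> bool"
where
  "G_star_algebra G T A \<rho> \<longleftrightarrow>
     star_algebra A \<and> \<rho> \<in> star_hom A (tensor_O A G T) \<and>
     (\<forall>a\<in>carrier A. \<forall>g\<in>carrier G. \<forall>h\<in>carrier G. \<rho> a (g \<otimes>\<^bsub>G\<^esub> h) = \<rho> (\<rho> a h) g) \<and>
     (\<forall>a\<in>carrier A. \<rho> a \<one>\<^bsub>G\<^esub> = a)"

definition coaction_action :: "('a \<Rightarrow> 'g \<Rightarrow> 'a) \<Rightarrow> 'g \<Rightarrow> 'a \<Rightarrow> 'a" where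
  "coaction_action \<rho> g a = \<rho> a g"

definition invariant_subalgebra ::
  "('g, 'k) monoid_scheme \<Rightarrow> 'a star_alg \<Rightarrow> ('g \<Rightarrow> 'a \<Rightarrow> 'a) \<Rightarrow> 'a star_alg"
where
  "invariant_subalgebra G A \<alpha> = A\<lparr>carrier := {a \<in> carrier A. \<forall>g\<in>carrier G. \<alpha> g a = a}\<rparr>"

definition G_cstar_algebra ::
  "('g, 'k) monoid_scheme \<Rightarrow> 'g topology \<Rightarrow> ('a, 'm) cstar_alg_scheme \<Rightarrow> ('g \<Rightarrow> 'a \<Rightarrow> 'a) \<Rightarrow> bool"
where
  "G_cstar_algebra G T N \<alpha> \<longleftrightarrow>
     cstar_algebra N \<and>
     (\<forall>g\<in>carrier G. \<alpha> g \<in> star_hom N N \<and> bij_betw (\<alpha> g) (carrier N) (carrier N)) \<and>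
     (\<forall>x\<in>carrier N. \<alpha> \<one>\<^bsub>G\<^esub> x = x) \<and>
     (\<forall>g\<in>carrier G. \<forall>h\<in>carrier G. \<forall>x\<in>carrier N. \<alpha> (g \<otimes>\<^bsub>G\<^esub> h) x = \<alpha> g (\<alpha> h x)) \<and>
     (\<forall>x\<in>carrier N. continuous_map T (Metric_space.mtopology (carrier N) (cdist N)) (\<lambda>g. \<alpha> g x))"

definition equivariant_hom ::
  "('g, 'k) monoid_scheme \<Rightarrow> ('a, 'm) star_alg_scheme \<Rightarrow> ('g \<Rightarrow> 'a \<Rightarrow> 'a) \<Rightarrow>
   ('b, 'n) star_alg_scheme \<Rightarrow> ('g \<Rightarrow> 'b \<Rightarrow> 'b) \<Rightarrow> ('a \<Rightarrow> 'b) \<Rightarrow> bool"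
where
  "equivariant_hom G A \<alpha> B \<beta> h \<longleftrightarrow>
     h \<in> star_hom A B \<and> (\<forall>g\<in>carrier G. \<forall>a\<in>carrier A. h (\<alpha> g a) = \<beta> g (h a))"

definition equivariant_iso ::
  "('g, 'k) monoid_scheme \<Rightarrow> ('a, 'm) star_alg_scheme \<Rightarrow> ('g \<Rightarrow> 'a \<Rightarrow> 'a) \<Rightarrow>
   ('b, 'n) star_alg_scheme \<Rightarrow> ('g \<Rightarrow> 'b \<Rightarrow> 'b) \<Rightarrow> ('a \<Rightarrow> 'b) \<Rightarrow> bool"
where
  "equivariant_iso G A \<alpha> B \<beta> h \<longleftrightarrow>
     equivariant_hom G A \<alpha> B \<beta> h \<and> bij_betw h (carrier A) (carrier B)"

definition equivariant_square ::
  "('g, 'k) monoid_scheme \<Rightarrow> ('a, 'm) star_alg_scheme \<Rightarrow> ('g \<Rightarrow> 'a \<Rightarrow> 'a) \<Rightarrow>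
   ('b, 'n) star_alg_scheme \<Rightarrow> ('g \<Rightarrow> 'b \<Rightarrow> 'b) \<Rightarrow> ('c, 'o) star_alg_scheme \<Rightarrow> ('g \<Rightarrow> 'c \<Rightarrow> 'c) \<Rightarrow>
   ('d, 'q) star_alg_scheme \<Rightarrow> ('g \<Rightarrow> 'd \<Rightarrow> 'd) \<Rightarrow>
   ('a \<Rightarrow> 'd) \<Rightarrow> ('b \<Rightarrow> 'd) \<Rightarrow> ('c \<Rightarrow> 'a) \<Rightarrow> ('c \<Rightarrow> 'b) \<Rightarrow> bool"
where
  "equivariant_square G A \<alpha> B \<beta> C \<gamma> D \<delta> l r p q \<longleftrightarrow>
     equivariant_hom G A \<alpha> D \<delta> l \<and> equivariant_hom G B \<beta> D \<delta> r \<and>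
     equivariant_hom G C \<gamma> A \<alpha> p \<and> equivariant_hom G C \<gamma> B \<beta> q \<and>
     (\<forall>c\<in>carrier C. l (p c) = r (q c))"

definition equivariant_pullback ::
  "('g, 'k) monoid_scheme \<Rightarrow> ('a, 'm) star_alg_scheme \<Rightarrow> ('g \<Rightarrow> 'a \<Rightarrow> 'a) \<Rightarrow>
   ('b, 'n) star_alg_scheme \<Rightarrow> ('g \<Rightarrow> 'b \<Rightarrow> 'b) \<Rightarrow> ('c, 'o) star_alg_scheme \<Rightarrow> ('g \<Rightarrow> 'c \<Rightarrow> 'c) \<Rightarrow>
   ('d, 'q) star_alg_scheme \<Rightarrow> ('g \<Rightarrow> 'd \<Rightarrow> 'd) \<Rightarrow>
   ('a \<Rightarrow> 'd) \<Rightarrow> ('b \<Rightarrow> 'd) \<Rightarrow> ('c \<Rightarrow> 'a) \<Rightarrow> ('c \<Rightarrow> 'b) \<Rightarrow> bool"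
where
  "equivariant_pullback G A \<alpha> B \<beta> C \<gamma> D \<delta> l r p q \<longleftrightarrow>
     equivariant_square G A \<alpha> B \<beta> C \<gamma> D \<delta> l r p q \<and>
     equivariant_iso G C \<gamma> (fibre_product A B l r) (\<lambda>g (a, b). (\<alpha> g a, \<beta> g b)) (\<lambda>c. (p c, q c))"

definition completion_action ::
  "('a, 'm) star_alg_scheme \<Rightarrow> ('a \<Rightarrow> 'g \<Rightarrow> 'a) \<Rightarrow> 'u cstar_alg \<Rightarrow> ('a \<Rightarrow> 'u) \<Rightarrow> 'g \<Rightarrow> 'u \<Rightarrow> 'u"
where
  "completion_action M \<rho> Mbar i g = completion_map M Mbar i Mbar i (coaction_action \<rho> g)"

end

theory Submission
  imports Defs
begin

text \<open>
  The canonical map from \<open>Cbar\<close> to the fibre product of \<open>Abar\<close> and \<open>Bbar\<close> is isometric: let \<open>\<nu>\<close> be the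
  norm of the image, and suppose a self-adjoint \<open>h\<close> in \<open>C\<close> has \<open>\<parallel>h\<parallel> = 1\<close> but \<open>\<nu> h = t < 1\<close>.  The orbit of
  \<open>h ^ (2 N)\<close> lies in a finite-dimensional subspace of \<open>C\<close>, so its convex hull has a \<open>G\<close>-fixed point
  \<open>e\<close> in \<open>C\<close> in its closure.  On finite-dimensional *-subalgebras, hence on the AF algebra of invariants, \<open>\<nu>\<close> is
  the norm, so \<open>\<parallel>e\<parallel> \<le> t ^ (2 N)\<close>.  On the other hand the elements of the orbit are positive of norm
  \<open>1\<close>, so \<open>\<parallel>e\<parallel>\<close> is at least the inverse of a multiple of the number of sets of small diameter needed to
  cover the orbit, and this number grows only polynomially in \<open>N\<close> because the orbit of \<open>h\<close> is
  finite-dimensional.  The map has dense range since the kernel of \<open>rbar\<close> is the closure of the kernel of \<open>r\<close>: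
  \<open>D\<close> maps to the quotient C*-algebra of \<open>Bbar\<close> by that closure, hence so does \<open>Dbar\<close>.
\<close>

text \<open>A C*-norm on C need not be unique, as only the invariants are AF; a gap between
  \<open>\<nu>\<close> and the norm has to be moved into the invariants. Averaging does this but may
  shrink a positive element, and powers are taken because only an exponential gap survives a
  polynomial loss. The coaction takes values in the algebraic tensor product, which makes orbits
  finite-dimensional. Besides the count of pieces this keeps the fixed point in C itself: the AF
  hypothesis says nothing about invariants of the completion. Injectivity into the completions makes
  \<open>\<nu>\<close> definite on the image of C only, which suffices to compare norms on
  finite-dimensional subspaces of that image. Spectral theory is replaced by unitaries: for
  self-adjoint h of norm below 1 and s = sqrt (1 - h^2), the elements s \<plusminus> i h of the
  unitization act isometrically by left multiplication, and h and 1 - 2 h^2 are averages of such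
  isometries. Haar measure is replaced by iterated midpoints of orbit points, whose displacement
  under the group tends to 0.\<close>

lemma carrier_ring_of_type_algebra [simp]: "carrier (ring_of_type_algebra :: complex ring) = UNIV"
  and mult_ring_of_type_algebra [simp]: "x \<otimes>\<^bsub>ring_of_type_algebra\<^esub> y = (x * y :: complex)"
  and add_ring_of_type_algebra [simp]: "x \<oplus>\<^bsub>ring_of_type_algebra\<^esub> y = (x + y :: complex)"
  and one_ring_of_type_algebra [simp]: "\<one>\<^bsub>ring_of_type_algebra\<^esub> = (1 :: complex)"
  and zero_ring_of_type_algebra [simp]: "\<zero>\<^bsub>ring_of_type_algebra\<^esub> = (0 :: complex)"
  by (simp_all add: ring_of_type_algebra_def)

section \<open>Linear arithmetic in *-algebras without unit\<close>

context star_algebra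
begin

declare mult_closed [simp, intro] invol_closed [simp, intro] invol_invol [simp]

lemma scale_closed [simp, intro]: "x \<in> carrier A \<Longrightarrow> c \<odot> x \<in> carrier A"
  by (rule smult_closed) auto

lemma scale_left_distrib: "x \<in> carrier A \<Longrightarrow> (c + d) \<odot> x = c \<odot> x \<oplus> d \<odot> x"
  using smult_l_distr[of c d x] by simp

lemma scale_right_distrib:
  "\<lbrakk>x \<in> carrier A; y \<in> carrier A\<rbrakk> \<Longrightarrow> c \<odot> (x \<oplus> y) = c \<odot> x \<oplus> c \<odot> y"
  by (rule smult_r_distr) auto

lemma scale_scale: "x \<in> carrier A \<Longrightarrow> c \<odot> (d \<odot> x) = (c * d) \<odot> x"
  using smult_assoc1[of c d x] by simp

lemma scale_one [simp]: "x \<in> carrier A \<Longrightarrow> 1 \<odot> x = x"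
  using smult_one[of x] by simp

lemma scale_zero_left [simp]: "x \<in> carrier A \<Longrightarrow> 0 \<odot> x = \<zero>"
  using smult_l_null[of x] by simp

lemma scale_zero_right [simp]: "c \<odot> \<zero> = \<zero>"
  by (rule smult_r_null) auto

lemma neg_eq_scale: "x \<in> carrier A \<Longrightarrow> \<ominus> x = (-1) \<odot> x"
  by (rule minus_equality) (use scale_left_distrib[of x "-1" 1] in auto)

lemma diff_eq_scale: "\<lbrakk>x \<in> carrier A; y \<in> carrier A\<rbrakk> \<Longrightarrow> x \<ominus> y = x \<oplus> (-1) \<odot> y"
  by (simp add: a_minus_def neg_eq_scale)

lemma mult_zero_right [simp]: "x \<in> carrier A \<Longrightarrow> x \<otimes> \<zero> = \<zero>"
  using smult_mult_r[of x \<zero> 0] by simp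

lemma mult_zero_left [simp]: "x \<in> carrier A \<Longrightarrow> \<zero> \<otimes> x = \<zero>"
  using smult_mult_l[of \<zero> x 0] by simp

lemma invol_zero [simp]: "invol A \<zero> = \<zero>"
  using invol_smult[of \<zero> 0] by simp

lemma diff_closed [simp, intro]: "\<lbrakk>x \<in> carrier A; y \<in> carrier A\<rbrakk> \<Longrightarrow> x \<ominus> y \<in> carrier A"
  by (simp add: diff_eq_scale)

text \<open>
  Identities between linear combinations of five vectors are checked on coefficients: the map
  \<open>L\<close> below sends coefficients to the linear combination.
\<close>

definition coefficients :: "(complex \<Rightarrow> complex \<Rightarrow> complex \<Rightarrow> complex \<Rightarrow> complex \<Rightarrow> 'a) \<Rightarrow> 'a \<Rightarrow> 'a \<Rightarrow> 'a \<Rightarrow> 'a \<Rightarrow> 'a \<Rightarrow> bool"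
where
  "coefficients L x y z w v \<longleftrightarrow>
     (\<forall>a b c d e. L a b c d e \<in> carrier A) \<and>
     (\<forall>a b c d e a' b' c' d' e'.
        L a b c d e \<oplus> L a' b' c' d' e' = L (a + a') (b + b') (c + c') (d + d') (e + e')) \<and>
     (\<forall>a b c d e a' b' c' d' e'.
        L a b c d e \<ominus> L a' b' c' d' e' = L (a - a') (b - b') (c - c') (d - d') (e - e')) \<and>
     (\<forall>k a b c d e. k \<odot> L a b c d e = L (k * a) (k * b) (k * c) (k * d) (k * e)) \<and>
     x = L 1 0 0 0 0 \<and> y = L 0 1 0 0 0 \<and> z = L 0 0 1 0 0 \<and> w = L 0 0 0 1 0 \<and> v = L 0 0 0 0 1 \<and> \<zero> = L 0 0 0 0 0"

lemma coefficients_ex: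
  assumes "x \<in> carrier A" "y \<in> carrier A" "z \<in> carrier A" "w \<in> carrier A" "v \<in> carrier A"
  obtains L where "coefficients L x y z w v"
proof -
  define L where "L a b c d e = a \<odot> x \<oplus> b \<odot> y \<oplus> c \<odot> z \<oplus> d \<odot> w \<oplus> e \<odot> v" for a b c d e
  have cl: "L a b c d e \<in> carrier A" for a b c d e using assms by (simp add: L_def)
  have ad: "L a b c d e \<oplus> L a' b' c' d' e' = L (a + a') (b + b') (c + c') (d + d') (e + e')" for a b c d e a' b' c' d' e'
    using assms by (simp add: L_def scale_left_distrib a_ac)
  have sc: "k \<odot> L a b c d e = L (k * a) (k * b) (k * c) (k * d) (k * e)" for k a b c d e
    using assms by (simp add: L_def scale_right_distrib scale_scale)
  have df: "L a b c d e \<ominus> L a' b' c' d' e' = L (a - a') (b - b') (c - c') (d - d') (e - e')" for a b c d e a' b' c' d' e'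
    by (simp add: diff_eq_scale cl sc ad)
  have "x = L 1 0 0 0 0 \<and> y = L 0 1 0 0 0 \<and> z = L 0 0 1 0 0 \<and> w = L 0 0 0 1 0 \<and> v = L 0 0 0 0 1 \<and> \<zero> = L 0 0 0 0 0"
    using assms by (simp add: L_def)
  then have "coefficients L x y z w v"
    using cl ad sc df unfolding coefficients_def by simp
  then show thesis by (rule that)
qed

text \<open>Facts 1 to 4 move the operations into the coefficients, facts 5 to 9 rewrite the five
  vectors. Uses with fewer vectors repeat one of them. Nested products are rewritten from the
  longest down, because rewriting a shorter one first would destroy the longer term that contains
  it.\<close>

lemma coefficientsD:
  assumes "coefficients L x y z w v"
  shows "\<And>a b c d e. L a b c d e \<in> carrier A"
    and "\<And>a b c d e a' b' c' d' e'.
      L a b c d e \<oplus> L a' b' c' d' e' = L (a + a') (b + b') (c + c') (d + d') (e + e')"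
    and "\<And>a b c d e a' b' c' d' e'.
      L a b c d e \<ominus> L a' b' c' d' e' = L (a - a') (b - b') (c - c') (d - d') (e - e')"
    and "\<And>k a b c d e. k \<odot> L a b c d e = L (k * a) (k * b) (k * c) (k * d) (k * e)"
    and "x = L 1 0 0 0 0" "y = L 0 1 0 0 0" "z = L 0 0 1 0 0" "w = L 0 0 0 1 0" "v = L 0 0 0 0 1" "\<zero> = L 0 0 0 0 0"
  using assms unfolding coefficients_def by simp_all

lemma diff_mult_left:
  "\<lbrakk>x \<in> carrier A; y \<in> carrier A; z \<in> carrier A\<rbrakk> \<Longrightarrow> (x \<ominus> y) \<otimes> z = x \<otimes> z \<ominus> y \<otimes> z"
  by (simp add: diff_eq_scale distr_l smult_mult_l)

lemma diff_mult_right: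
  "\<lbrakk>x \<in> carrier A; y \<in> carrier A; z \<in> carrier A\<rbrakk> \<Longrightarrow> x \<otimes> (y \<ominus> z) = x \<otimes> y \<ominus> x \<otimes> z"
  by (simp add: diff_eq_scale distr_r smult_mult_r)

lemma invol_diff:
  "\<lbrakk>x \<in> carrier A; y \<in> carrier A\<rbrakk> \<Longrightarrow> invol A (x \<ominus> y) = invol A x \<ominus> invol A y"
  by (simp add: diff_eq_scale invol_add invol_smult)

lemma diff_self [simp]: "x \<in> carrier A \<Longrightarrow> x \<ominus> x = \<zero>"
  by (simp add: a_minus_def r_neg)

lemma diff_zero [simp]: "x \<in> carrier A \<Longrightarrow> x \<ominus> \<zero> = x"
  by (simp add: diff_eq_scale)

lemma diff_add_cancel [simp]: "\<lbrakk>x \<in> carrier A; y \<in> carrier A\<rbrakk> \<Longrightarrow> x \<ominus> y \<oplus> y = x"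
  by (simp add: a_minus_def a_assoc l_neg)

lemma add_diff_cancel [simp]: "\<lbrakk>x \<in> carrier A; y \<in> carrier A\<rbrakk> \<Longrightarrow> x \<oplus> y \<ominus> y = x"
  by (simp add: a_minus_def a_assoc r_neg)

lemma diff_eq_zero_iff: "\<lbrakk>x \<in> carrier A; y \<in> carrier A\<rbrakk> \<Longrightarrow> x \<ominus> y = \<zero> \<longleftrightarrow> x = y"
  by (metis diff_add_cancel diff_self l_zero)

lemma scale_diff:
  "\<lbrakk>x \<in> carrier A; y \<in> carrier A\<rbrakk> \<Longrightarrow> c \<odot> (x \<ominus> y) = c \<odot> x \<ominus> c \<odot> y"
  by (simp add: diff_eq_scale scale_right_distrib scale_scale)

lemma star_subalgebraI:
  assumes "F \<subseteq> carrier A" "\<zero> \<in> F" "\<And>x y. x \<in> F \<Longrightarrow> y \<in> F \<Longrightarrow> x \<oplus> y \<in> F"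
    "\<And>c x. x \<in> F \<Longrightarrow> c \<odot> x \<in> F" "\<And>x y. x \<in> F \<Longrightarrow> y \<in> F \<Longrightarrow> x \<otimes> y \<in> F"
    "\<And>x. x \<in> F \<Longrightarrow> invol A x \<in> F"
  shows "star_subalgebra F A"
proof -
  have "\<ominus> x \<in> F" if "x \<in> F" for x
    using assms that by (simp add: neg_eq_scale subset_iff)
  then show ?thesis
    unfolding star_subalgebra_def using assms by (auto intro!: submoduleI)
qed

lemma star_subalgebraD:
  assumes "star_subalgebra F A"
  shows "F \<subseteq> carrier A" and "\<zero> \<in> F" and "\<And>x y. x \<in> F \<Longrightarrow> y \<in> F \<Longrightarrow> x \<oplus> y \<in> F"
    and "\<And>c x. x \<in> F \<Longrightarrow> c \<odot> x \<in> F" and "\<And>x y. x \<in> F \<Longrightarrow> y \<in> F \<Longrightarrow> x \<otimes> y \<in> F"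
    and "\<And>x. x \<in> F \<Longrightarrow> invol A x \<in> F"
proof -
  have S: "submodule F (ring_of_type_algebra :: complex ring) A"
    using assms by (simp add: star_subalgebra_def)
  note E = submoduleE[OF S]
  show "F \<subseteq> carrier A" "\<And>x y. x \<in> F \<Longrightarrow> y \<in> F \<Longrightarrow> x \<oplus> y \<in> F" "\<And>c x. x \<in> F \<Longrightarrow> c \<odot> x \<in> F"
    using E by auto
  show "\<zero> \<in> F" using E(1,2) E(4)[of 0] scale_zero_left by fastforce
  show "\<And>x y. x \<in> F \<Longrightarrow> y \<in> F \<Longrightarrow> x \<otimes> y \<in> F" "\<And>x. x \<in> F \<Longrightarrow> invol A x \<in> F"
    using assms by (auto simp: star_subalgebra_def)
qed

end

section \<open>Homomorphisms, images and subalgebras\<close>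

lemma star_algebraI:
  fixes A (structure)
  assumes "\<zero> \<in> carrier A" "\<And>x y. \<lbrakk>x \<in> carrier A; y \<in> carrier A\<rbrakk> \<Longrightarrow> x \<oplus> y \<in> carrier A"
    and "\<And>x y z. \<lbrakk>x \<in> carrier A; y \<in> carrier A; z \<in> carrier A\<rbrakk> \<Longrightarrow> (x \<oplus> y) \<oplus> z = x \<oplus> (y \<oplus> z)"
    and "\<And>x y. \<lbrakk>x \<in> carrier A; y \<in> carrier A\<rbrakk> \<Longrightarrow> x \<oplus> y = y \<oplus> x"
    and "\<And>x. x \<in> carrier A \<Longrightarrow> \<zero> \<oplus> x = x"
    and "\<And>c x. x \<in> carrier A \<Longrightarrow> c \<odot> x \<in> carrier A"
    and "\<And>x. x \<in> carrier A \<Longrightarrow> 0 \<odot> x = \<zero>"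
    and "\<And>x. x \<in> carrier A \<Longrightarrow> 1 \<odot> x = x"
    and "\<And>c d x. x \<in> carrier A \<Longrightarrow> (c + d) \<odot> x = c \<odot> x \<oplus> d \<odot> x"
    and "\<And>c d x. x \<in> carrier A \<Longrightarrow> (c * d) \<odot> x = c \<odot> (d \<odot> x)"
    and "\<And>c x y. \<lbrakk>x \<in> carrier A; y \<in> carrier A\<rbrakk> \<Longrightarrow> c \<odot> (x \<oplus> y) = c \<odot> x \<oplus> c \<odot> y"
    and "star_algebra_axioms A"
  shows "star_algebra A"
proof -
  have "abelian_group A"
  proof (rule abelian_groupI)
    fix x assume x: "x \<in> carrier A"
    \<comment> \<open>The scalar axioms supply the additive inverse, so the rule asks for
      none.\<close>
    have "(-1) \<odot> x \<oplus> x = (-1 + 1) \<odot> x"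
      using x assms(8,9) by presburger
    with x show "\<exists>y\<in>carrier A. y \<oplus> x = \<zero>" using assms(6,7)[of x] by auto
  qed (use assms in auto)
  then have "module (ring_of_type_algebra :: complex ring) A"
    using assms cring_from_type_algebra
    by (intro moduleI) auto
  with assms show ?thesis by (simp add: star_algebra_def)
qed

lemma star_homD:
  assumes "h \<in> star_hom A B"
  shows "\<And>x. x \<in> carrier A \<Longrightarrow> h x \<in> carrier B"
    and "\<And>x y. \<lbrakk>x \<in> carrier A; y \<in> carrier A\<rbrakk> \<Longrightarrow> h (x \<oplus>\<^bsub>A\<^esub> y) = h x \<oplus>\<^bsub>B\<^esub> h y"
    and "\<And>c x. x \<in> carrier A \<Longrightarrow> h (c \<odot>\<^bsub>A\<^esub> x) = c \<odot>\<^bsub>B\<^esub> h x"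
    and "\<And>x y. \<lbrakk>x \<in> carrier A; y \<in> carrier A\<rbrakk> \<Longrightarrow> h (x \<otimes>\<^bsub>A\<^esub> y) = h x \<otimes>\<^bsub>B\<^esub> h y"
    and "\<And>x. x \<in> carrier A \<Longrightarrow> h (invol A x) = invol B (h x)"
  using assms by (auto simp: star_hom_def)

lemma star_homI:
  assumes "\<And>x. x \<in> carrier A \<Longrightarrow> h x \<in> carrier B"
    and "\<And>x y. \<lbrakk>x \<in> carrier A; y \<in> carrier A\<rbrakk> \<Longrightarrow> h (x \<oplus>\<^bsub>A\<^esub> y) = h x \<oplus>\<^bsub>B\<^esub> h y"
    and "\<And>c x. x \<in> carrier A \<Longrightarrow> h (c \<odot>\<^bsub>A\<^esub> x) = c \<odot>\<^bsub>B\<^esub> h x"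
    and "\<And>x y. \<lbrakk>x \<in> carrier A; y \<in> carrier A\<rbrakk> \<Longrightarrow> h (x \<otimes>\<^bsub>A\<^esub> y) = h x \<otimes>\<^bsub>B\<^esub> h y"
    and "\<And>x. x \<in> carrier A \<Longrightarrow> h (invol A x) = invol B (h x)"
  shows "h \<in> star_hom A B"
  using assms by (auto simp: star_hom_def)

lemma star_hom_cong:
  assumes "h \<in> star_hom A B" "star_algebra A" "\<And>x. x \<in> carrier A \<Longrightarrow> h' x = h x"
  shows "h' \<in> star_hom A B"
proof -
  interpret star_algebra A by fact
  show ?thesis using assms(1,3) by (auto simp: star_hom_def Pi_iff)
qed

lemma star_hom_diff:
  assumes "star_algebra A" "star_algebra B" "h \<in> star_hom A B" "x \<in> carrier A" "y \<in> carrier A"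
  shows "h (x \<ominus>\<^bsub>A\<^esub> y) = h x \<ominus>\<^bsub>B\<^esub> h y"
proof -
  interpret A: star_algebra A by fact
  interpret B: star_algebra B by fact
  show ?thesis using assms(4,5) star_homD[OF assms(3)] by (simp add: A.diff_eq_scale B.diff_eq_scale)
qed

lemma star_hom_zero:
  assumes "star_algebra A" "star_algebra B" "h \<in> star_hom A B"
  shows "h \<zero>\<^bsub>A\<^esub> = \<zero>\<^bsub>B\<^esub>"
proof -
  interpret A: star_algebra A by fact
  interpret B: star_algebra B by fact
  show ?thesis using star_homD[OF assms(3)] A.scale_zero_left[OF A.zero_closed] B.scale_zero_left
    by (metis A.zero_closed)
qed

text \<open>\<open>star_hom\<close> compares operations without presupposing any axiom for B, so
  every identity of A can be pushed along the surjection. The zero of B is matched separately, since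
  additivity cannot identify it before B is known to be a group. The quotient by an ideal is
  obtained in this way.\<close>

lemma star_algebra_image:
  assumes "star_algebra A" and h: "h \<in> star_hom A B" and surj: "h ` carrier A = carrier B"
    and zero: "h \<zero>\<^bsub>A\<^esub> = \<zero>\<^bsub>B\<^esub>"
  shows "star_algebra B"
proof -
  interpret A: star_algebra A by fact
  note hom = star_homD(2-5)[OF h, symmetric]
  show ?thesis
    by (intro star_algebraI star_algebra_axioms.intro; unfold surj[symmetric]; clarify?;
        simp add: hom zero[symmetric] A.a_ac A.mult_assoc A.distr_l A.distr_r A.scale_scale
          A.scale_left_distrib A.scale_right_distrib A.smult_mult_l A.smult_mult_r A.invol_add
          A.invol_smult A.invol_mult)
qed

lemma (in star_algebra) star_algebra_subalgebra:
  assumes "star_subalgebra F A"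
  shows "star_algebra (A\<lparr>carrier := F\<rparr>)"
proof -
  note D = star_subalgebraD[OF assms]
  have [simp]: "x \<in> carrier A" if "x \<in> F" for x using D(1) that by auto
  show ?thesis
    by (intro star_algebraI star_algebra_axioms.intro)
      (use D in \<open>auto simp: a_ac mult_assoc distr_l distr_r scale_scale
          scale_left_distrib scale_right_distrib smult_mult_l smult_mult_r invol_add
          invol_smult invol_mult\<close>)
qed

text \<open>The completeness axiom of a C*-algebra is stated through this metric, so the metric is
  built from the norm axioms alone; subalgebras and quotients use it before they are known to be
  C*-algebras.\<close>

lemma Metric_space_cdist:
  fixes N (structure)
  assumes "star_algebra N"
    and nonneg: "\<And>x. x \<in> carrier N \<Longrightarrow> 0 \<le> cnorm N x"
    and eq_0: "\<And>x. x \<in> carrier N \<Longrightarrow> cnorm N x = 0 \<longleftrightarrow> x = \<zero>"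
    and triangle: "\<And>x y. \<lbrakk>x \<in> carrier N; y \<in> carrier N\<rbrakk> \<Longrightarrow> cnorm N (x \<oplus> y) \<le> cnorm N x + cnorm N y"
    and scale: "\<And>c x. x \<in> carrier N \<Longrightarrow> cnorm N (c \<odot> x) = cmod c * cnorm N x"
  shows "Metric_space (carrier N) (cdist N)"
proof -
  interpret star_algebra N by fact
  show ?thesis
  proof
    fix x y z
    show "0 \<le> cdist N x y" using nonneg by (simp add: cdist_def)
    show "cdist N x y = cdist N y x"
    proof (cases "x \<in> carrier N \<and> y \<in> carrier N")
      case True
      then have xy: "x \<in> carrier N" "y \<in> carrier N" by auto
      obtain L where "coefficients L x y x y y" using coefficients_ex[OF xy xy xy(2)] .
  note L = coefficientsD[OF this]
      have "x \<ominus> y = (-1) \<odot> (y \<ominus> x)" by (simp add: L)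
      with True show ?thesis by (simp add: cdist_def scale)
    qed (auto simp: cdist_def)
    assume x: "x \<in> carrier N" and y: "y \<in> carrier N"
    then show "cdist N x y = 0 \<longleftrightarrow> x = y" by (simp add: cdist_def eq_0 diff_eq_zero_iff)
    assume z: "z \<in> carrier N"
    obtain L where "coefficients L x y z z z" using coefficients_ex[OF x y z z z] .
  note L = coefficientsD[OF this]
    have "x \<ominus> z = (x \<ominus> y) \<oplus> (y \<ominus> z)" by (simp add: L)
    with x y z show "cdist N x z \<le> cdist N x y + cdist N y z"
      by (simp add: cdist_def triangle)
  qed
qed

lemma mcomplete_cdist_iff:
  fixes N (structure)
  assumes "star_algebra N" and MS: "Metric_space (carrier N) (cdist N)"
  shows "Metric_space.mcomplete (carrier N) (cdist N) \<longleftrightarrow>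
    (\<forall>s. (\<forall>n. s n \<in> carrier N) \<longrightarrow>
      (\<forall>e>0. \<exists>M. \<forall>m\<ge>M. \<forall>n\<ge>M. cnorm N (s m \<ominus> s n) < e) \<longrightarrow>
      (\<exists>x\<in>carrier N. (\<lambda>n. cnorm N (s n \<ominus> x)) \<longlonglongrightarrow> 0))" (is "_ \<longleftrightarrow> ?R")
proof -
  interpret M: Metric_space "carrier N" "cdist N" by fact
  have C: "M.MCauchy s \<longleftrightarrow> (\<forall>e>0. \<exists>M. \<forall>m\<ge>M. \<forall>n\<ge>M. cnorm N (s m \<ominus> s n) < e)"
    if "\<forall>n. s n \<in> carrier N" for s
  proof -
    have "range s \<subseteq> carrier N" "\<And>m n. cdist N (s m) (s n) = cnorm N (s m \<ominus> s n)"
      using that by (auto simp: cdist_def)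
    then show ?thesis by (simp add: M.MCauchy_def)
  qed
  have L: "limitin M.mtopology s x sequentially \<longleftrightarrow> x \<in> carrier N \<and> (\<lambda>n. cnorm N (s n \<ominus> x)) \<longlonglongrightarrow> 0"
    if "\<forall>n. s n \<in> carrier N" for s x
    using that by (auto simp: M.limitin_metric_dist_null cdist_def)
  have "M.mcomplete \<longleftrightarrow> (\<forall>s. (\<forall>n. s n \<in> carrier N) \<longrightarrow> M.MCauchy s \<longrightarrow>
      (\<exists>x. limitin M.mtopology s x sequentially))"
    unfolding M.mcomplete_def M.MCauchy_def by blast
  also have "\<dots> \<longleftrightarrow> ?R"
    using C L by (simp add: Bex_def cong: imp_cong)
  finally show ?thesis .
qed

section \<open>Limits of sequences, closures and closed subalgebras\<close>

context cstar_algebra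
begin

declare norm_nonneg [simp]

lemma Metric_space: "Metric_space (carrier N) (cdist N)"
  using star_algebra_axioms norm_nonneg norm_eq_0 norm_triangle norm_smult
  by (intro Metric_space_cdist) auto

lemma norm_zero [simp]: "cnorm N \<zero> = 0"
  by (simp add: norm_eq_0)

lemma norm_diff_commute: "\<lbrakk>x \<in> carrier N; y \<in> carrier N\<rbrakk> \<Longrightarrow> cnorm N (x \<ominus> y) = cnorm N (y \<ominus> x)"
  using Metric_space.commute[OF Metric_space, of x y] by (simp add: cdist_def)

lemma norm_diff_triangle:
  "\<lbrakk>x \<in> carrier N; y \<in> carrier N; z \<in> carrier N\<rbrakk> \<Longrightarrow>
    cnorm N (x \<ominus> z) \<le> cnorm N (x \<ominus> y) + cnorm N (y \<ominus> z)"
  using Metric_space.triangle[OF Metric_space, of x y z] by (simp add: cdist_def)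

lemma norm_le_diff_add:
  "\<lbrakk>x \<in> carrier N; y \<in> carrier N\<rbrakk> \<Longrightarrow> cnorm N x \<le> cnorm N (x \<ominus> y) + cnorm N y"
  using norm_triangle[of "x \<ominus> y" y] by simp

lemma norm_diff_le:
  "\<lbrakk>x \<in> carrier N; y \<in> carrier N\<rbrakk> \<Longrightarrow> cnorm N (x \<ominus> y) \<le> cnorm N x + cnorm N y"
  using norm_triangle[of x "(-1) \<odot> y"] by (simp add: diff_eq_scale norm_smult)

lemma norm_abs_diff_le:
  "\<lbrakk>x \<in> carrier N; y \<in> carrier N\<rbrakk> \<Longrightarrow> \<bar>cnorm N x - cnorm N y\<bar> \<le> cnorm N (x \<ominus> y)"
  using norm_le_diff_add[of x y] norm_le_diff_add[of y x] by (simp add: norm_diff_commute)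

lemma norm_add_diff_add:
  assumes "x \<in> carrier N" "y \<in> carrier N" "x' \<in> carrier N" "y' \<in> carrier N"
  shows "cnorm N ((x \<oplus> y) \<ominus> (x' \<oplus> y')) \<le> cnorm N (x \<ominus> x') + cnorm N (y \<ominus> y')"
proof -
  obtain L where "coefficients L x y x' y' y'" using coefficients_ex[OF assms assms(4)] .
  note L = coefficientsD[OF this]
  have "(x \<oplus> y) \<ominus> (x' \<oplus> y') = (x \<ominus> x') \<oplus> (y \<ominus> y')" by (simp add: L)
  with assms show ?thesis by (simp add: norm_triangle)
qed

lemma norm_diff_diff_diff:
  assumes "x \<in> carrier N" "y \<in> carrier N" "x' \<in> carrier N" "y' \<in> carrier N"
  shows "cnorm N ((x \<ominus> y) \<ominus> (x' \<ominus> y')) \<le> cnorm N (x \<ominus> x') + cnorm N (y \<ominus> y')"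
proof -
  obtain L where "coefficients L x y x' y' y'" using coefficients_ex[OF assms assms(4)] .
  note L = coefficientsD[OF this]
  have "(x \<ominus> y) \<ominus> (x' \<ominus> y') = (x \<ominus> x') \<ominus> (y \<ominus> y')" by (simp add: L)
  with assms show ?thesis by (simp add: norm_diff_le)
qed

lemma norm_mult_diff_mult:
  assumes "x \<in> carrier N" "y \<in> carrier N" "x' \<in> carrier N" "y' \<in> carrier N"
  shows "cnorm N (x \<otimes> y \<ominus> x' \<otimes> y') \<le> cnorm N (x \<ominus> x') * cnorm N y + cnorm N x' * cnorm N (y \<ominus> y')"
proof -
  have "cnorm N (x \<otimes> y \<ominus> x' \<otimes> y') \<le> cnorm N (x \<otimes> y \<ominus> x' \<otimes> y) + cnorm N (x' \<otimes> y \<ominus> x' \<otimes> y')"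
    using assms by (intro norm_diff_triangle) auto
  also have "\<dots> \<le> cnorm N (x \<ominus> x') * cnorm N y + cnorm N x' * cnorm N (y \<ominus> y')"
    using assms by (intro add_mono) (metis diff_closed diff_mult_left diff_mult_right norm_mult)+
  finally show ?thesis .
qed

lemma norm_invol [simp]:
  assumes "x \<in> carrier N"
  shows "cnorm N (invol N x) = cnorm N x"
proof -
  \<comment> \<open>The C*-identity and submultiplicativity bound the square of the norm of y by the
    product of the norms of \<open>invol N y\<close> and y. Exchanging the two elements then gives
    equality.\<close>
  have le: "cnorm N y \<le> cnorm N (invol N y)" if y: "y \<in> carrier N" for y
  proof (cases "cnorm N y = 0")
    case False
    have "cnorm N y * cnorm N y \<le> cnorm N (invol N y) * cnorm N y"
      using cstar_identity[OF y] norm_mult[of "invol N y" y] y by (simp add: power2_eq_square)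
    with False show ?thesis using norm_nonneg[OF y] by (simp add: mult_le_cancel_right)
  qed (use y in simp)
  show ?thesis using le[OF assms] le[of "invol N x"] assms by simp
qed

lemma norm_square:
  "\<lbrakk>h \<in> carrier N; invol N h = h\<rbrakk> \<Longrightarrow> cnorm N (h \<otimes> h) = (cnorm N h)\<^sup>2"
  using cstar_identity[of h] by simp

text \<open>Membership of all terms and of the limit is built in, so that the limit laws compose
  without side conditions.\<close>

definition tends :: "(nat \<Rightarrow> 'a) \<Rightarrow> 'a \<Rightarrow> bool" where
  "tends s x \<longleftrightarrow> (\<forall>n. s n \<in> carrier N) \<and> x \<in> carrier N \<and> (\<lambda>n. cnorm N (s n \<ominus> x)) \<longlonglongrightarrow> 0"

lemma tendsD:
  assumes "tends s x"
  shows "s n \<in> carrier N" "x \<in> carrier N" "(\<lambda>n. cnorm N (s n \<ominus> x)) \<longlonglongrightarrow> 0"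
  using assms by (auto simp: tends_def)

lemma tendsI:
  assumes "\<And>n. s n \<in> carrier N" "x \<in> carrier N" "\<And>n. cnorm N (s n \<ominus> x) \<le> f n" "f \<longlonglongrightarrow> 0"
  shows "tends s x"
  unfolding tends_def using assms
  by (auto intro!: tendsto_sandwich[OF _ _ tendsto_const assms(4)])

lemma tends_const [simp]: "x \<in> carrier N \<Longrightarrow> tends (\<lambda>n. x) x"
  by (simp add: tends_def)

lemma tends_add:
  assumes "tends s x" "tends t y"
  shows "tends (\<lambda>n. s n \<oplus> t n) (x \<oplus> y)"
  using tendsD[OF assms(1)] tendsD[OF assms(2)]
  by (intro tendsI[of _ _ "\<lambda>n. cnorm N (s n \<ominus> x) + cnorm N (t n \<ominus> y)"])
    (auto simp: norm_add_diff_add intro!: tendsto_add_zero)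

lemma tends_diff:
  assumes "tends s x" "tends t y"
  shows "tends (\<lambda>n. s n \<ominus> t n) (x \<ominus> y)"
  using tendsD[OF assms(1)] tendsD[OF assms(2)]
  by (intro tendsI[of _ _ "\<lambda>n. cnorm N (s n \<ominus> x) + cnorm N (t n \<ominus> y)"])
    (auto simp: norm_diff_diff_diff intro!: tendsto_add_zero)

lemma tends_scale:
  assumes "tends s x"
  shows "tends (\<lambda>n. c \<odot> s n) (c \<odot> x)"
  using tendsD[OF assms]
  by (intro tendsI[of _ _ "\<lambda>n. cmod c * cnorm N (s n \<ominus> x)"])
    (auto simp: scale_diff[symmetric] norm_smult intro!: tendsto_mult_right_zero)

lemma tends_invol:
  assumes "tends s x"
  shows "tends (\<lambda>n. invol N (s n)) (invol N x)"
  using tendsD[OF assms]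
  by (intro tendsI[of _ _ "\<lambda>n. cnorm N (s n \<ominus> x)"]) (auto simp: invol_diff[symmetric])

lemma tends_norm:
  assumes "tends s x"
  shows "(\<lambda>n. cnorm N (s n)) \<longlonglongrightarrow> cnorm N x"
proof -
  have "(\<lambda>n. cnorm N (s n) - cnorm N x) \<longlonglongrightarrow> 0"
    by (rule Lim_null_comparison[OF _ tendsD(3)[OF assms]])
      (use tendsD[OF assms] norm_abs_diff_le in auto)
  then show ?thesis by (simp add: LIM_zero_iff)
qed

lemma tends_mult:
  assumes "tends s x" "tends t y"
  shows "tends (\<lambda>n. s n \<otimes> t n) (x \<otimes> y)"
proof -
  note D = tendsD[OF assms(1)] tendsD[OF assms(2)]
  have "(\<lambda>n. cnorm N (s n \<ominus> x) * cnorm N (t n) + cnorm N x * cnorm N (t n \<ominus> y))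
      \<longlonglongrightarrow> 0 * cnorm N y + cnorm N x * 0"
    by (intro tendsto_intros D tends_norm assms)
  with D show ?thesis
    by (intro tendsI[of _ _ "\<lambda>n. cnorm N (s n \<ominus> x) * cnorm N (t n) + cnorm N x * cnorm N (t n \<ominus> y)"])
      (auto simp: norm_mult_diff_mult)
qed

lemma tends_unique:
  assumes "tends s x" "tends s y"
  shows "x = y"
proof -
  note D = tendsD[OF assms(1)] tendsD[OF assms(2)]
  have "tends (\<lambda>n. s n \<ominus> s n) (x \<ominus> y)" by (rule tends_diff[OF assms])
  from tends_norm[OF this] have "(\<lambda>n. 0) \<longlonglongrightarrow> cnorm N (x \<ominus> y)" using D by simp
  then have "cnorm N (x \<ominus> y) = 0" by (simp add: LIMSEQ_const_iff)
  then show ?thesis using D by (simp add: norm_eq_0 diff_eq_zero_iff)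
qed

lemma tends_Suc: "tends s x \<Longrightarrow> tends (\<lambda>n. s (Suc n)) x"
  unfolding tends_def by (auto intro: LIMSEQ_Suc)

lemma Cauchy_tends:
  assumes "\<And>n. s n \<in> carrier N"
    and "\<And>e. e > 0 \<Longrightarrow> \<exists>M. \<forall>m\<ge>M. \<forall>n\<ge>M. cnorm N (s m \<ominus> s n) < e"
  obtains x where "tends s x"
proof -
  have "\<exists>x\<in>carrier N. (\<lambda>n. cnorm N (s n \<ominus> x)) \<longlonglongrightarrow> 0"
    using complete[unfolded mcomplete_cdist_iff[OF star_algebra_axioms Metric_space], rule_format, of s]
      assms by blast
  with assms(1) that show thesis by (auto simp: tends_def)
qed

lemma geometric_tends:
  assumes s: "\<And>n. s n \<in> carrier N"
    and step: "\<And>n. cnorm N (s (Suc n) \<ominus> s n) \<le> K * r ^ n" and r: "0 \<le> r" "r < 1"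
  obtains x where "tends s x"
proof (rule Cauchy_tends[OF s])
  fix e :: real assume e: "e > 0"
  have K: "0 \<le> K" using step[of 0] norm_nonneg[OF diff_closed[OF s s], of "Suc 0" 0] by simp
  \<comment> \<open>The right-hand side is the sum of \<open>K * r ^ j\<close> over
    \<open>n \<le> j < n + k\<close>; this closed form carries the induction on k.\<close>
  have bd: "cnorm N (s (n + k) \<ominus> s n) \<le> K * r ^ n / (1 - r) - K * r ^ (n + k) / (1 - r)" for n k
  proof (induction k)
    case (Suc k)
    have "cnorm N (s (n + Suc k) \<ominus> s n) \<le> cnorm N (s (Suc (n + k)) \<ominus> s (n + k)) + cnorm N (s (n + k) \<ominus> s n)"
      using norm_diff_triangle[of "s (Suc (n + k))" "s (n + k)" "s n"] s by simp
    also have "\<dots> \<le> K * r ^ (n + k) + (K * r ^ n / (1 - r) - K * r ^ (n + k) / (1 - r))"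
      using step Suc.IH by (rule add_mono)
    also have "\<dots> = K * r ^ n / (1 - r) - K * r ^ (n + Suc k) / (1 - r)"
    proof -
      have "K * u = K * u / (1 - r) - K * (r * u) / (1 - r)" for u
        using r by (simp add: diff_divide_distrib[symmetric] nonzero_eq_divide_eq algebra_simps)
      from this[of "r ^ (n + k)"] show ?thesis by simp
    qed
    finally show ?case .
  qed (use s in simp)
  have bd': "cnorm N (s m \<ominus> s n) \<le> K * r ^ n / (1 - r)" if "n \<le> m" for m n
    using bd[of n "m - n"] that r K by (smt (verit) le_add_diff_inverse zero_le_divide_iff zero_le_mult_iff zero_le_power)
  have "(\<lambda>n. K * r ^ n / (1 - r)) \<longlonglongrightarrow> K * 0 / (1 - r)"
    using r by (intro tendsto_intros LIMSEQ_realpow_zero) auto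
  then have "\<forall>\<^sub>F n in sequentially. K * r ^ n / (1 - r) < e"
    using e by (intro order_tendstoD) auto
  then obtain M where M: "\<And>n. n \<ge> M \<Longrightarrow> K * r ^ n / (1 - r) < e" by (auto simp: eventually_sequentially)
  show "\<exists>M. \<forall>m\<ge>M. \<forall>n\<ge>M. cnorm N (s m \<ominus> s n) < e"
  proof (intro exI[of _ M] allI impI)
    fix m n assume mn: "M \<le> m" "M \<le> n"
    show "cnorm N (s m \<ominus> s n) < e"
      using bd'[of n m] bd'[of m n] M[OF mn(1)] M[OF mn(2)] norm_diff_commute[OF s s, of m n]
      by (cases "n \<le> m") auto
  qed
qed

definition closure_set :: "'a set \<Rightarrow> 'a set" where
  "closure_set S = {x \<in> carrier N. \<forall>e>0. \<exists>y\<in>S. cnorm N (x \<ominus> y) < e}"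

lemma closure_set_iff:
  assumes "S \<subseteq> carrier N"
  shows "x \<in> closure_set S \<longleftrightarrow> (\<exists>s. (\<forall>n. s n \<in> S) \<and> tends s x)"
proof
  assume x: "x \<in> closure_set S"
  then have xN: "x \<in> carrier N" by (simp add: closure_set_def)
  have "\<exists>y\<in>S. cnorm N (x \<ominus> y) < inverse (real (Suc n))" for n
    using x unfolding closure_set_def by simp
  then obtain s where s: "\<And>n. s n \<in> S" "\<And>n. cnorm N (x \<ominus> s n) < inverse (real (Suc n))" by metis
  have "tends s x"
  proof (rule tendsI[OF _ xN _ LIMSEQ_inverse_real_of_nat])
    fix n show sn: "s n \<in> carrier N" using s assms by auto
    show "cnorm N (s n \<ominus> x) \<le> inverse (real (Suc n))"
      using s(2)[of n] norm_diff_commute[OF xN sn] by simp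
  qed
  with s show "\<exists>s. (\<forall>n. s n \<in> S) \<and> tends s x" by auto
next
  assume "\<exists>s. (\<forall>n. s n \<in> S) \<and> tends s x"
  then obtain s where s: "\<And>n. s n \<in> S" "tends s x" by auto
  note D = tendsD[OF s(2)]
  show "x \<in> closure_set S"
    unfolding closure_set_def
  proof (intro CollectI conjI allI impI)
    fix e :: real assume "e > 0"
    then have "\<forall>\<^sub>F n in sequentially. cnorm N (s n \<ominus> x) < e"
      using D(3) by (intro order_tendstoD) auto
    then obtain n where "cnorm N (s n \<ominus> x) < e" by (auto simp: eventually_sequentially)
    then show "\<exists>y\<in>S. cnorm N (x \<ominus> y) < e" using s(1) D(1,2) by (metis norm_diff_commute)
  qed (rule D)
qed

lemma closure_set_closed:
  assumes "S \<subseteq> carrier N" "\<And>n. s n \<in> closure_set S" "tends s x"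
  shows "x \<in> closure_set S"
  unfolding closure_set_def
proof (intro CollectI conjI allI impI)
  note D = tendsD[OF assms(3)]
  fix e :: real assume e: "e > 0"
  then have "\<forall>\<^sub>F n in sequentially. cnorm N (s n \<ominus> x) < e / 2"
    using D(3) by (intro order_tendstoD) auto
  then obtain n where n: "cnorm N (s n \<ominus> x) < e / 2" by (auto simp: eventually_sequentially)
  obtain y where y: "y \<in> S" "cnorm N (s n \<ominus> y) < e / 2"
    using assms(2)[of n] e unfolding closure_set_def by (auto dest!: spec[of _ "e/2"])
  have "cnorm N (x \<ominus> y) \<le> cnorm N (x \<ominus> s n) + cnorm N (s n \<ominus> y)"
    using D y assms(1) by (intro norm_diff_triangle) auto
  also have "\<dots> < e" using n y D by (simp add: norm_diff_commute)
  finally show "\<exists>y\<in>S. cnorm N (x \<ominus> y) < e" using y by auto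
qed (use assms(3) in \<open>simp add: tends_def\<close>)

lemma closure_set_superset: "S \<subseteq> carrier N \<Longrightarrow> S \<subseteq> closure_set S"
  by (force simp: closure_set_def)

lemma closure_set_subset: "closure_set S \<subseteq> carrier N"
  by (auto simp: closure_set_def)

lemma star_subalgebra_closure_set:
  assumes "star_subalgebra F N"
  shows "star_subalgebra (closure_set F) N"
proof -
  note D = star_subalgebraD[OF assms]
  note iff = closure_set_iff[OF D(1)]
  show ?thesis
  proof (rule star_subalgebraI[OF closure_set_subset])
    show "\<zero> \<in> closure_set F" using closure_set_superset[OF D(1)] D(2) by blast
    fix x y assume x: "x \<in> closure_set F" and y: "y \<in> closure_set F"
    obtain s where s: "\<forall>n. s n \<in> F" "tends s x" using iff[THEN iffD1, OF x] by (elim exE conjE)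
    obtain t where t: "\<forall>n. t n \<in> F" "tends t y" using iff[THEN iffD1, OF y] by (elim exE conjE)
    show "x \<oplus> y \<in> closure_set F"
      unfolding iff using s t D(3) tends_add[OF s(2) t(2)] by (intro exI[of _ "\<lambda>n. s n \<oplus> t n"]) auto
    show "x \<otimes> y \<in> closure_set F"
      unfolding iff using s t D(5) tends_mult[OF s(2) t(2)] by (intro exI[of _ "\<lambda>n. s n \<otimes> t n"]) auto
  next
    fix x assume x: "x \<in> closure_set F"
    obtain s where s: "\<forall>n. s n \<in> F" "tends s x" using iff[THEN iffD1, OF x] by (elim exE conjE)
    show "c \<odot> x \<in> closure_set F" for c
      unfolding iff using s D(4) tends_scale[OF s(2), of c] by (intro exI[of _ "\<lambda>n. c \<odot> s n"]) auto
    show "invol N x \<in> closure_set F"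
      unfolding iff using s D(6) tends_invol[OF s(2)] by (intro exI[of _ "\<lambda>n. invol N (s n)"]) auto
  qed
qed

text \<open>Subtraction goes through an inverse chosen within the carrier, so shrinking the carrier
  does not preserve it by definition. Multiplication by -1 gives its value in both algebras.\<close>

lemma diff_subalgebra:
  assumes "star_subalgebra F N" "x \<in> F" "y \<in> F"
  shows "x \<ominus>\<^bsub>N\<lparr>carrier := F\<rparr>\<^esub> y = x \<ominus> y"
proof -
  interpret F: star_algebra "N\<lparr>carrier := F\<rparr>" by (rule star_algebra_subalgebra) fact
  show ?thesis using assms star_subalgebraD(1)[OF assms(1)] F.diff_eq_scale[of x y]
    by (subst diff_eq_scale) auto
qed

lemma cstar_algebra_subalgebra:
  assumes F: "star_subalgebra F N" and closed: "\<And>s x. (\<And>n. s n \<in> F) \<Longrightarrow> tends s x \<Longrightarrow> x \<in> F"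
  shows "cstar_algebra (N\<lparr>carrier := F\<rparr>)"
proof -
  let ?F = "N\<lparr>carrier := F\<rparr>"
  note D = star_subalgebraD[OF F]
  have [simp]: "x \<in> carrier N" if "x \<in> F" for x using D(1) that by auto
  interpret F: star_algebra ?F by (rule star_algebra_subalgebra) fact
  have MS: "Metric_space (carrier ?F) (cdist ?F)"
    by (rule Metric_space_cdist[OF F.star_algebra_axioms])
      (auto simp: norm_eq_0 norm_triangle norm_smult)
  have "Metric_space.mcomplete (carrier ?F) (cdist ?F)"
    unfolding mcomplete_cdist_iff[OF F.star_algebra_axioms MS]
  proof (intro allI impI)
    fix s :: "nat \<Rightarrow> 'a" assume s: "\<forall>n. s n \<in> carrier ?F"
      and C: "\<forall>e>0. \<exists>M. \<forall>m\<ge>M. \<forall>n\<ge>M. cnorm ?F (s m \<ominus>\<^bsub>?F\<^esub> s n) < e"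
    have "\<exists>M. \<forall>m\<ge>M. \<forall>n\<ge>M. cnorm N (s m \<ominus> s n) < e" if "e > 0" for e
      using C that s by (simp add: diff_subalgebra[OF F])
    moreover have "s n \<in> carrier N" for n using s by simp
    ultimately obtain x where x: "tends s x" using Cauchy_tends by blast
    then have "x \<in> F" using closed[of s] s by simp
    with x show "\<exists>x\<in>carrier ?F. (\<lambda>n. cnorm ?F (s n \<ominus>\<^bsub>?F\<^esub> x)) \<longlonglongrightarrow> 0"
      using s by (auto simp: tends_def diff_subalgebra[OF F])
  qed
  then show ?thesis
    by (intro cstar_algebra.intro cstar_algebra_axioms.intro F.star_algebra_axioms)
      (auto simp: norm_eq_0 norm_triangle norm_smult norm_mult cstar_identity)
qed

end

section \<open>Unitary pairs and norm bounds for self-adjoint elements\<close>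

lemma le_of_forall_scaling:
  fixes a b K :: real
  assumes "\<And>s. 0 < s \<Longrightarrow> s < 1 \<Longrightarrow> a \<le> b + (1 - s) * K"
  shows "a \<le> b"
proof -
  have "((\<lambda>s. b + (1 - s) * K) \<longlongrightarrow> b + (1 - 1) * K) (at_left 1)"
    by (intro tendsto_intros)
  moreover have "\<forall>\<^sub>F s in at_left 1. a \<le> b + (1 - s) * K"
    unfolding eventually_at_left_field using assms by (intro exI[of _ 0]) auto
  ultimately show ?thesis
    using tendsto_lowerbound[of "\<lambda>s. b + (1 - s) * K" b "at_left (1::real)" a] by simp
qed

text \<open>
  With \<open>s = 1 - b\<close> in the unitization, the relations say that \<open>s\<close> is a self-adjoint square root of
  \<open>1 - h\<^sup>2\<close> commuting with \<open>h\<close>; then \<open>s \<plusminus> i h\<close> is unitary.  They are preserved by *-homomorphisms.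
\<close>

definition unitary_pair :: "('a, 'm) star_alg_scheme \<Rightarrow> 'a \<Rightarrow> 'a \<Rightarrow> bool" where
  "unitary_pair N h b \<longleftrightarrow> h \<in> carrier N \<and> b \<in> carrier N \<and> invol N h = h \<and> invol N b = b \<and>
     h \<otimes>\<^bsub>N\<^esub> b = b \<otimes>\<^bsub>N\<^esub> h \<and> h \<otimes>\<^bsub>N\<^esub> h \<oplus>\<^bsub>N\<^esub> b \<otimes>\<^bsub>N\<^esub> b = 2 \<odot>\<^bsub>N\<^esub> b"

lemma unitary_pair_hom:
  assumes "f \<in> star_hom M N" "unitary_pair M h b" "star_algebra M"
  shows "unitary_pair N (f h) (f b)"
proof -
  interpret star_algebra M by fact
  note f = star_homD[OF assms(1)]
  from assms(2) have h: "h \<in> carrier M" and b: "b \<in> carrier M" by (auto simp: unitary_pair_def)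
  have "f (h \<otimes>\<^bsub>M\<^esub> h \<oplus>\<^bsub>M\<^esub> b \<otimes>\<^bsub>M\<^esub> b) = f (2 \<odot>\<^bsub>M\<^esub> b)" "f (h \<otimes>\<^bsub>M\<^esub> b) = f (b \<otimes>\<^bsub>M\<^esub> h)"
      "f (invol M h) = f h" "f (invol M b) = f b"
    using assms(2) by (auto simp: unitary_pair_def)
  then show ?thesis
    unfolding unitary_pair_def using h b by (simp add: f)
qed

context cstar_algebra
begin

text \<open>The square relation says b = (h^2 + b^2) / 2. For \<rho> the norm of h, the map y
  \<mapsto> (h^2 + y^2) / 2 sends the ball of radius \<rho> < 1 into itself and is \<rho>-Lipschitz
  there. Iteration from 0 converges geometrically, and self-adjointness and commutation with h pass
  to the limit.\<close>

lemma unitary_pair_ex: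
  assumes h: "h \<in> carrier N" "invol N h = h" and less: "cnorm N h < 1"
  obtains b where "unitary_pair N h b"
proof -
  define s where "s = rec_nat \<zero> (\<lambda>_ y. (1/2) \<odot> (h \<otimes> h \<oplus> y \<otimes> y))"
  have s0: "s 0 = \<zero>" and sS: "s (Suc n) = (1/2) \<odot> (h \<otimes> h \<oplus> s n \<otimes> s n)" for n
    by (simp_all add: s_def)
  define \<rho> where "\<rho> = cnorm N h"
  have \<rho>: "0 \<le> \<rho>" "\<rho> < 1" using h less by (auto simp: \<rho>_def)
  have inv: "s n \<in> carrier N \<and> invol N (s n) = s n \<and> h \<otimes> s n = s n \<otimes> h \<and> cnorm N (s n) \<le> \<rho>" for n
  proof (induction n)
    case (Suc n)
    then have n: "s n \<in> carrier N" "invol N (s n) = s n" "h \<otimes> s n = s n \<otimes> h" "cnorm N (s n) \<le> \<rho>" by auto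
    have c: "h \<otimes> (s n \<otimes> s n) = (s n \<otimes> s n) \<otimes> h"
      using n h mult_assoc[of h "s n" "s n"] mult_assoc[of "s n" h "s n"] mult_assoc[of "s n" "s n" h]
      by simp
    have "cnorm N (h \<otimes> h \<oplus> s n \<otimes> s n) \<le> cnorm N (h \<otimes> h) + cnorm N (s n \<otimes> s n)"
      using h n by (simp add: norm_triangle)
    also have "\<dots> \<le> \<rho>\<^sup>2 + \<rho>\<^sup>2"
      using h n power_mono[OF n(4) norm_nonneg[OF n(1)], of 2] by (simp add: norm_square \<rho>_def)
    also have "\<dots> \<le> 2 * \<rho>" using \<rho> by (simp add: power2_eq_square mult_left_le)
    finally have "cnorm N (s (Suc n)) \<le> \<rho>" using h n by (simp add: sS norm_smult)
    moreover have "h \<otimes> (h \<otimes> h) = (h \<otimes> h) \<otimes> h" using h by (simp add: mult_assoc)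
    ultimately show ?case
      using h n c by (simp add: sS invol_smult invol_add invol_mult smult_mult_l smult_mult_r distr_l distr_r)
  qed (use h \<rho> in \<open>auto simp: s0\<close>)
  then have s: "s n \<in> carrier N" for n by simp
  have step: "cnorm N (s (Suc n) \<ominus> s n) \<le> 1 * \<rho> ^ n" for n
  proof (induction n)
    case 0
    have "cnorm N (s (Suc 0)) \<le> 1" using inv[of "Suc 0"] \<rho> by simp
    then show ?case using s[of "Suc 0"] by (simp add: s0)
  next
    case (Suc n)
    have cl: "s n \<otimes> s n \<in> carrier N" "s (Suc n) \<otimes> s (Suc n) \<in> carrier N" "h \<otimes> h \<in> carrier N"
      using s h by auto
    obtain L where "coefficients L (h \<otimes> h) (s n \<otimes> s n) (s (Suc n) \<otimes> s (Suc n)) (h \<otimes> h) (h \<otimes> h)"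
      using coefficients_ex[OF cl(3,1,2,3,3)] .
    note L = coefficientsD[OF this]
    have "s (Suc (Suc n)) \<ominus> s (Suc n) = (1/2) \<odot> (s (Suc n) \<otimes> s (Suc n) \<ominus> s n \<otimes> s n)"
      unfolding sS[of "Suc n"] by (subst (3) sS) (simp add: L(1-4) L(5-))
    then have "cnorm N (s (Suc (Suc n)) \<ominus> s (Suc n)) = (1/2) * cnorm N (s (Suc n) \<otimes> s (Suc n) \<ominus> s n \<otimes> s n)"
      using cl by (simp add: norm_smult)
    also have "\<dots> \<le> (1/2) * (cnorm N (s (Suc n) \<ominus> s n) * cnorm N (s (Suc n)) + cnorm N (s n) * cnorm N (s (Suc n) \<ominus> s n))"
      using norm_mult_diff_mult[OF s s s s, of "Suc n" "Suc n" n n] by simp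
    also have "\<dots> \<le> (1/2) * (\<rho> ^ n * \<rho> + \<rho> * \<rho> ^ n)"
      using Suc inv s \<rho> by (intro mult_left_mono add_mono mult_mono) auto
    finally show ?case by simp
  qed
  obtain b where b: "tends s b" using geometric_tends[OF s step \<rho>] .
  have bN: "b \<in> carrier N" by (rule tendsD[OF b])
  have "tends (\<lambda>n. s n) (invol N b)" using tends_invol[OF b] inv by simp
  then have b1: "invol N b = b" using b tends_unique by blast
  have "tends (\<lambda>n. h \<otimes> s n) (h \<otimes> b)" "tends (\<lambda>n. s n \<otimes> h) (b \<otimes> h)"
    using tends_mult[OF tends_const b] tends_mult[OF b tends_const] h by auto
  moreover have "(\<lambda>n. s n \<otimes> h) = (\<lambda>n. h \<otimes> s n)" using inv by auto
  ultimately have b2: "h \<otimes> b = b \<otimes> h" using tends_unique by metis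
  have "tends (\<lambda>n. (1/2) \<odot> (h \<otimes> h \<oplus> s n \<otimes> s n)) ((1/2) \<odot> (h \<otimes> h \<oplus> b \<otimes> b))"
    using h by (intro tends_scale tends_add tends_mult b tends_const) auto
  then have "(1/2) \<odot> (h \<otimes> h \<oplus> b \<otimes> b) = b"
    using tends_Suc[OF b] tends_unique unfolding sS by blast
  then have "2 \<odot> b = 2 \<odot> ((1/2) \<odot> (h \<otimes> h \<oplus> b \<otimes> b))" by simp
  also have "\<dots> = h \<otimes> h \<oplus> b \<otimes> b" using h bN by (simp add: scale_scale)
  finally show thesis using that[of b] h b1 b2 bN by (simp add: unitary_pair_def)
qed

context
  fixes h b assumes hb: "unitary_pair N h b"
begin

lemma unitary_pairD:
  shows h_closed: "h \<in> carrier N" and b_closed: "b \<in> carrier N" and h_selfadjoint: "invol N h = h"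
    and b_selfadjoint: "invol N b = b" and hb_commute: "h \<otimes> b = b \<otimes> h"
    and hb_square: "h \<otimes> h \<oplus> b \<otimes> b = 2 \<odot> b"
  using hb by (auto simp: unitary_pair_def)

text \<open>Rewriting to normal form: in a word in h and b applied to x, every b moves to the
  outside and at most one h remains.\<close>

lemma unitary_pair_apply:
  assumes x: "x \<in> carrier N"
  shows "h \<otimes> (b \<otimes> x) = b \<otimes> (h \<otimes> x)" and "h \<otimes> (h \<otimes> x) = 2 \<odot> (b \<otimes> x) \<ominus> b \<otimes> (b \<otimes> x)"
proof -
  show "h \<otimes> (b \<otimes> x) = b \<otimes> (h \<otimes> x)"
    using x by (simp add: mult_assoc[symmetric] h_closed b_closed hb_commute)
  have "h \<otimes> (h \<otimes> x) \<oplus> b \<otimes> (b \<otimes> x) = (h \<otimes> h \<oplus> b \<otimes> b) \<otimes> x"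
    using x by (simp add: distr_l mult_assoc h_closed b_closed)
  also have "\<dots> = 2 \<odot> (b \<otimes> x)" using x by (simp add: hb_square smult_mult_l b_closed)
  finally show "h \<otimes> (h \<otimes> x) = 2 \<odot> (b \<otimes> x) \<ominus> b \<otimes> (b \<otimes> x)"
    using x add_diff_cancel[of "h \<otimes> (h \<otimes> x)" "b \<otimes> (b \<otimes> x)"] by (simp add: h_closed b_closed)
qed

text \<open>The vector is v = u x for u = 1 - b + c h in the unitization, where u* u = (1 - b)^2 +
  h^2 = 1. Hence v* v = x* x, and the C*-identity gives equal norms.\<close>

lemma norm_unitary_apply:
  assumes x: "x \<in> carrier N" and c: "c = \<i> \<or> c = - \<i>"
  shows "cnorm N (x \<ominus> b \<otimes> x \<oplus> c \<odot> (h \<otimes> x)) = cnorm N x"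
proof -
  note [simp] = h_closed b_closed x
  define v where "v = x \<ominus> b \<otimes> x \<oplus> c \<odot> (h \<otimes> x)"
  have v [simp]: "v \<in> carrier N" by (simp add: v_def)
  have bv: "b \<otimes> v = b \<otimes> x \<ominus> b \<otimes> (b \<otimes> x) \<oplus> c \<odot> (b \<otimes> (h \<otimes> x))"
    by (simp add: v_def distr_r diff_mult_right smult_mult_r)
  have hv: "h \<otimes> v = h \<otimes> x \<ominus> b \<otimes> (h \<otimes> x) \<oplus> c \<odot> (2 \<odot> (b \<otimes> x) \<ominus> b \<otimes> (b \<otimes> x))"
    by (simp add: v_def distr_r diff_mult_right smult_mult_r unitary_pair_apply)
  have "x \<in> carrier N" "b \<otimes> x \<in> carrier N" "b \<otimes> (b \<otimes> x) \<in> carrier N" "h \<otimes> x \<in> carrier N"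
      "b \<otimes> (h \<otimes> x) \<in> carrier N" by simp_all
  from coefficients_ex[OF this] obtain L where
    "coefficients L x (b \<otimes> x) (b \<otimes> (b \<otimes> x)) (h \<otimes> x) (b \<otimes> (h \<otimes> x))" .
  note L = coefficientsD[OF this]
  have "v \<ominus> b \<otimes> v \<oplus> cnj c \<odot> (h \<otimes> v) = x"
    using c unfolding bv hv unfolding v_def unfolding L(7,9) unfolding L(6,8) unfolding L(5) by (auto simp: L(1-4))
  then have *: "invol N x \<otimes> (v \<ominus> b \<otimes> v \<oplus> cnj c \<odot> (h \<otimes> v)) = invol N x \<otimes> x" by simp
  have "invol N v \<otimes> v = (invol N x \<ominus> invol N x \<otimes> b \<oplus> cnj c \<odot> (invol N x \<otimes> h)) \<otimes> v"
    by (simp add: v_def invol_add invol_diff invol_mult invol_smult h_selfadjoint b_selfadjoint)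
  also have "\<dots> = invol N x \<otimes> (v \<ominus> b \<otimes> v \<oplus> cnj c \<odot> (h \<otimes> v))"
    by (simp add: distr_l distr_r diff_mult_left diff_mult_right smult_mult_l smult_mult_r mult_assoc)
  finally have "(cnorm N v)\<^sup>2 = (cnorm N x)\<^sup>2"
    using cstar_identity[of v] cstar_identity[of x] * by simp
  then show ?thesis by (simp add: v_def[symmetric])
qed

text \<open>Let u and v be the isometries for c = \<i> and c = - \<i>. Then 2 \<i> h = u - v, 2 (1 -
  b) = u + v and 2 (1 - 2 h^2) = u^2 + v^2, so each of the three operators is a contraction.\<close>

lemma unitary_pair_norms:
  assumes x: "x \<in> carrier N"
  shows "cnorm N (h \<otimes> x) \<le> cnorm N x"
    and "cnorm N (x \<ominus> b \<otimes> x) \<le> cnorm N x"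
    and "cnorm N (x \<ominus> 2 \<odot> (h \<otimes> (h \<otimes> x))) \<le> cnorm N x"
proof -
  note [simp] = h_closed b_closed x
  define U where "U c y = y \<ominus> b \<otimes> y \<oplus> c \<odot> (h \<otimes> y)" for c y
  have U [simp]: "U c y \<in> carrier N" if "y \<in> carrier N" for c y using that by (simp add: U_def)
  have nU: "cnorm N (U \<i> y) = cnorm N y" "cnorm N (U (- \<i>) y) = cnorm N y" if "y \<in> carrier N" for y
    using norm_unitary_apply[OF that] by (auto simp: U_def)
  have "x \<in> carrier N" "b \<otimes> x \<in> carrier N" "b \<otimes> (b \<otimes> x) \<in> carrier N" "h \<otimes> x \<in> carrier N"
      "b \<otimes> (h \<otimes> x) \<in> carrier N" by simp_all
  from coefficients_ex[OF this] obtain L where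
    "coefficients L x (b \<otimes> x) (b \<otimes> (b \<otimes> x)) (h \<otimes> x) (b \<otimes> (h \<otimes> x))" .
  note L = coefficientsD[OF this]
  have "2 * cnorm N (h \<otimes> x) = cnorm N (U \<i> x \<ominus> U (- \<i>) x)"
  proof -
    have "U \<i> x \<ominus> U (- \<i>) x = (2 * \<i>) \<odot> (h \<otimes> x)"
      unfolding U_def unfolding L(7,9) unfolding L(6,8) unfolding L(5) by (simp add: L(1-4))
    then show ?thesis by (simp add: norm_smult norm_mult)
  qed
  also have "\<dots> \<le> cnorm N (U \<i> x) + cnorm N (U (- \<i>) x)" by (rule norm_diff_le) simp_all
  finally show "cnorm N (h \<otimes> x) \<le> cnorm N x" by (simp add: nU)
  have "2 * cnorm N (x \<ominus> b \<otimes> x) = cnorm N (U \<i> x \<oplus> U (- \<i>) x)"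
  proof -
    have "U \<i> x \<oplus> U (- \<i>) x = 2 \<odot> (x \<ominus> b \<otimes> x)"
      unfolding U_def unfolding L(7,9) unfolding L(6,8) unfolding L(5) by (simp add: L(1-4))
    then show ?thesis by (simp add: norm_smult)
  qed
  also have "\<dots> \<le> cnorm N (U \<i> x) + cnorm N (U (- \<i>) x)" by (rule norm_triangle) simp_all
  finally show "cnorm N (x \<ominus> b \<otimes> x) \<le> cnorm N x" by (simp add: nU)
  have UU: "U c (U c x) = U c x \<ominus> (b \<otimes> x \<ominus> b \<otimes> (b \<otimes> x) \<oplus> c \<odot> (b \<otimes> (h \<otimes> x)))
      \<oplus> c \<odot> (h \<otimes> x \<ominus> b \<otimes> (h \<otimes> x) \<oplus> c \<odot> (2 \<odot> (b \<otimes> x) \<ominus> b \<otimes> (b \<otimes> x)))" for c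
    by (simp add: U_def distr_r diff_mult_right smult_mult_r unitary_pair_apply)
  have "2 * cnorm N (x \<ominus> 2 \<odot> (h \<otimes> (h \<otimes> x))) = cnorm N (U \<i> (U \<i> x) \<oplus> U (- \<i>) (U (- \<i>) x))"
  proof -
    have "U \<i> (U \<i> x) \<oplus> U (- \<i>) (U (- \<i>) x) = 2 \<odot> (x \<ominus> 2 \<odot> (2 \<odot> (b \<otimes> x) \<ominus> b \<otimes> (b \<otimes> x)))"
      unfolding UU unfolding U_def unfolding L(7,9) unfolding L(6,8) unfolding L(5) by (simp add: L(1-4))
    then show ?thesis by (simp add: norm_smult unitary_pair_apply)
  qed
  also have "\<dots> \<le> cnorm N (U \<i> (U \<i> x)) + cnorm N (U (- \<i>) (U (- \<i>) x))" by (rule norm_triangle) simp_all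
  finally show "cnorm N (x \<ominus> 2 \<odot> (h \<otimes> (h \<otimes> x))) \<le> cnorm N x" by (simp add: nU)
qed

text \<open>The first bound at x = h compares the square of the norm of h with the norm itself. The
  mere existence of b thus bounds h, and this existence is inherited by images under
  homomorphisms.\<close>

lemma norm_unitary_pair_le_1: "cnorm N h \<le> 1"
proof (cases "cnorm N h = 0")
  case False
  then have "0 < cnorm N h" using norm_nonneg[OF h_closed] by simp
  moreover have "cnorm N h * cnorm N h \<le> cnorm N h"
    using unitary_pair_norms(1)[OF h_closed] norm_square[OF h_closed h_selfadjoint]
    by (simp add: power2_eq_square)
  ultimately show ?thesis by simp
qed simp

end

lemma norm_diff_double_square_le:
  assumes h: "h \<in> carrier N" "invol N h = h" "cnorm N h \<le> 1" and x: "x \<in> carrier N"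
  shows "cnorm N (x \<ominus> 2 \<odot> (h \<otimes> (h \<otimes> x))) \<le> cnorm N x"
proof (rule le_of_forall_scaling)
  fix s :: real assume s: "0 < s" "s < 1"
  note [simp] = h(1) x
  \<comment> \<open>With t^2 = s the bound for t h involves s h^2, so the error in passing to s = 1
    is linear in 1 - s.\<close>
  define t where "t = complex_of_real (sqrt s)"
  have tt: "t * t = s" using s by (simp add: t_def flip: of_real_mult)
  have ct: "cmod t < 1" using s by (simp add: t_def)
  have "invol N (t \<odot> h) = t \<odot> h" by (simp add: invol_smult h t_def)
  moreover have "cnorm N (t \<odot> h) < 1"
    using ct mult_left_le[OF h(3), of "cmod t"] by (simp add: norm_smult)
  ultimately obtain b where "unitary_pair N (t \<odot> h) b" using unitary_pair_ex[of "t \<odot> h"] by auto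
  from unitary_pair_norms(3)[OF this x]
  have le: "cnorm N (x \<ominus> (2 * s) \<odot> (h \<otimes> (h \<otimes> x))) \<le> cnorm N x"
    by (simp add: smult_mult_l smult_mult_r scale_scale mult.assoc tt)
  have "h \<otimes> (h \<otimes> x) \<in> carrier N" by simp
  from coefficients_ex[OF x this x x x] obtain L where
    "coefficients L x (h \<otimes> (h \<otimes> x)) x x x" .
  note L = coefficientsD[OF this]
  have "x \<ominus> 2 \<odot> (h \<otimes> (h \<otimes> x))
      = (x \<ominus> (2 * s) \<odot> (h \<otimes> (h \<otimes> x))) \<ominus> (2 * (1 - s)) \<odot> (h \<otimes> (h \<otimes> x))"
    unfolding L(6) unfolding L(5) by (simp add: L(1-4) algebra_simps)
  then have "cnorm N (x \<ominus> 2 \<odot> (h \<otimes> (h \<otimes> x)))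
      \<le> cnorm N (x \<ominus> (2 * s) \<odot> (h \<otimes> (h \<otimes> x))) + cnorm N ((2 * (1 - s)) \<odot> (h \<otimes> (h \<otimes> x)))"
    using norm_diff_le[of "x \<ominus> (2 * s) \<odot> (h \<otimes> (h \<otimes> x))" "(2 * (1 - s)) \<odot> (h \<otimes> (h \<otimes> x))"] by simp
  moreover have "cmod (2 * (1 - complex_of_real s)) = 2 * (1 - s)"
    using s norm_of_real[where 'a = complex, of "2 * (1 - s)"] by simp
  ultimately show "cnorm N (x \<ominus> 2 \<odot> (h \<otimes> (h \<otimes> x))) \<le> cnorm N x + (1 - s) * (2 * cnorm N (h \<otimes> (h \<otimes> x)))"
    using le by (simp add: norm_smult left_diff_distrib right_diff_distrib mult_ac)
qed

text \<open>1 - h^2 is the mean of 1 and the contraction 1 - 2 h^2.\<close>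

lemma norm_diff_square_le:
  assumes h: "h \<in> carrier N" "invol N h = h" "cnorm N h \<le> 1" and x: "x \<in> carrier N"
  shows "cnorm N (x \<ominus> h \<otimes> (h \<otimes> x)) \<le> cnorm N x"
proof -
  note [simp] = h(1) x
  have "h \<otimes> (h \<otimes> x) \<in> carrier N" by simp
  from coefficients_ex[OF x this x x x] obtain L where
    "coefficients L x (h \<otimes> (h \<otimes> x)) x x x" .
  note L = coefficientsD[OF this]
  have "2 \<odot> (x \<ominus> h \<otimes> (h \<otimes> x)) = x \<oplus> (x \<ominus> 2 \<odot> (h \<otimes> (h \<otimes> x)))"
    unfolding L(6) unfolding L(5) by (simp add: L(1-4))
  then have "2 * cnorm N (x \<ominus> h \<otimes> (h \<otimes> x)) = cnorm N (x \<oplus> (x \<ominus> 2 \<odot> (h \<otimes> (h \<otimes> x))))"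
    by (metis (no_types) diff_closed h(1) mult_closed norm_numeral norm_smult x)
  also have "\<dots> \<le> cnorm N x + cnorm N (x \<ominus> 2 \<odot> (h \<otimes> (h \<otimes> x)))" by (rule norm_triangle) simp_all
  finally show ?thesis using norm_diff_double_square_le[OF assms] by simp
qed

text \<open>For the contraction T = 1 - 2 h^2 one has 4 (h^2 - h^4) = 1 - T^2, an operator of norm
  at most 2.\<close>

lemma norm_square_diff_fourth_le:
  assumes h: "h \<in> carrier N" "invol N h = h" "cnorm N h \<le> 1" and x: "x \<in> carrier N"
  shows "cnorm N (h \<otimes> (h \<otimes> x) \<ominus> h \<otimes> (h \<otimes> (h \<otimes> (h \<otimes> x)))) \<le> cnorm N x / 2"
proof -
  note [simp] = h(1) x
  define T where "T y = y \<ominus> 2 \<odot> (h \<otimes> (h \<otimes> y))" for y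
  have [simp]: "T y \<in> carrier N" if "y \<in> carrier N" for y using that by (simp add: T_def)
  have T: "cnorm N (T y) \<le> cnorm N y" if "y \<in> carrier N" for y
    unfolding T_def by (rule norm_diff_double_square_le[OF h that])
  have "h \<otimes> (h \<otimes> x) \<in> carrier N" "h \<otimes> (h \<otimes> (h \<otimes> (h \<otimes> x))) \<in> carrier N" by simp_all
  from coefficients_ex[OF x this x x] obtain L where
    "coefficients L x (h \<otimes> (h \<otimes> x)) (h \<otimes> (h \<otimes> (h \<otimes> (h \<otimes> x)))) x x" .
  note L = coefficientsD[OF this]
  have TT: "T (T x) = x \<ominus> 2 \<odot> (h \<otimes> (h \<otimes> x)) \<ominus> 2 \<odot> (h \<otimes> (h \<otimes> x) \<ominus> 2 \<odot> (h \<otimes> (h \<otimes> (h \<otimes> (h \<otimes> x)))))"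
    by (simp add: T_def diff_mult_right smult_mult_r)
  have "4 \<odot> (h \<otimes> (h \<otimes> x) \<ominus> h \<otimes> (h \<otimes> (h \<otimes> (h \<otimes> x)))) = x \<ominus> T (T x)"
    unfolding TT unfolding L(7) unfolding L(6) unfolding L(5) by (simp add: L(1-4))
  moreover have "cnorm N (4 \<odot> (h \<otimes> (h \<otimes> x) \<ominus> h \<otimes> (h \<otimes> (h \<otimes> (h \<otimes> x)))))
      = 4 * cnorm N (h \<otimes> (h \<otimes> x) \<ominus> h \<otimes> (h \<otimes> (h \<otimes> (h \<otimes> x))))"
    by (simp add: norm_smult)
  moreover have "cnorm N (x \<ominus> T (T x)) \<le> cnorm N x + cnorm N (T (T x))" by (rule norm_diff_le) simp_all
  moreover have "cnorm N (T (T x)) \<le> cnorm N x" using T[of "T x"] T[of x] by simp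
  ultimately show ?thesis by simp
qed

end

section \<open>Contractivity of homomorphisms and density in the completion\<close>

theorem star_hom_contractive:
  assumes M: "cstar_algebra M" and N: "cstar_algebra N" and f: "f \<in> star_hom M N" and x: "x \<in> carrier M"
  shows "cnorm N (f x) \<le> cnorm M x"
proof -
  interpret M: cstar_algebra M by fact
  interpret N: cstar_algebra N by fact
  note hom = star_homD[OF f]
  \<comment> \<open>A pair exists in M because the norm is below 1; its relations are algebraic, so
    they hold for the images, and in N they force norm at most 1.\<close>
  have less: "cnorm N (f h) \<le> 1" if h: "h \<in> carrier M" "invol M h = h" "cnorm M h < 1" for h
  proof -
    obtain b where "unitary_pair M h b" using M.unitary_pair_ex[OF h] .
    then have "unitary_pair N (f h) (f b)" by (rule unitary_pair_hom[OF f _ M.star_algebra_axioms])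
    then show ?thesis by (rule N.norm_unitary_pair_le_1)
  qed
  have sa: "cnorm N (f h) \<le> cnorm M h" if h: "h \<in> carrier M" "invol M h = h" for h
  proof (rule dense_ge)
    fix t assume t: "cnorm M h < t"
    then have t0: "0 < t" using M.norm_nonneg[OF h(1)] by linarith
    let ?c = "complex_of_real (1 / t)"
    have "cnorm N (f (?c \<odot>\<^bsub>M\<^esub> h)) \<le> 1"
      using h t t0 by (intro less) (auto simp: M.invol_smult M.norm_smult norm_divide)
    then show "cnorm N (f h) \<le> t"
      using h t0 hom by (simp add: N.norm_smult norm_divide)
  qed
  \<comment> \<open>The general case reduces to the self-adjoint element x* x by the C*-identity on
    both sides.\<close>
  have "(cnorm N (f x))\<^sup>2 = cnorm N (f (invol M x \<otimes>\<^bsub>M\<^esub> x))"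
    using x hom N.cstar_identity[of "f x"] by simp
  also have "\<dots> \<le> cnorm M (invol M x \<otimes>\<^bsub>M\<^esub> x)" using x by (intro sa) (auto simp: M.invol_mult)
  also have "\<dots> = (cnorm M x)\<^sup>2" using x by (rule M.cstar_identity)
  finally show ?thesis using x by (simp add: power2_le_iff_abs_le)
qed

lemma star_hom_tends:
  assumes M: "cstar_algebra M" and N: "cstar_algebra N" and f: "f \<in> star_hom M N"
    and s: "cstar_algebra.tends M s x"
  shows "cstar_algebra.tends N (\<lambda>n. f (s n)) (f x)"
proof -
  interpret M: cstar_algebra M by fact
  interpret N: cstar_algebra N by fact
  note D = M.tendsD[OF s]
  have "cnorm N (f (s n) \<ominus>\<^bsub>N\<^esub> f x) \<le> cnorm M (s n \<ominus>\<^bsub>M\<^esub> x)" for n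
    using star_hom_contractive[OF M N f M.diff_closed[OF D(1,2)]]
      star_hom_diff[OF M.star_algebra_axioms N.star_algebra_axioms f D(1,2)] by simp
  then show ?thesis using D star_homD(1)[OF f] by (intro N.tendsI[of _ _ "\<lambda>n. cnorm M (s n \<ominus>\<^bsub>M\<^esub> x)"]) auto
qed

lemma star_subalgebra_image:
  assumes M: "star_algebra M" and N: "star_algebra N" and f: "f \<in> star_hom M N"
  shows "star_subalgebra (f ` carrier M) N"
proof -
  interpret M: star_algebra M by fact
  interpret N: star_algebra N by fact
  note hom = star_homD[OF f]
  show ?thesis
  proof (rule N.star_subalgebraI)
    show "\<zero>\<^bsub>N\<^esub> \<in> f ` carrier M"
      using star_hom_zero[OF M N f] M.zero_closed by (metis imageI)
  qed (auto simp: hom(1) simp flip: hom(2-5))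
qed

lemma star_hom_restrict:
  assumes "star_algebra M" "f \<in> star_hom M N"
  shows "restrict f (carrier M) \<in> star_hom M N"
  by (rule star_hom_cong[OF assms(2,1)]) simp

text \<open>Uniqueness in the universal property is stated for maps extensional on the carrier, so
  it is applied to the restrictions of f and g.\<close>

lemma completion_hom_eq:
  fixes Mbar N :: "'u cstar_alg"
  assumes M: "is_cstar_completion M Mbar i" and N: "cstar_algebra N"
    and f: "f \<in> star_hom Mbar N" and g: "g \<in> star_hom Mbar N"
    and eq: "\<And>x. x \<in> carrier M \<Longrightarrow> f (i x) = g (i x)" and y: "y \<in> carrier Mbar"
  shows "f y = g y"
proof -
  have Mbar: "cstar_algebra Mbar" and i: "i \<in> star_hom M Mbar" using M by (auto simp: is_cstar_completion_def)
  interpret Mbar: cstar_algebra Mbar by fact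
  have fi: "(\<lambda>x. f (i x)) \<in> star_hom M N" by (rule star_hom_comp[OF i f])
  have "\<exists>!h. h \<in> star_hom Mbar N \<and> h \<in> extensional (carrier Mbar) \<and> (\<forall>x\<in>carrier M. h (i x) = f (i x))"
    using M[unfolded is_cstar_completion_def] N fi by blast
  moreover have "restrict h (carrier Mbar) \<in> star_hom Mbar N \<and>
      restrict h (carrier Mbar) \<in> extensional (carrier Mbar) \<and>
      (\<forall>x\<in>carrier M. restrict h (carrier Mbar) (i x) = f (i x))"
    if "h \<in> star_hom Mbar N" "\<And>x. x \<in> carrier M \<Longrightarrow> f (i x) = h (i x)" for h
    using that star_hom_restrict[OF Mbar.star_algebra_axioms that(1)] star_homD(1)[OF i] by simp
  ultimately have "restrict f (carrier Mbar) = restrict g (carrier Mbar)"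
    using f g eq by blast
  then show ?thesis using y by (metis restrict_apply')
qed

text \<open>The closure K of the image is a C*-algebra in the same type, so the universal property
  yields a homomorphism from \<open>Mbar\<close> into K that fixes the image. Followed by the
  inclusion it agrees with the identity on the image, hence everywhere, and K is all of
  \<open>Mbar\<close>.\<close>

lemma completion_dense:
  fixes Mbar :: "'u cstar_alg"
  assumes M: "is_cstar_completion M Mbar i" and "star_algebra M"
    and y: "y \<in> carrier Mbar" and e: "e > 0"
  obtains x where "x \<in> carrier M" "cnorm Mbar (y \<ominus>\<^bsub>Mbar\<^esub> i x) < e"
proof -
  have Mbar: "cstar_algebra Mbar" and i: "i \<in> star_hom M Mbar" using M by (auto simp: is_cstar_completion_def)
  interpret Mbar: cstar_algebra Mbar by fact
  define S where "S = i ` carrier M"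
  define K where "K = Mbar.closure_set S"
  let ?K = "Mbar\<lparr>carrier := K\<rparr>"
  note iD = star_homD[OF i]
  have S: "star_subalgebra S Mbar"
    unfolding S_def by (rule star_subalgebra_image[OF \<open>star_algebra M\<close> Mbar.star_algebra_axioms i])
  have SM: "S \<subseteq> carrier Mbar" by (rule Mbar.star_subalgebraD(1)[OF S])
  have SK: "S \<subseteq> K" unfolding K_def by (rule Mbar.closure_set_superset[OF SM])
  have KM: "K \<subseteq> carrier Mbar" unfolding K_def by (rule Mbar.closure_set_subset)
  have K: "cstar_algebra ?K"
    using Mbar.star_subalgebra_closure_set[OF S] Mbar.closure_set_closed[OF SM]
    unfolding K_def by (intro Mbar.cstar_algebra_subalgebra) auto
  have iK: "i \<in> star_hom M ?K"
    using SK by (intro star_homI) (auto simp: iD S_def)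
  from M[unfolded is_cstar_completion_def] K iK
  obtain h where h: "h \<in> star_hom Mbar ?K" "\<And>x. x \<in> carrier M \<Longrightarrow> h (i x) = i x" by blast
  have "h \<in> star_hom Mbar Mbar"
    using star_homD[OF h(1)] KM by (intro star_homI) auto
  moreover have "(\<lambda>x. x) \<in> star_hom Mbar Mbar" by (auto simp: star_hom_def)
  ultimately have "h y = y" using completion_hom_eq[OF M Mbar _ _ _ y] h(2) by blast
  with star_homD(1)[OF h(1) y] have "y \<in> K" by simp
  then show thesis using e that unfolding K_def Mbar.closure_set_def S_def by auto
qed

section \<open>Actions on completions\<close>

lemma continuous_map_representative_function:
  assumes G: "compact_group G T" and f: "f \<in> representative_functions G T"
  shows "continuous_map T euclidean f"
proof -
  have T: "topspace T = carrier G" using G by (simp add: compact_group_def)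
  have mult: "continuous_map T euclidean (\<lambda>g. u g * v g)"
    if "continuous_map T euclidean u" "continuous_map T euclidean v" for u v :: "_ \<Rightarrow> complex"
    using that by (simp add: continuous_map_atin tendsto_mult)
  have mc: "continuous_map T euclidean u" if u: "u \<in> matrix_coefficients G T" for u
  proof -
    obtain n \<pi> \<xi> v where \<pi>: "continuous_rep G T n \<pi>"
      and u: "\<And>g. g \<in> carrier G \<Longrightarrow> u g = (\<Sum>i<n. \<xi> i * (\<Sum>j<n. \<pi> g i j * v j))"
      using u by (auto simp: matrix_coefficients_def)
    have "continuous_map T euclidean (\<lambda>g. \<Sum>i<n. \<xi> i * (\<Sum>j<n. \<pi> g i j * v j))"
      using \<pi> by (intro continuous_map_sum mult continuous_map_const[THEN iffD2])
        (auto simp: continuous_rep_def)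
    then show ?thesis by (rule continuous_map_eq) (simp add: u T)
  qed
  obtain m c u where u: "\<And>k. k < m \<Longrightarrow> u k \<in> matrix_coefficients G T"
    and f: "\<And>g. g \<in> carrier G \<Longrightarrow> f g = (\<Sum>k<(m::nat). c k * u k g)"
    using f unfolding representative_functions_def by blast
  have "continuous_map T euclidean (\<lambda>g. \<Sum>k<m. c k * u k g)"
    using u mc by (intro continuous_map_sum mult continuous_map_const[THEN iffD2]) auto
  then show ?thesis by (rule continuous_map_eq) (simp add: f T)
qed

text \<open>Here the algebraic tensor product pays off: the orbit of a stays in the span of finitely
  many elements, with continuous coefficients.\<close>

lemma coaction_expansion:
  assumes G: "compact_group G T" and M: "G_star_algebra G T M \<rho>" and a: "a \<in> carrier M"
  obtains m :: nat and b f where "\<And>k. k < m \<Longrightarrow> b k \<in> carrier M"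
    and "\<And>k. k < m \<Longrightarrow> continuous_map T euclidean (f k :: _ \<Rightarrow> complex)"
    and "\<And>g. g \<in> carrier G \<Longrightarrow> \<rho> a g = (\<Oplus>\<^bsub>M\<^esub>k\<in>{..<m}. f k g \<odot>\<^bsub>M\<^esub> b k)"
proof -
  have "\<rho> a \<in> carrier (tensor_O M G T)"
    using M a star_homD(1) by (metis G_star_algebra_def)
  then obtain m b f where "\<forall>k<m. b k \<in> carrier M \<and> f k \<in> representative_functions G T"
    "\<forall>g\<in>carrier G. \<rho> a g = (\<Oplus>\<^bsub>M\<^esub>k\<in>{..<m::nat}. f k g \<odot>\<^bsub>M\<^esub> b k)"
    by (auto simp: tensor_O_def)
  then show thesis using continuous_map_representative_function[OF G] by (intro that[of m b f]) auto
qed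

lemma coaction_action_hom:
  assumes M: "G_star_algebra G T M \<rho>" and g: "g \<in> carrier G"
  shows "coaction_action \<rho> g \<in> star_hom M M"
proof -
  interpret M: star_algebra M using M by (simp add: G_star_algebra_def)
  have \<rho>: "\<rho> \<in> star_hom M (tensor_O M G T)" using M by (simp add: G_star_algebra_def)
  note D = star_homD[OF \<rho>]
  show ?thesis
  proof (rule star_homI)
    fix x assume x: "x \<in> carrier M"
    show "coaction_action \<rho> g x \<in> carrier M"
      using D(1)[OF x] g by (auto simp: tensor_O_def coaction_action_def)
    show "coaction_action \<rho> g (c \<odot>\<^bsub>M\<^esub> x) = c \<odot>\<^bsub>M\<^esub> coaction_action \<rho> g x" for c
      using D(3)[OF x, of c] g by (simp add: tensor_O_def coaction_action_def)
    show "coaction_action \<rho> g (invol M x) = invol M (coaction_action \<rho> g x)"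
      using D(5)[OF x] g by (simp add: tensor_O_def coaction_action_def)
    fix y assume y: "y \<in> carrier M"
    show "coaction_action \<rho> g (x \<oplus>\<^bsub>M\<^esub> y) = coaction_action \<rho> g x \<oplus>\<^bsub>M\<^esub> coaction_action \<rho> g y"
      using D(2)[OF x y] g by (simp add: tensor_O_def coaction_action_def)
    show "coaction_action \<rho> g (x \<otimes>\<^bsub>M\<^esub> y) = coaction_action \<rho> g x \<otimes>\<^bsub>M\<^esub> coaction_action \<rho> g y"
      using D(4)[OF x y] g by (simp add: tensor_O_def coaction_action_def)
  qed
qed

lemma star_hom_lincomb:
  assumes M: "star_algebra M" and N: "star_algebra N" and f: "f \<in> star_hom M N"
    and b: "\<And>k. k < m \<Longrightarrow> b k \<in> carrier M"
  shows "f (\<Oplus>\<^bsub>M\<^esub>k\<in>{..<m::nat}. c k \<odot>\<^bsub>M\<^esub> b k) = (\<Oplus>\<^bsub>N\<^esub>k\<in>{..<m}. c k \<odot>\<^bsub>N\<^esub> f (b k))"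
  using b
proof (induction m)
  interpret M: star_algebra M by fact
  interpret N: star_algebra N by fact
  case 0
  show ?case using star_hom_zero[OF M N f] by simp
next
  interpret M: star_algebra M by fact
  interpret N: star_algebra N by fact
  case (Suc m)
  note hom = star_homD[OF f]
  have "b k \<in> carrier M" "f (b k) \<in> carrier N" if "k < Suc m" for k
    using Suc.prems that hom(1) by auto
  then show ?case
    using Suc by (simp add: lessThan_Suc M.finsum_insert N.finsum_insert Pi_iff hom M.finsum_closed)
qed

lemma (in cstar_algebra) norm_lincomb_diff:
  assumes "\<And>k. k < m \<Longrightarrow> b k \<in> carrier N"
  shows "cnorm N ((\<Oplus>k\<in>{..<m::nat}. c k \<odot> b k) \<ominus> (\<Oplus>k\<in>{..<m}. d k \<odot> b k))
    \<le> (\<Sum>k<m. cmod (c k - d k) * cnorm N (b k))"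
  using assms
proof (induction m)
  case (Suc m)
  have cl: "b k \<in> carrier N" if "k < Suc m" for k using Suc.prems that by auto
  have S: "(\<Oplus>k\<in>{..<m}. e k \<odot> b k) \<in> carrier N" for e using cl by (intro finsum_closed) auto
  have X: "(\<Oplus>k\<in>{..<Suc m}. e k \<odot> b k) = e m \<odot> b m \<oplus> (\<Oplus>k\<in>{..<m}. e k \<odot> b k)" for e
    using cl by (simp add: lessThan_Suc finsum_insert Pi_iff)
  have bm: "b m \<in> carrier N" using cl by simp
  have "cnorm N (c m \<odot> b m \<ominus> d m \<odot> b m) = cmod (c m - d m) * cnorm N (b m)"
    using norm_smult[OF bm, of "c m - d m"] scale_left_distrib[OF bm, of "c m" "- d m"] bm
    by (simp add: diff_eq_scale scale_scale)
  then show ?case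
    using norm_add_diff_add[of "c m \<odot> b m" "\<Oplus>k\<in>{..<m}. c k \<odot> b k" "d m \<odot> b m" "\<Oplus>k\<in>{..<m}. d k \<odot> b k"]
      Suc.IH cl S bm unfolding X by simp
qed simp

locale completed_action =
  fixes G :: "'g monoid" and T :: "'g topology" and M :: "'a star_alg" and \<rho> :: "'a \<Rightarrow> 'g \<Rightarrow> 'a"
    and Mbar :: "'u cstar_alg" (structure) and i :: "'a \<Rightarrow> 'u"
  assumes G: "compact_group G T" and M: "G_star_algebra G T M \<rho>"
    and completion: "is_cstar_completion M Mbar i"
begin

abbreviation act :: "'g \<Rightarrow> 'u \<Rightarrow> 'u" where
  "act \<equiv> completion_action M \<rho> Mbar i"

lemma star_algebra_M: "star_algebra M"
  using M by (simp add: G_star_algebra_def)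

lemma cstar_algebra_Mbar: "cstar_algebra Mbar" and i_hom: "i \<in> star_hom M Mbar"
  using completion by (auto simp: is_cstar_completion_def)

sublocale M: star_algebra M by (rule star_algebra_M)
sublocale Mbar: cstar_algebra Mbar by (rule cstar_algebra_Mbar)

lemma group_G: "group G" and topspace_T: "topspace T = carrier G" and compact_T: "compact_space T"
  using G by (auto simp: compact_group_def)

sublocale G: group G by (rule group_G)

lemmas i_homD = star_homD[OF i_hom]

lemma dense:
  assumes "y \<in> carrier Mbar" "e > 0"
  obtains x where "x \<in> carrier M" "cnorm Mbar (y \<ominus> i x) < e"
  using completion_dense[OF completion star_algebra_M assms] .

lemma hom_eq:
  fixes N :: "'u cstar_alg"
  assumes "cstar_algebra N" "f \<in> star_hom Mbar N" "g \<in> star_hom Mbar N"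
    "\<And>x. x \<in> carrier M \<Longrightarrow> f (i x) = g (i x)" "y \<in> carrier Mbar"
  shows "f y = g y"
  using completion_hom_eq[OF completion assms] .

lemma act_hom: "g \<in> carrier G \<Longrightarrow> act g \<in> star_hom Mbar Mbar"
  and act_i: "g \<in> carrier G \<Longrightarrow> x \<in> carrier M \<Longrightarrow> act g (i x) = i (\<rho> x g)"
  using completion_map[OF completion completion coaction_action_hom[OF M]]
  by (auto simp: completion_action_def coaction_action_def)

lemma \<rho>_closed: "g \<in> carrier G \<Longrightarrow> x \<in> carrier M \<Longrightarrow> \<rho> x g \<in> carrier M"
  using star_homD(1)[OF coaction_action_hom[OF M]] by (simp add: coaction_action_def)

lemma act_closed [simp]: "g \<in> carrier G \<Longrightarrow> x \<in> carrier Mbar \<Longrightarrow> act g x \<in> carrier Mbar"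
  using star_homD(1)[OF act_hom] .

lemma act_one: "x \<in> carrier Mbar \<Longrightarrow> act \<one>\<^bsub>G\<^esub> x = x"
proof (rule hom_eq[OF cstar_algebra_Mbar act_hom])
  show "(\<lambda>x. x) \<in> star_hom Mbar Mbar" by (auto simp: star_hom_def)
qed (use M in \<open>auto simp: act_i G_star_algebra_def\<close>)

lemma act_mult:
  assumes "g \<in> carrier G" "h \<in> carrier G" "x \<in> carrier Mbar"
  shows "act (g \<otimes>\<^bsub>G\<^esub> h) x = act g (act h x)"
proof (rule hom_eq[OF cstar_algebra_Mbar act_hom _ _ assms(3)])
  show "(\<lambda>x. act g (act h x)) \<in> star_hom Mbar Mbar"
    using star_hom_comp act_hom assms(1,2) by blast
qed (use M assms in \<open>auto simp: act_i \<rho>_closed G_star_algebra_def\<close>)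

lemma act_inv:
  assumes "g \<in> carrier G" "x \<in> carrier Mbar"
  shows "act (inv\<^bsub>G\<^esub> g) (act g x) = x" "act g (act (inv\<^bsub>G\<^esub> g) x) = x"
  using act_mult[of "inv\<^bsub>G\<^esub> g" g x] act_mult[of g "inv\<^bsub>G\<^esub> g" x] assms by (simp_all add: act_one)

text \<open>A translation and its inverse are both contractive.\<close>

lemma norm_act [simp]:
  assumes "g \<in> carrier G" "x \<in> carrier Mbar"
  shows "cnorm Mbar (act g x) = cnorm Mbar x"
proof (rule antisym)
  note contr = star_hom_contractive[OF cstar_algebra_Mbar cstar_algebra_Mbar act_hom]
  show "cnorm Mbar (act g x) \<le> cnorm Mbar x" using contr assms by blast
  show "cnorm Mbar x \<le> cnorm Mbar (act g x)"
    using contr[of "inv\<^bsub>G\<^esub> g" "act g x"] assms by (simp add: act_inv)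
qed

lemma act_diff:
  assumes "g \<in> carrier G" "x \<in> carrier Mbar" "y \<in> carrier Mbar"
  shows "act g (x \<ominus> y) = act g x \<ominus> act g y"
  using star_hom_diff[OF Mbar.star_algebra_axioms Mbar.star_algebra_axioms act_hom] assms by blast

lemma orbit_expansion:
  assumes "a \<in> carrier M"
  obtains m :: nat and b f where "\<And>k. k < m \<Longrightarrow> b k \<in> carrier M"
    and "\<And>k. k < m \<Longrightarrow> continuous_map T euclidean (f k :: _ \<Rightarrow> complex)"
    and "\<And>g. g \<in> carrier G \<Longrightarrow> act g (i a) = (\<Oplus>k\<in>{..<m}. f k g \<odot> i (b k))"
proof -
  obtain m b f where b: "\<And>k. k < m \<Longrightarrow> b k \<in> carrier M"
    and f: "\<And>k. k < m \<Longrightarrow> continuous_map T euclidean (f k :: _ \<Rightarrow> complex)"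
    and eq: "\<And>g. g \<in> carrier G \<Longrightarrow> \<rho> a g = (\<Oplus>\<^bsub>M\<^esub>k\<in>{..<m::nat}. f k g \<odot>\<^bsub>M\<^esub> b k)"
    using coaction_expansion[OF G M assms] by blast
  have "act g (i a) = (\<Oplus>k\<in>{..<m}. f k g \<odot> i (b k))" if "g \<in> carrier G" for g
    using that assms star_hom_lincomb[OF star_algebra_M Mbar.star_algebra_axioms i_hom, of m b] b
    by (simp add: act_i eq)
  with b f show thesis by (rule that)
qed

text \<open>For \<open>i a\<close> the orbit map is a finite sum with continuous coefficients. A
  general x is approximated by such an element; since the action is isometric, the error e / 3 is
  uniform in g.\<close>

lemma act_near:
  assumes x: "x \<in> carrier Mbar" and g0: "g0 \<in> carrier G" and e: "e > 0"
  obtains U where "openin T U" "g0 \<in> U" "\<And>g. g \<in> U \<Longrightarrow> cnorm Mbar (act g x \<ominus> act g0 x) < e"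
proof -
  obtain a where a: "a \<in> carrier M" "cnorm Mbar (x \<ominus> i a) < e / 3"
    using dense[OF x, of "e/3"] e by auto
  obtain m b f where b: "\<And>k. k < m \<Longrightarrow> b k \<in> carrier M"
    and f: "\<And>k. k < m \<Longrightarrow> continuous_map T euclidean (f k :: _ \<Rightarrow> complex)"
    and eq: "\<And>g. g \<in> carrier G \<Longrightarrow> act g (i a) = (\<Oplus>k\<in>{..<m::nat}. f k g \<odot> i (b k))"
    using orbit_expansion[OF a(1)] by blast
  define \<phi> where "\<phi> g = (\<Sum>k<m. cmod (f k g - f k g0) * cnorm Mbar (i (b k)))" for g
  have "continuous_map T euclidean \<phi>"
    unfolding \<phi>_def using f
    by (intro continuous_map_sum continuous_map_real_mult continuous_map_norm continuous_map_diff
        continuous_map_const[THEN iffD2]) auto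
  then have "openin T {g \<in> topspace T. \<phi> g \<in> {..<e/3}}"
    by (intro openin_continuous_map_preimage[where Y = euclidean]) (auto simp flip: open_openin)
  moreover have "g0 \<in> {g \<in> topspace T. \<phi> g \<in> {..<e/3}}"
    using g0 e by (simp add: topspace_T \<phi>_def)
  moreover have "cnorm Mbar (act g x \<ominus> act g0 x) < e" if "g \<in> {g \<in> topspace T. \<phi> g \<in> {..<e/3}}" for g
  proof -
    have g: "g \<in> carrier G" "\<phi> g < e/3" using that by (auto simp: topspace_T)
    have ia: "i a \<in> carrier Mbar" using a i_homD by blast
    have "cnorm Mbar (act g (i a) \<ominus> act g0 (i a)) \<le> \<phi> g"
      unfolding eq[OF g(1)] eq[OF g0] \<phi>_def by (rule Mbar.norm_lincomb_diff) (use b i_homD in blast)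
    moreover have "cnorm Mbar (act g x \<ominus> act g (i a)) < e / 3"
        "cnorm Mbar (act g0 x \<ominus> act g0 (i a)) < e / 3"
      using g g0 x ia a by (simp_all flip: act_diff)
    moreover have "cnorm Mbar (act g x \<ominus> act g0 x)
        \<le> cnorm Mbar (act g x \<ominus> act g (i a)) + cnorm Mbar (act g (i a) \<ominus> act g0 x)"
      using g g0 x ia by (intro Mbar.norm_diff_triangle) auto
    moreover have "cnorm Mbar (act g (i a) \<ominus> act g0 x)
        \<le> cnorm Mbar (act g (i a) \<ominus> act g0 (i a)) + cnorm Mbar (act g0 (i a) \<ominus> act g0 x)"
      using g g0 x ia by (intro Mbar.norm_diff_triangle) auto
    moreover have "cnorm Mbar (act g0 (i a) \<ominus> act g0 x) = cnorm Mbar (act g0 x \<ominus> act g0 (i a))"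
      using g0 x ia by (intro Mbar.norm_diff_commute) auto
    ultimately show ?thesis using g(2) by linarith
  qed
  ultimately show thesis by (rule that)
qed

theorem G_cstar_algebra_completion: "G_cstar_algebra G T Mbar act"
  unfolding G_cstar_algebra_def
proof (intro conjI ballI)
  fix g assume g: "g \<in> carrier G"
  show "act g \<in> star_hom Mbar Mbar" by (rule act_hom[OF g])
  show "bij_betw (act g) (carrier Mbar) (carrier Mbar)"
    by (rule bij_betw_byWitness[where f' = "act (inv\<^bsub>G\<^esub> g)"]) (use g in \<open>auto simp: act_inv\<close>)
next
  fix x assume x: "x \<in> carrier Mbar"
  interpret MS: Metric_space "carrier Mbar" "cdist Mbar" by (rule Mbar.Metric_space)
  show "continuous_map T MS.mtopology (\<lambda>g. act g x)"
    unfolding MS.continuous_map_to_metric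
  proof (intro ballI allI impI)
    fix g0 and e :: real assume "g0 \<in> topspace T" "0 < e"
    then obtain U where "openin T U" "g0 \<in> U" "\<And>g. g \<in> U \<Longrightarrow> cnorm Mbar (act g x \<ominus> act g0 x) < e"
      using act_near[OF x, of g0 e] by (auto simp: topspace_T)
    moreover from this have "U \<subseteq> carrier G" using openin_subset topspace_T by metis
    ultimately show "\<exists>U. openin T U \<and> g0 \<in> U \<and> (\<forall>y\<in>U. act y x \<in> MS.mball (act g0 x) e)"
      using x \<open>g0 \<in> topspace T\<close> by (intro exI[of _ U])
        (auto simp: topspace_T cdist_def subset_iff Mbar.norm_diff_commute)
  qed
qed (auto simp: act_one act_mult cstar_algebra_Mbar)

text \<open>The orbit is described by m complex coefficients, that is by 2 m bounded real
  coordinates. Rounding them to a grid of mesh proportional to 1 / n leaves at most (K n)^(2 m)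
  cells. The exponent does not depend on n, and the estimate for high powers rests on this.\<close>

lemma orbit_cover:
  assumes a: "a \<in> carrier M"
  obtains K d :: nat where "\<And>n::nat. n \<ge> 1 \<Longrightarrow> \<exists>\<U>. finite \<U> \<and> card \<U> \<le> (K * n) ^ d \<and> \<Union>\<U> = carrier G \<and>
    (\<forall>U\<in>\<U>. \<forall>g\<in>U. \<forall>g'\<in>U. cnorm Mbar (act g (i a) \<ominus> act g' (i a)) \<le> 1 / n)"
proof -
  obtain m b f where b: "\<And>k. k < m \<Longrightarrow> b k \<in> carrier M"
    and f: "\<And>k. k < m \<Longrightarrow> continuous_map T euclidean (f k :: _ \<Rightarrow> complex)"
    and eq: "\<And>g. g \<in> carrier G \<Longrightarrow> act g (i a) = (\<Oplus>k\<in>{..<m::nat}. f k g \<odot> i (b k))"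
    using orbit_expansion[OF a] by blast
  have "\<exists>R. \<forall>g\<in>carrier G. cmod (f k g) \<le> R" if "k < m" for k
  proof -
    have "compactin euclidean (f k ` topspace T)"
      using compact_T f[OF that] image_compactin unfolding compact_space_def by blast
    then have "bounded (f k ` carrier G)" by (simp add: topspace_T compact_imp_bounded)
    then show ?thesis by (auto simp: bounded_iff)
  qed
  then obtain R0 where R0: "\<And>k g. k < m \<Longrightarrow> g \<in> carrier G \<Longrightarrow> cmod (f k g) \<le> R0 k" by metis
  obtain R :: nat where R: "(\<Sum>k<m. \<bar>R0 k\<bar>) \<le> R" using real_arch_simple by blast
  have R: "cmod (f k g) \<le> R" if "k < m" "g \<in> carrier G" for k g
  proof -
    have "cmod (f k g) \<le> \<bar>R0 k\<bar>" using R0[OF that] by linarith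
    also have "\<dots> \<le> (\<Sum>k<m. \<bar>R0 k\<bar>)" using that by (intro member_le_sum) auto
    finally show ?thesis using R by linarith
  qed
  \<comment> \<open>Elements of one cell differ in each complex coefficient by at most twice the
    mesh 1 / (n s). An integer s \<ge> 1 above S therefore gives diameter at most 1 / n.\<close>
  define S where "S = (\<Sum>k<m. 2 * cnorm Mbar (i (b k)))"
  obtain s0 :: nat where s0: "S \<le> s0" using real_arch_simple by blast
  define s where "s = s0 + 1"
  have s: "S \<le> s" "s \<ge> 1" using s0 by (auto simp: s_def)
  \<comment> \<open>Each coordinate has 2 n s R + 1 grid indices, at most (2 R s + 1) n for n \<ge>
    1.\<close>
  define K where "K = 2 * R * s + 1"
  show thesis
  proof (rule that[of K "2 * m"])
    fix n :: nat assume n: "n \<ge> 1"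
    define \<kappa> where "\<kappa> g = (\<lambda>k\<in>{..<m}. (\<lfloor>n * s * Re (f k g)\<rfloor>, \<lfloor>n * s * Im (f k g)\<rfloor>))" for g
    define I where "I = {- int (n * s * R)..int (n * s * R)}"
    have flo: "\<lfloor>n * s * t\<rfloor> \<in> I" if "\<bar>t\<bar> \<le> R" for t :: real
    proof -
      have "real (n * s) * t \<le> real (n * s) * R" "real (n * s) * (- R) \<le> real (n * s) * t"
        using that by (intro mult_left_mono; simp)+
      then show ?thesis unfolding I_def by (simp add: le_floor_iff floor_le_iff)
    qed
    have \<kappa>I: "\<kappa> ` carrier G \<subseteq> ({..<m} \<rightarrow>\<^sub>E I \<times> I)"
    proof
      fix z assume "z \<in> \<kappa> ` carrier G"
      then obtain g where g: "g \<in> carrier G" "z = \<kappa> g" by auto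
      have "\<bar>Re (f k g)\<bar> \<le> R" "\<bar>Im (f k g)\<bar> \<le> R" if "k < m" for k
        using R[OF that g(1)] abs_Re_le_cmod[of "f k g"] abs_Im_le_cmod[of "f k g"] by linarith+
      then show "z \<in> ({..<m} \<rightarrow>\<^sub>E I \<times> I)" using flo by (auto simp: g \<kappa>_def)
    qed
    have fin: "finite ({..<m} \<rightarrow>\<^sub>E I \<times> I)" by (intro finite_PiE) (auto simp: I_def)
    have "card (\<kappa> ` carrier G) \<le> card ({..<m} \<rightarrow>\<^sub>E I \<times> I)" by (rule card_mono[OF fin \<kappa>I])
    also have "\<dots> = (card I * card I) ^ m" by (simp add: card_PiE card_cartesian_product)
    also have "\<dots> = card I ^ (2 * m)" by (simp add: power_mult power2_eq_square)
    also have "\<dots> \<le> (K * n) ^ (2 * m)"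
    proof (rule power_mono)
      have "card I = nat (int (2 * (n * s * R) + 1))" by (simp add: I_def algebra_simps)
      also have "\<dots> = 2 * (n * s * R) + 1" by (rule nat_int)
      also have "\<dots> \<le> K * n" using n by (simp add: K_def algebra_simps)
      finally show "card I \<le> K * n" .
    qed simp
    finally have card: "card (\<kappa> ` carrier G) \<le> (K * n) ^ (2 * m)" .
    define \<U> where "\<U> = (\<lambda>v. {g \<in> carrier G. \<kappa> g = v}) ` (\<kappa> ` carrier G)"
    have fin': "finite (\<kappa> ` carrier G)" by (rule finite_subset[OF \<kappa>I fin])
    have "cnorm Mbar (act g (i a) \<ominus> act g' (i a)) \<le> 1 / n"
      if g: "g \<in> carrier G" and g': "g' \<in> carrier G" and eq\<kappa>: "\<kappa> g = \<kappa> g'" for g g'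
    proof -
      have near: "\<bar>x - y\<bar> \<le> 1 / (n * s)" if "\<lfloor>n * s * x\<rfloor> = \<lfloor>n * s * y\<rfloor>" for x y :: real
      proof -
        have "\<bar>n * s * x - n * s * y\<bar> \<le> 1" using that by linarith
        then have "real (n * s) * \<bar>x - y\<bar> \<le> 1"
          by (metis abs_mult abs_of_nat of_nat_mult right_diff_distrib)
        then show ?thesis using n s by (simp add: field_simps)
      qed
      have df: "cmod (f k g - f k g') \<le> 2 / (n * s)" if "k < m" for k
      proof -
        have "\<kappa> g k = \<kappa> g' k" using eq\<kappa> by simp
        then have "\<bar>Re (f k g) - Re (f k g')\<bar> \<le> 1 / (n * s)" "\<bar>Im (f k g) - Im (f k g')\<bar> \<le> 1 / (n * s)"
          using that near by (auto simp: \<kappa>_def)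
        then show ?thesis using cmod_le[of "f k g - f k g'"] by simp
      qed
      have "cnorm Mbar (act g (i a) \<ominus> act g' (i a)) \<le> (\<Sum>k<m. cmod (f k g - f k g') * cnorm Mbar (i (b k)))"
        unfolding eq[OF g] eq[OF g'] by (rule Mbar.norm_lincomb_diff) (use b i_homD in blast)
      also have "\<dots> \<le> (\<Sum>k<m. 2 / (n * s) * cnorm Mbar (i (b k)))"
        using df b i_homD by (intro sum_mono mult_right_mono) auto
      also have "\<dots> = S / (n * s)" by (simp add: S_def sum_divide_distrib)
      also have "\<dots> \<le> s / (n * s)" using s by (intro divide_right_mono) auto
      also have "\<dots> = 1 / n" using s by simp
      finally show ?thesis .
    qed
    then show "\<exists>\<U>. finite \<U> \<and> card \<U> \<le> (K * n) ^ (2 * m) \<and> \<Union>\<U> = carrier G \<and>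
      (\<forall>U\<in>\<U>. \<forall>g\<in>U. \<forall>g'\<in>U. cnorm Mbar (act g (i a) \<ominus> act g' (i a)) \<le> 1 / n)"
      using card fin' card_image_le[OF fin', of "\<lambda>v. {g \<in> carrier G. \<kappa> g = v}"]
      by (intro exI[of _ \<U>]) (auto simp: \<U>_def)
  qed
qed

end

section \<open>Quotients of C*-algebras\<close>

lemma (in star_algebra) diff_diff_swap:
  assumes "x \<in> carrier A" "y \<in> carrier A" "z \<in> carrier A" "w \<in> carrier A"
  shows "(x \<ominus> y) \<ominus> (z \<ominus> w) = (x \<ominus> z) \<ominus> (y \<ominus> w)"
proof -
  from coefficients_ex[OF assms assms(1)] obtain L where "coefficients L x y z w x" .
  note L = coefficientsD[OF this]
  show ?thesis unfolding L(5-8) by (simp add: L(1-4))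
qed

context cstar_algebra
begin

text \<open>
  One step towards an approximate unit: for \<open>j \<noteq> 0\<close> take \<open>e = k\<^sup>2\<close> with \<open>k = j\<^sup>* j / \<parallel>j\<parallel>\<^sup>2\<close>.  Squaring
  \<open>j\<^sup>* j\<close> makes \<open>e\<close> positive without appeal to the positivity of \<open>j\<^sup>* j\<close>.
\<close>

lemma approximate_unit_step:
  assumes j: "j \<in> carrier N" and nz: "j \<noteq> \<zero>"
  defines "k \<equiv> complex_of_real (1 / (cnorm N j)\<^sup>2) \<odot> (invol N j \<otimes> j)"
  shows "y \<in> carrier N \<Longrightarrow> cnorm N (y \<ominus> y \<otimes> (k \<otimes> k)) \<le> cnorm N y"
    and "cnorm N (j \<ominus> j \<otimes> (k \<otimes> k)) \<le> 9 / 10 * cnorm N j"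
proof -
  define \<kappa> where "\<kappa> = (cnorm N j)\<^sup>2"
  have \<kappa>: "\<kappa> > 0" using nz norm_eq_0[OF j] norm_nonneg[OF j] by (simp add: \<kappa>_def)
  have k [simp]: "k \<in> carrier N" using j by (simp add: k_def)
  have ks [simp]: "invol N k = k" using j by (simp add: k_def invol_smult invol_mult)
  have k1: "cnorm N k = 1" using j \<kappa> by (simp add: k_def norm_smult cstar_identity norm_divide norm_power \<kappa>_def)
  have jj: "invol N j \<otimes> j = complex_of_real \<kappa> \<odot> k" using j \<kappa> by (simp add: k_def scale_scale \<kappa>_def)
  have contr: "cnorm N (y \<ominus> y \<otimes> (k \<otimes> k)) \<le> cnorm N y" if y: "y \<in> carrier N" for y
  proof -
    have "cnorm N (y \<ominus> y \<otimes> (k \<otimes> k)) = cnorm N (invol N (y \<ominus> y \<otimes> (k \<otimes> k)))" using y by simp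
    also have "invol N (y \<ominus> y \<otimes> (k \<otimes> k)) = invol N y \<ominus> k \<otimes> (k \<otimes> invol N y)"
      using y by (simp add: invol_diff invol_mult mult_assoc)
    also have "cnorm N \<dots> \<le> cnorm N (invol N y)" using y k1 by (intro norm_diff_square_le) auto
    finally show ?thesis using y by simp
  qed
  then show "y \<in> carrier N \<Longrightarrow> cnorm N (y \<ominus> y \<otimes> (k \<otimes> k)) \<le> cnorm N y" .
  let ?p2 = "k \<otimes> k" and ?p4 = "k \<otimes> (k \<otimes> (k \<otimes> k))" and ?p6 = "k \<otimes> (k \<otimes> (k \<otimes> (k \<otimes> (k \<otimes> k))))"
    and ?p8 = "k \<otimes> (k \<otimes> (k \<otimes> (k \<otimes> (k \<otimes> (k \<otimes> (k \<otimes> k))))))"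
  have "?p2 \<in> carrier N" "?p4 \<in> carrier N" "?p6 \<in> carrier N" "?p8 \<in> carrier N" by simp_all
  from coefficients_ex[OF this k] obtain L where "coefficients L ?p2 ?p4 ?p6 ?p8 k" .
  note L = coefficientsD[OF this]
  \<comment> \<open>g g = (k^2 - k^4) g, so the operator bound 1/2 for k^2 - k^4 bounds the square
    of the norm of g by half that norm.\<close>
  define g where "g = ?p2 \<ominus> ?p4"
  have g [simp]: "g \<in> carrier N" by (simp add: g_def)
  have gs: "invol N g = g" by (simp add: g_def invol_diff invol_mult mult_assoc)
  have "g \<otimes> g = k \<otimes> (k \<otimes> g) \<ominus> k \<otimes> (k \<otimes> (k \<otimes> (k \<otimes> g)))"
    unfolding g_def by (simp add: diff_mult_left diff_mult_right mult_assoc)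
  then have "cnorm N (g \<otimes> g) \<le> cnorm N g / 2" using norm_square_diff_fourth_le[OF k ks _ g] k1 by simp
  then have "cnorm N g * cnorm N g \<le> 1 / 2 * cnorm N g" using norm_square[OF g gs] by (simp add: power2_eq_square)
  then have g2: "cnorm N g \<le> 1 / 2"
    using mult_le_cancel_right[of "cnorm N g" "cnorm N g" "1/2"] norm_nonneg[OF g] by linarith
  \<comment> \<open>w^2 = (1 - k^2) g has norm at most 1/2, which is below (3/4)^2.\<close>
  define w where "w = k \<ominus> k \<otimes> (k \<otimes> k)"
  have w [simp]: "w \<in> carrier N" by (simp add: w_def)
  have ws: "invol N w = w" by (simp add: w_def invol_diff invol_mult mult_assoc)
  have "w \<otimes> w = (?p2 \<ominus> ?p4) \<ominus> (?p4 \<ominus> ?p6)"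
    unfolding w_def by (simp add: diff_mult_left diff_mult_right mult_assoc)
  also have "\<dots> = g \<ominus> k \<otimes> (k \<otimes> g)"
    unfolding g_def by (simp add: diff_mult_left diff_mult_right mult_assoc)
  finally have "cnorm N (w \<otimes> w) \<le> cnorm N g" using norm_diff_square_le[OF k ks _ g] k1 by simp
  then have "(cnorm N w)\<^sup>2 \<le> (3 / 4)\<^sup>2" using g2 norm_square[OF w ws] by (simp add: power2_eq_square)
  then have w34: "cnorm N w \<le> 3 / 4" by (rule power2_le_imp_le) simp
  \<comment> \<open>z is j (1 - k^2), and z* z = \<kappa> w (1 - k^2) has norm at most 3/4 \<kappa>,
    which is below (9/10)^2 \<kappa>.\<close>
  define z where "z = j \<ominus> j \<otimes> (k \<otimes> k)"
  have z [simp]: "z \<in> carrier N" using j by (simp add: z_def)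
  have "invol N z \<otimes> z = (invol N j \<otimes> j \<ominus> k \<otimes> (k \<otimes> (invol N j \<otimes> j)))
      \<ominus> ((invol N j \<otimes> j) \<otimes> (k \<otimes> k) \<ominus> k \<otimes> (k \<otimes> ((invol N j \<otimes> j) \<otimes> (k \<otimes> k))))"
    unfolding z_def using j
    by (simp add: invol_diff invol_mult diff_mult_left diff_mult_right mult_assoc)
  also have "\<dots> = complex_of_real \<kappa> \<odot> (w \<ominus> w \<otimes> (k \<otimes> k))"
    unfolding jj w_def
    by (simp add: smult_mult_l smult_mult_r diff_mult_left diff_mult_right mult_assoc scale_diff)
  finally have "(cnorm N z)\<^sup>2 = \<kappa> * cnorm N (w \<ominus> w \<otimes> (k \<otimes> k))"
    using cstar_identity[of z] \<kappa> by (simp add: norm_smult)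
  also have "\<dots> \<le> \<kappa> * (81 / 100)" using contr[OF w] w34 \<kappa> by (intro mult_left_mono) auto
  also have "\<dots> = (9 / 10 * cnorm N j)\<^sup>2" by (simp add: \<kappa>_def power2_eq_square)
  finally show "cnorm N (j \<ominus> j \<otimes> (k \<otimes> k)) \<le> 9 / 10 * cnorm N j"
    unfolding z_def by (rule power2_le_imp_le) (use j in simp)
qed

end

locale cstar_ideal = cstar_algebra N for N :: "'a cstar_alg" (structure) +
  fixes J :: "'a set"
  assumes subalgebra: "star_subalgebra J N"
    and ideal_left: "\<lbrakk>x \<in> carrier N; j \<in> J\<rbrakk> \<Longrightarrow> x \<otimes> j \<in> J"
    and ideal_right: "\<lbrakk>x \<in> carrier N; j \<in> J\<rbrakk> \<Longrightarrow> j \<otimes> x \<in> J"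
    and closed: "\<lbrakk>\<And>n. s n \<in> J; tends s x\<rbrakk> \<Longrightarrow> x \<in> J"
begin

lemmas J_D = star_subalgebraD[OF subalgebra]

lemma J_carrier [simp]: "j \<in> J \<Longrightarrow> j \<in> carrier N"
  using J_D(1) by auto

lemma J_diff: "\<lbrakk>i \<in> J; j \<in> J\<rbrakk> \<Longrightarrow> i \<ominus> j \<in> J"
  by (simp add: diff_eq_scale J_D)

text \<open>One step multiplies the norm of j by at most 9/10 on passing to the residue j - j e. The
  next step is applied to that residue, and the two elements are merged by 1 - f = (1 - e) (1 - e').
  The smallness concerns the given j, the contraction bound every y; the C*-identity of the quotient
  asks for exactly this combination.\<close>

lemma approximate_unit:
  assumes j: "j \<in> J" and d: "d > 0"
  obtains e where "e \<in> J" "\<And>y. y \<in> carrier N \<Longrightarrow> cnorm N (y \<ominus> y \<otimes> e) \<le> cnorm N y"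
    "cnorm N (j \<ominus> j \<otimes> e) < d"
proof -
  have iter: "\<exists>e\<in>J. (\<forall>y\<in>carrier N. cnorm N (y \<ominus> y \<otimes> e) \<le> cnorm N y) \<and>
      cnorm N (j \<ominus> j \<otimes> e) \<le> (9/10) ^ n * cnorm N j" if "j \<in> J" for n j
    using that
  proof (induction n arbitrary: j)
    case 0
    then show ?case using J_D(2) by (intro bexI[of _ \<zero>]) auto
  next
    case (Suc n)
    show ?case
    proof (cases "j = \<zero>")
      case True
      then show ?thesis using J_D(2) by (intro bexI[of _ \<zero>]) auto
    next
      case False
      define k where "k = complex_of_real (1 / (cnorm N j)\<^sup>2) \<odot> (invol N j \<otimes> j)"
      define e where "e = k \<otimes> k"
      have "k \<in> J" using Suc.prems by (simp add: k_def J_D)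
      then have eJ: "e \<in> J" by (simp add: e_def J_D)
      note step = approximate_unit_step[OF J_carrier[OF Suc.prems] False, folded k_def, folded e_def]
      have "j \<ominus> j \<otimes> e \<in> J" using Suc.prems eJ by (intro J_diff) (auto intro: ideal_left)
      from Suc.IH[OF this] obtain e' where e': "e' \<in> J"
        "\<And>y. y \<in> carrier N \<Longrightarrow> cnorm N (y \<ominus> y \<otimes> e') \<le> cnorm N y"
        "cnorm N (j \<ominus> j \<otimes> e \<ominus> (j \<ominus> j \<otimes> e) \<otimes> e') \<le> (9/10) ^ n * cnorm N (j \<ominus> j \<otimes> e)" by blast
      define f where "f = e \<oplus> e' \<ominus> e \<otimes> e'"
      have fJ: "f \<in> J" using eJ e'(1) by (simp add: f_def J_diff J_D)
      have f: "y \<ominus> y \<otimes> f = y \<ominus> y \<otimes> e \<ominus> (y \<ominus> y \<otimes> e) \<otimes> e'" if y: "y \<in> carrier N" for y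
      proof -
        have [simp]: "e \<in> carrier N" "e' \<in> carrier N" using eJ e' by auto
        have "y \<otimes> e \<in> carrier N" "y \<otimes> e' \<in> carrier N" "y \<otimes> (e \<otimes> e') \<in> carrier N" using y by auto
        from coefficients_ex[OF y this y] obtain L where
          "coefficients L y (y \<otimes> e) (y \<otimes> e') (y \<otimes> (e \<otimes> e')) y" .
        note L = coefficientsD[OF this]
        have "y \<ominus> y \<otimes> f = y \<ominus> (y \<otimes> e \<oplus> y \<otimes> e' \<ominus> y \<otimes> (e \<otimes> e'))"
          using y by (simp add: f_def distr_r diff_mult_right)
        also have "\<dots> = y \<ominus> y \<otimes> e \<ominus> (y \<otimes> e' \<ominus> y \<otimes> (e \<otimes> e'))"
          unfolding L(6-8) unfolding L(5) by (simp add: L(1-4))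
        also have "\<dots> = y \<ominus> y \<otimes> e \<ominus> (y \<ominus> y \<otimes> e) \<otimes> e'"
          using y by (simp add: diff_mult_left mult_assoc)
        finally show ?thesis .
      qed
      have "cnorm N (y \<ominus> y \<otimes> f) \<le> cnorm N y" if y: "y \<in> carrier N" for y
        using e'(2)[of "y \<ominus> y \<otimes> e"] step(1)[OF y] y eJ by (simp add: f)
      moreover have "cnorm N (j \<ominus> j \<otimes> f) \<le> (9/10) ^ Suc n * cnorm N j"
      proof -
        have "cnorm N (j \<ominus> j \<otimes> f) \<le> (9/10) ^ n * cnorm N (j \<ominus> j \<otimes> e)"
          using e'(3) Suc.prems by (simp add: f)
        also have "\<dots> \<le> (9/10) ^ n * (9/10 * cnorm N j)" using step(2) by (intro mult_left_mono) auto
        finally show ?thesis by simp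
      qed
      ultimately show ?thesis using fJ by blast
    qed
  qed
  have "(\<lambda>n. (9/10) ^ n * cnorm N j) \<longlonglongrightarrow> 0 * cnorm N j"
    by (intro tendsto_intros LIMSEQ_realpow_zero) auto
  then have "\<forall>\<^sub>F n in sequentially. (9/10) ^ n * cnorm N j < d" using d by (intro order_tendstoD) auto
  then obtain n where n: "(9/10) ^ n * cnorm N j < d" by (auto simp: eventually_sequentially)
  from iter[OF j, of n] obtain e where "e \<in> J" "\<forall>y\<in>carrier N. cnorm N (y \<ominus> y \<otimes> e) \<le> cnorm N y"
    "cnorm N (j \<ominus> j \<otimes> e) \<le> (9/10) ^ n * cnorm N j" by blast
  with n show thesis by (intro that[of e]) auto
qed

definition qnorm :: "'a \<Rightarrow> real" where
  "qnorm x = (INF j\<in>J. cnorm N (x \<ominus> j))"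

lemma qnorm_le: "\<lbrakk>x \<in> carrier N; j \<in> J\<rbrakk> \<Longrightarrow> qnorm x \<le> cnorm N (x \<ominus> j)"
  unfolding qnorm_def by (intro cINF_lower bdd_belowI[of _ 0]) auto

lemma qnorm_le_norm: "x \<in> carrier N \<Longrightarrow> qnorm x \<le> cnorm N x"
  using qnorm_le[OF _ J_D(2)] by simp

lemma qnorm_nonneg: "x \<in> carrier N \<Longrightarrow> 0 \<le> qnorm x"
  unfolding qnorm_def using J_D(2) by (intro cINF_greatest) auto

lemma qnorm_less:
  assumes "x \<in> carrier N" "qnorm x < c"
  obtains j where "j \<in> J" "cnorm N (x \<ominus> j) < c"
proof -
  have "J \<noteq> {}" using J_D(2) by auto
  from that cInf_lessD[of "(\<lambda>j. cnorm N (x \<ominus> j)) ` J" c] this assms show thesis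
    unfolding qnorm_def by auto
qed

lemma qnorm_leI:
  assumes "x \<in> carrier N" "\<And>d. d > 0 \<Longrightarrow> \<exists>j\<in>J. cnorm N (x \<ominus> j) \<le> c + d"
  shows "qnorm x \<le> c"
proof (rule field_le_epsilon)
  fix d :: real assume "d > 0"
  then obtain j where "j \<in> J" "cnorm N (x \<ominus> j) \<le> c + d" using assms(2) by blast
  then show "qnorm x \<le> c + d" using qnorm_le[OF assms(1)] order_trans by blast
qed

lemma qnorm_cong:
  assumes "x \<in> carrier N" "y \<in> carrier N" "x \<ominus> y \<in> J"
  shows "qnorm x = qnorm y"
proof -
  have le: "qnorm x \<le> qnorm y" if xy: "x \<in> carrier N" "y \<in> carrier N" "x \<ominus> y \<in> J" for x y
  proof (rule qnorm_leI[OF xy(1)])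
    fix d :: real assume "d > 0"
    then obtain j where j: "j \<in> J" "cnorm N (y \<ominus> j) < qnorm y + d"
      using qnorm_less[OF xy(2), of "qnorm y + d"] by auto
    from coefficients_ex[OF xy(1,2) J_carrier[OF j(1)] xy(1,1)] obtain L where "coefficients L x y j x x" .
    note L = coefficientsD[OF this]
    have "x \<ominus> (j \<oplus> (x \<ominus> y)) = y \<ominus> j" unfolding L(5-7) by (simp add: L(1-4))
    then show "\<exists>j\<in>J. cnorm N (x \<ominus> j) \<le> qnorm y + d"
      using j xy J_D(3) by (intro bexI[of _ "j \<oplus> (x \<ominus> y)"]) auto
  qed
  have "y \<ominus> x = (-1) \<odot> (x \<ominus> y)"
  proof -
    from coefficients_ex[OF assms(1,2,2,2,2)] obtain L where "coefficients L x y y y y" .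
    note L = coefficientsD[OF this]
    show ?thesis unfolding L(5,6) by (simp add: L(1-4))
  qed
  then have "y \<ominus> x \<in> J" using J_D(4)[OF assms(3)] by simp
  then show ?thesis using le assms by (intro antisym) auto
qed

text \<open>Approximation by elements of J puts x in the closure of J, and J is closed.\<close>

lemma qnorm_eq_0_iff:
  assumes x: "x \<in> carrier N"
  shows "qnorm x = 0 \<longleftrightarrow> x \<in> J"
proof
  assume "x \<in> J"
  then show "qnorm x = 0" using qnorm_le[OF x, of x] qnorm_nonneg[OF x] x by simp
next
  assume "qnorm x = 0"
  then have "\<exists>j\<in>J. cnorm N (x \<ominus> j) < d" if "d > 0" for d
    using qnorm_less[OF x] that by metis
  then have "x \<in> closure_set J" using x by (simp add: closure_set_def)
  then obtain s where "\<forall>n. s n \<in> J" "tends s x" using closure_set_iff[OF J_D(1)] by metis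
  then show "x \<in> J" using closed by blast
qed

lemma qnorm_add:
  assumes x: "x \<in> carrier N" and y: "y \<in> carrier N"
  shows "qnorm (x \<oplus> y) \<le> qnorm x + qnorm y"
proof (rule qnorm_leI)
  fix d :: real assume "d > 0"
  then have d: "qnorm x < qnorm x + d/2" "qnorm y < qnorm y + d/2" by auto
  obtain i where i: "i \<in> J" "cnorm N (x \<ominus> i) < qnorm x + d/2" using qnorm_less[OF x d(1)] .
  obtain j where j: "j \<in> J" "cnorm N (y \<ominus> j) < qnorm y + d/2" using qnorm_less[OF y d(2)] .
  have "cnorm N ((x \<oplus> y) \<ominus> (i \<oplus> j)) \<le> cnorm N (x \<ominus> i) + cnorm N (y \<ominus> j)"
    using x y i j by (intro norm_add_diff_add) auto
  with i j show "\<exists>j\<in>J. cnorm N (x \<oplus> y \<ominus> j) \<le> qnorm x + qnorm y + d"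
    by (intro bexI[of _ "i \<oplus> j"]) (auto simp: J_D)
qed (use x y in auto)

lemma qnorm_scale_le:
  assumes x: "x \<in> carrier N"
  shows "qnorm (c \<odot> x) \<le> cmod c * qnorm x"
proof (rule qnorm_leI)
  fix d :: real assume d: "d > 0"
  \<comment> \<open>The summand 1 covers the case c = 0.\<close>
  define t where "t = d / (cmod c + 1)"
  have t: "t > 0" using d by (auto simp: t_def intro!: divide_pos_pos add_nonneg_pos)
  then obtain i where i: "i \<in> J" "cnorm N (x \<ominus> i) < qnorm x + t"
    using qnorm_less[OF x, of "qnorm x + t"] by auto
  have "cnorm N (c \<odot> x \<ominus> c \<odot> i) = cmod c * cnorm N (x \<ominus> i)"
    using x i by (simp flip: scale_diff norm_smult)
  also have "\<dots> \<le> cmod c * (qnorm x + t)" using i by (intro mult_left_mono) auto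
  finally have "cnorm N (c \<odot> x \<ominus> c \<odot> i) \<le> cmod c * qnorm x + cmod c * t" by (simp add: distrib_left)
  moreover have "cmod c * t \<le> (cmod c + 1) * t" using t by (intro mult_right_mono) auto
  moreover have "(cmod c + 1) * t = d" by (simp add: t_def add_nonneg_eq_0_iff)
  ultimately have "cnorm N (c \<odot> x \<ominus> c \<odot> i) \<le> cmod c * qnorm x + d" by linarith
  with i show "\<exists>j\<in>J. cnorm N (c \<odot> x \<ominus> j) \<le> cmod c * qnorm x + d"
    by (intro bexI[of _ "c \<odot> i"]) (auto simp: J_D)
qed (use x in auto)

lemma qnorm_scale:
  assumes x: "x \<in> carrier N"
  shows "qnorm (c \<odot> x) = cmod c * qnorm x"
proof (cases "c = 0")
  case True
  then show ?thesis using x J_D(2) qnorm_eq_0_iff[of \<zero>] by simp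
next
  case False
  have "qnorm x = qnorm (inverse c \<odot> (c \<odot> x))" using x False by (simp add: scale_scale)
  also have "\<dots> \<le> cmod (inverse c) * qnorm (c \<odot> x)" using x by (intro qnorm_scale_le) auto
  finally have "cmod c * qnorm x \<le> qnorm (c \<odot> x)" using False by (simp add: norm_divide inverse_eq_divide field_simps)
  then show ?thesis using qnorm_scale_le[OF x, of c] by linarith
qed

text \<open>For i and j in J nearly realizing the two quotient norms, (x - i) (y - j) is congruent
  to x y. Both factors carry an error d, so the product estimate is taken to the limit d
  \<rightarrow> 0.\<close>

lemma qnorm_mult:
  assumes x: "x \<in> carrier N" and y: "y \<in> carrier N"
  shows "qnorm (x \<otimes> y) \<le> qnorm x * qnorm y"
proof -
  have *: "qnorm (x \<otimes> y) \<le> (qnorm x + d) * (qnorm y + d)" if d: "d > 0" for d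
  proof -
    from d have d': "qnorm x < qnorm x + d" "qnorm y < qnorm y + d" by auto
    obtain i where i: "i \<in> J" "cnorm N (x \<ominus> i) < qnorm x + d" using qnorm_less[OF x d'(1)] .
    obtain j where j: "j \<in> J" "cnorm N (y \<ominus> j) < qnorm y + d" using qnorm_less[OF y d'(2)] .
    have "x \<otimes> y \<ominus> (x \<ominus> i) \<otimes> (y \<ominus> j) \<in> J"
    proof -
      have "x \<otimes> y \<in> carrier N" "x \<otimes> j \<in> carrier N" "i \<otimes> y \<in> carrier N" "i \<otimes> j \<in> carrier N"
        using x y i j by auto
      from coefficients_ex[OF this x] obtain L where
        "coefficients L (x \<otimes> y) (x \<otimes> j) (i \<otimes> y) (i \<otimes> j) x" .
      note L = coefficientsD[OF this]
      have "x \<otimes> y \<ominus> (x \<ominus> i) \<otimes> (y \<ominus> j) = x \<otimes> y \<ominus> ((x \<otimes> y \<ominus> i \<otimes> y) \<ominus> (x \<otimes> j \<ominus> i \<otimes> j))"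
        using x y i j by (simp add: diff_mult_left diff_mult_right)
      also have "\<dots> = x \<otimes> j \<oplus> (i \<otimes> y \<ominus> i \<otimes> j)" unfolding L(5-8) by (simp add: L(1-4))
      also have "\<dots> \<in> J" using x y i j by (intro J_D(3,5) J_diff ideal_left ideal_right) auto
      finally show ?thesis .
    qed
    then have "qnorm (x \<otimes> y) = qnorm ((x \<ominus> i) \<otimes> (y \<ominus> j))" using x y i j by (intro qnorm_cong) auto
    also have "\<dots> \<le> cnorm N ((x \<ominus> i) \<otimes> (y \<ominus> j))" using x y i j by (intro qnorm_le_norm) auto
    also have "\<dots> \<le> cnorm N (x \<ominus> i) * cnorm N (y \<ominus> j)" using x y i j by (intro norm_mult) auto
    also have "\<dots> \<le> (qnorm x + d) * (qnorm y + d)"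
      using i j x y qnorm_nonneg[OF x] d by (intro mult_mono) auto
    finally show ?thesis .
  qed
  have "((\<lambda>d. (qnorm x + d) * (qnorm y + d)) \<longlongrightarrow> (qnorm x + 0) * (qnorm y + 0)) (at_right 0)"
    by (intro tendsto_intros)
  moreover have "\<forall>\<^sub>F d in at_right 0. qnorm (x \<otimes> y) \<le> (qnorm x + d) * (qnorm y + d)"
    unfolding eventually_at_right_field using * by (intro exI[of _ 1]) auto
  ultimately show "qnorm (x \<otimes> y) \<le> qnorm x * qnorm y"
    using tendsto_lowerbound[of "\<lambda>d. (qnorm x + d) * (qnorm y + d)" _ "at_right (0::real)"] by simp
qed

lemma qnorm_invol_le:
  assumes x: "x \<in> carrier N"
  shows "qnorm (invol N x) \<le> qnorm x"
proof (rule qnorm_leI)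
  fix d :: real assume "d > 0"
  then obtain i where i: "i \<in> J" "cnorm N (x \<ominus> i) < qnorm x + d"
    using qnorm_less[OF x, of "qnorm x + d"] by auto
  have "cnorm N (invol N x \<ominus> invol N i) = cnorm N (x \<ominus> i)"
    using x i by (simp flip: invol_diff)
  with i show "\<exists>j\<in>J. cnorm N (invol N x \<ominus> j) \<le> qnorm x + d"
    by (intro bexI[of _ "invol N i"]) (auto simp: J_D)
qed (use x in auto)

text \<open>For y = x* x let j in J nearly realize the quotient norm, and let e be an approximate
  unit for j. Then v = x - x e is congruent to x, and v* v arises from y (1 - e) by the left
  contraction 1 - \<open>invol N e\<close>. Splitting y into y - j and j bounds y (1 - e) by the
  norm of y - j plus a small rest.\<close>

lemma qnorm_cstar_identity:
  assumes x: "x \<in> carrier N"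
  shows "qnorm (invol N x \<otimes> x) = (qnorm x)\<^sup>2"
proof (rule antisym)
  have "qnorm (invol N x \<otimes> x) \<le> qnorm (invol N x) * qnorm x" using x by (intro qnorm_mult) auto
  also have "\<dots> \<le> qnorm x * qnorm x" using x by (intro mult_right_mono qnorm_invol_le qnorm_nonneg)
  finally show "qnorm (invol N x \<otimes> x) \<le> (qnorm x)\<^sup>2" by (simp add: power2_eq_square)
  define y where "y = invol N x \<otimes> x"
  have y [simp]: "y \<in> carrier N" using x by (simp add: y_def)
  show "(qnorm x)\<^sup>2 \<le> qnorm (invol N x \<otimes> x)"
    unfolding y_def[symmetric]
  proof (rule field_le_epsilon)
    fix d :: real assume "d > 0"
    then obtain j where j: "j \<in> J" "cnorm N (y \<ominus> j) < qnorm y + d/2"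
      using qnorm_less[OF y, of "qnorm y + d/2"] by auto
    obtain e where e: "e \<in> J" "\<And>y. y \<in> carrier N \<Longrightarrow> cnorm N (y \<ominus> y \<otimes> e) \<le> cnorm N y"
      "cnorm N (j \<ominus> j \<otimes> e) < d/2"
      using approximate_unit[OF j(1), of "d/2"] \<open>d > 0\<close> by auto
    have [simp]: "e \<in> carrier N" "j \<in> carrier N" using e j by auto
    \<comment> \<open>Being merged from several steps, e is not known to be self-adjoint; the bound
      for left multiplication by 1 - \<open>invol N e\<close> is the adjoint of the bound for right
      multiplication by 1 - e.\<close>
    have contr: "cnorm N (z \<ominus> invol N e \<otimes> z) \<le> cnorm N z" if "z \<in> carrier N" for z
    proof -
      have "cnorm N (z \<ominus> invol N e \<otimes> z) = cnorm N (invol N (z \<ominus> invol N e \<otimes> z))" using that by simp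
      also have "invol N (z \<ominus> invol N e \<otimes> z) = invol N z \<ominus> invol N z \<otimes> e"
        using that by (simp add: invol_diff invol_mult)
      also have "cnorm N \<dots> \<le> cnorm N z" using e(2)[of "invol N z"] that by simp
      finally show ?thesis .
    qed
    define v where "v = x \<ominus> x \<otimes> e"
    have v: "v \<in> carrier N" using x by (simp add: v_def)
    have "qnorm x = qnorm v"
      using x e v J_D(4)[of "x \<otimes> e" "1"] unfolding v_def
    proof (intro qnorm_cong)
      have "x \<otimes> e \<in> carrier N" using x by simp
      from coefficients_ex[OF x this x x x] obtain L where "coefficients L x (x \<otimes> e) x x x" .
      note L = coefficientsD[OF this]
      have "x \<ominus> (x \<ominus> x \<otimes> e) = x \<otimes> e" unfolding L(6) unfolding L(5) by (simp add: L(1-4))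
      then show "x \<ominus> (x \<ominus> x \<otimes> e) \<in> J" using x e by (simp add: ideal_left)
    qed auto
    then have "(qnorm x)\<^sup>2 \<le> (cnorm N v)\<^sup>2"
      using qnorm_le_norm[OF v] qnorm_nonneg[OF v] by (simp add: power_mono)
    also have "\<dots> = cnorm N (invol N v \<otimes> v)" using cstar_identity[OF v] by simp
    also have "invol N v \<otimes> v = (y \<ominus> invol N e \<otimes> y) \<ominus> (y \<otimes> e \<ominus> invol N e \<otimes> (y \<otimes> e))"
      using x by (simp add: v_def y_def invol_diff invol_mult diff_mult_left diff_mult_right mult_assoc)
    also have "\<dots> = (y \<ominus> y \<otimes> e) \<ominus> invol N e \<otimes> (y \<ominus> y \<otimes> e)"
      by (simp add: diff_mult_right diff_diff_swap[of y "invol N e \<otimes> y"])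
    also have "cnorm N \<dots> \<le> cnorm N (y \<ominus> y \<otimes> e)" by (intro contr) simp
    also have "\<dots> \<le> cnorm N ((y \<ominus> j) \<ominus> (y \<ominus> j) \<otimes> e) + cnorm N (j \<ominus> j \<otimes> e)"
    proof -
      have "y \<otimes> e \<in> carrier N" "j \<otimes> e \<in> carrier N" by auto
      from coefficients_ex[OF y \<open>j \<in> carrier N\<close> this y] obtain L where
        "coefficients L y j (y \<otimes> e) (j \<otimes> e) y" .
      note L = coefficientsD[OF this]
      have "y \<ominus> y \<otimes> e = ((y \<ominus> j) \<ominus> (y \<otimes> e \<ominus> j \<otimes> e)) \<oplus> (j \<ominus> j \<otimes> e)"
        unfolding L(7,8) unfolding L(5,6) by (simp add: L(1-4))
      then have "y \<ominus> y \<otimes> e = ((y \<ominus> j) \<ominus> (y \<ominus> j) \<otimes> e) \<oplus> (j \<ominus> j \<otimes> e)"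
        by (simp add: diff_mult_left)
      then show ?thesis
        using norm_triangle[of "(y \<ominus> j) \<ominus> (y \<ominus> j) \<otimes> e" "j \<ominus> j \<otimes> e"] by simp
    qed
    also have "\<dots> \<le> qnorm y + d" using e(2)[of "y \<ominus> j"] e(3) j(2) by simp
    finally show "(qnorm x)\<^sup>2 \<le> qnorm y + d" .
  qed
qed

text \<open>
  Cosets are represented by chosen elements of \<open>N\<close>, so that the quotient has its carrier in the same
  type as \<open>N\<close>.
\<close>

definition rep :: "'a \<Rightarrow> 'a" where
  "rep x = (SOME y. y \<in> carrier N \<and> x \<ominus> y \<in> J)"

lemma rep: "x \<in> carrier N \<Longrightarrow> rep x \<in> carrier N \<and> x \<ominus> rep x \<in> J"
  unfolding rep_def by (rule someI[of _ x]) (simp add: J_D)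

lemma diff_mem_trans:
  assumes "x \<in> carrier N" "y \<in> carrier N" "z \<in> carrier N" "x \<ominus> y \<in> J" "y \<ominus> z \<in> J"
  shows "x \<ominus> z \<in> J"
proof -
  from coefficients_ex[OF assms(1-3,3,3)] obtain L where "coefficients L x y z z z" .
  note L = coefficientsD[OF this]
  have "x \<ominus> z = (x \<ominus> y) \<oplus> (y \<ominus> z)" unfolding L(5-7) by (simp add: L(1-4))
  then show ?thesis using assms J_D(3) by simp
qed

lemma diff_mem_sym:
  assumes "x \<in> carrier N" "y \<in> carrier N" "x \<ominus> y \<in> J"
  shows "y \<ominus> x \<in> J"
proof -
  from coefficients_ex[OF assms(1,2,2,2,2)] obtain L where "coefficients L x y y y y" .
  note L = coefficientsD[OF this]
  have "y \<ominus> x = (-1) \<odot> (x \<ominus> y)" unfolding L(5,6) by (simp add: L(1-4))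
  then show ?thesis using J_D(4)[OF assms(3)] by simp
qed

lemma rep_eq_iff:
  assumes x: "x \<in> carrier N" and y: "y \<in> carrier N"
  shows "rep x = rep y \<longleftrightarrow> x \<ominus> y \<in> J"
proof
  assume "rep x = rep y"
  then show "x \<ominus> y \<in> J"
    using rep[OF x] rep[OF y] diff_mem_sym[OF y, of "rep y"] diff_mem_trans[OF x _ y, of "rep y"] y by auto
next
  assume "x \<ominus> y \<in> J"
  then have "(z \<in> carrier N \<and> x \<ominus> z \<in> J) = (z \<in> carrier N \<and> y \<ominus> z \<in> J)" for z
    using diff_mem_trans[OF x y, of z] diff_mem_trans[OF y x, of z] diff_mem_sym[OF x y] by blast
  then show "rep x = rep y" by (simp add: rep_def)
qed

definition quotient :: "'a cstar_alg" where
  "quotient = \<lparr>carrier = rep ` carrier N, monoid.mult = (\<lambda>x y. rep (x \<otimes> y)), one = undefined,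
     zero = rep \<zero>, add = (\<lambda>x y. rep (x \<oplus> y)), smult = (\<lambda>c x. rep (c \<odot> x)),
     invol = (\<lambda>x. rep (invol N x)), cnorm = qnorm\<rparr>"

text \<open>Operating on representatives changes the result by an element of J; for products this is
  where J being a two-sided ideal enters.\<close>

lemma rep_hom: "rep \<in> star_hom N quotient"
proof (rule star_homI)
  fix x assume x: "x \<in> carrier N"
  note rx = rep[OF x, THEN conjunct1] rep[OF x, THEN conjunct2]
  show "rep x \<in> carrier quotient" using x by (simp add: quotient_def)
  have "c \<odot> x \<ominus> c \<odot> rep x \<in> J" for c using rx x J_D(4) by (simp flip: scale_diff)
  then show "rep (c \<odot> x) = c \<odot>\<^bsub>quotient\<^esub> rep x" for c using x rx by (simp add: quotient_def rep_eq_iff)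
  have "invol N x \<ominus> invol N (rep x) \<in> J" using rx x J_D(6) by (simp flip: invol_diff)
  then show "rep (invol N x) = invol quotient (rep x)" using x rx by (simp add: quotient_def rep_eq_iff)
  fix y assume y: "y \<in> carrier N"
  note ry = rep[OF y, THEN conjunct1] rep[OF y, THEN conjunct2]
  have "(x \<oplus> y) \<ominus> (rep x \<oplus> rep y) = (x \<ominus> rep x) \<oplus> (y \<ominus> rep y)"
  proof -
    from coefficients_ex[OF x y rx(1) ry(1) y] obtain L where "coefficients L x y (rep x) (rep y) y" .
    note L = coefficientsD[OF this]
    show ?thesis unfolding L(7,8) unfolding L(5,6) by (simp add: L(1-4))
  qed
  then have "(x \<oplus> y) \<ominus> (rep x \<oplus> rep y) \<in> J" using rx ry J_D(3) by simp
  then show "rep (x \<oplus> y) = rep x \<oplus>\<^bsub>quotient\<^esub> rep y" using x rx y ry by (simp add: quotient_def rep_eq_iff)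
  have "x \<otimes> y \<ominus> rep x \<otimes> rep y = (x \<ominus> rep x) \<otimes> y \<oplus> rep x \<otimes> (y \<ominus> rep y)"
  proof -
    have "x \<otimes> y \<in> carrier N" "rep x \<otimes> y \<in> carrier N" "rep x \<otimes> rep y \<in> carrier N" using x y rx ry by auto
    from coefficients_ex[OF this y y] obtain L where
      "coefficients L (x \<otimes> y) (rep x \<otimes> y) (rep x \<otimes> rep y) y y" .
    note L = coefficientsD[OF this]
    have "x \<otimes> y \<ominus> rep x \<otimes> rep y = (x \<otimes> y \<ominus> rep x \<otimes> y) \<oplus> (rep x \<otimes> y \<ominus> rep x \<otimes> rep y)"
      unfolding L(5-7) by (simp add: L(1-4))
    then show ?thesis using x y rx ry by (simp add: diff_mult_left diff_mult_right)
  qed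
  then have "x \<otimes> y \<ominus> rep x \<otimes> rep y \<in> J" using x y rx ry by (simp add: J_D ideal_left ideal_right)
  then show "rep (x \<otimes> y) = rep x \<otimes>\<^bsub>quotient\<^esub> rep y" using x rx y ry by (simp add: quotient_def rep_eq_iff)
qed

lemma star_algebra_quotient: "star_algebra quotient"
  by (rule star_algebra_image[OF star_algebra_axioms rep_hom]) (simp_all add: quotient_def)

lemma cnorm_quotient_rep: "x \<in> carrier N \<Longrightarrow> cnorm quotient (rep x) = qnorm x"
  using rep[of x] qnorm_cong[of x "rep x"] by (simp add: quotient_def)

text \<open>A subsequence with increments below 2^(-k) is lifted term by term, each new
  representative being corrected by an element of J so as to stay near the previous one. The lifts
  converge in N, and as the whole sequence is Cauchy it has the same limit in the quotient.\<close>

lemma quotient_complete: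
  assumes s: "\<And>n. s n \<in> carrier quotient"
    and C: "\<And>e. e > 0 \<Longrightarrow> \<exists>M. \<forall>m\<ge>M. \<forall>n\<ge>M. cnorm quotient (s m \<ominus>\<^bsub>quotient\<^esub> s n) < e"
  shows "\<exists>x\<in>carrier quotient. (\<lambda>n. cnorm quotient (s n \<ominus>\<^bsub>quotient\<^esub> x)) \<longlonglongrightarrow> 0"
proof -
  have "\<exists>a. a \<in> carrier N \<and> s n = rep a" for n using s[of n] by (auto simp: quotient_def)
  then obtain a where a [simp]: "\<And>n. a n \<in> carrier N" and sa: "\<And>n. s n = rep (a n)" by metis
  have df: "cnorm quotient (rep x \<ominus>\<^bsub>quotient\<^esub> rep y) = qnorm (x \<ominus> y)"
    if "x \<in> carrier N" "y \<in> carrier N" for x y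
    using star_hom_diff[OF star_algebra_axioms star_algebra_quotient rep_hom that] that
    by (metis cnorm_quotient_rep diff_closed)
  have "\<exists>M. \<forall>m\<ge>M. \<forall>n\<ge>M. qnorm (a m \<ominus> a n) < (1/2) ^ k" for k
    using C[of "(1/2) ^ k"] by (simp add: sa df)
  then obtain M where M: "\<And>k m n. m \<ge> M k \<Longrightarrow> n \<ge> M k \<Longrightarrow> qnorm (a m \<ominus> a n) < (1/2) ^ k" by metis
  \<comment> \<open>Partial sums make both \<open>r k\<close> and \<open>r (Suc k)\<close> at least
    \<open>M k\<close>, so consecutive terms can be compared at the threshold
    \<open>M k\<close>.\<close>
  define r where "r k = (\<Sum>i\<le>k. M i)" for k
  have rM: "r k \<ge> M k" for k unfolding r_def by (rule member_le_sum) auto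
  have rM': "r (Suc k) \<ge> M k" for k using rM[of k] by (simp add: r_def)
  have "\<exists>y. \<forall>k. (y k \<in> carrier N \<and> y k \<ominus> a (r k) \<in> J) \<and> cnorm N (y (Suc k) \<ominus> y k) < (1/2) ^ k"
  proof (rule dependent_nat_choice)
    show "\<exists>y. y \<in> carrier N \<and> y \<ominus> a (r 0) \<in> J" using J_D(2) by (intro exI[of _ "a (r 0)"]) simp
    fix y k assume y: "y \<in> carrier N \<and> y \<ominus> a (r k) \<in> J"
    have "(a (r (Suc k)) \<ominus> y) \<ominus> (a (r (Suc k)) \<ominus> a (r k)) = a (r k) \<ominus> y"
    proof -
      from coefficients_ex[OF _ _ a a a] y obtain L where "coefficients L y y (a (r k)) (a (r (Suc k))) (a 0)" by blast
      note L = coefficientsD[OF this]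
      show ?thesis unfolding L(6,7,8) by (simp add: L(1-4))
    qed
    moreover have "a (r k) \<ominus> y \<in> J" using y diff_mem_sym by auto
    ultimately have "qnorm (a (r (Suc k)) \<ominus> y) = qnorm (a (r (Suc k)) \<ominus> a (r k))"
      using y by (intro qnorm_cong) auto
    then have "qnorm (a (r (Suc k)) \<ominus> y) < (1/2) ^ k" using M[OF rM' rM] by simp
    then obtain j where j: "j \<in> J" "cnorm N (a (r (Suc k)) \<ominus> y \<ominus> j) < (1/2) ^ k"
      using qnorm_less[of "a (r (Suc k)) \<ominus> y"] y by auto
    have yc: "y \<in> carrier N" using y by simp
    from coefficients_ex[OF yc J_carrier[OF j(1)] a a a] obtain L where
      "coefficients L y j (a (r (Suc k))) (a 0) (a 0)" .
    note L = coefficientsD[OF this]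
    have "a (r (Suc k)) \<ominus> j \<ominus> y = a (r (Suc k)) \<ominus> y \<ominus> j"
      "a (r (Suc k)) \<ominus> j \<ominus> a (r (Suc k)) = (-1) \<odot> j"
      unfolding L(5,6,7) by (simp_all add: L(1-4))
    then show "\<exists>z. (z \<in> carrier N \<and> z \<ominus> a (r (Suc k)) \<in> J) \<and> cnorm N (z \<ominus> y) < (1/2) ^ k"
      using j J_D(4)[OF j(1)] by (intro exI[of _ "a (r (Suc k)) \<ominus> j"]) simp
  qed
  then obtain y where y [simp]: "\<And>k. y k \<in> carrier N" and yJ: "\<And>k. y k \<ominus> a (r k) \<in> J"
    and step: "\<And>k. cnorm N (y (Suc k) \<ominus> y k) \<le> 1 * (1/2) ^ k"
    by (metis less_imp_le mult_1)
  obtain x where x: "tends y x" using geometric_tends[OF y step] by auto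
  have xc [simp]: "x \<in> carrier N" by (rule tendsD[OF x])
  have "(\<lambda>n. qnorm (a n \<ominus> x)) \<longlonglongrightarrow> 0"
  proof (rule LIMSEQ_I)
    fix e :: real assume e: "e > 0"
    have "\<forall>\<^sub>F k in sequentially. cnorm N (y k \<ominus> x) < e / 2"
      using tendsD(3)[OF x] e by (intro order_tendstoD) auto
    moreover have "\<forall>\<^sub>F k in sequentially. (1/2::real) ^ k < e / 2"
      using e by (intro order_tendstoD[OF LIMSEQ_realpow_zero]) auto
    ultimately have "\<forall>\<^sub>F k in sequentially. cnorm N (y k \<ominus> x) < e / 2 \<and> (1/2::real) ^ k < e / 2"
      by (rule eventually_conj)
    then obtain k where k: "cnorm N (y k \<ominus> x) < e / 2" "(1/2::real) ^ k < e / 2"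
      by (auto simp: eventually_sequentially)
    have "qnorm (a n \<ominus> x) < e" if n: "n \<ge> r k" for n
    proof -
      from coefficients_ex[OF xc a a a a] obtain L where
        "coefficients L x (a n) (a (r k)) (a 0) (a 0)" .
      note L = coefficientsD[OF this]
      have "a n \<ominus> x = (a n \<ominus> a (r k)) \<oplus> (a (r k) \<ominus> x)" unfolding L(5-7) by (simp add: L(1-4))
      then have "qnorm (a n \<ominus> x) \<le> qnorm (a n \<ominus> a (r k)) + qnorm (a (r k) \<ominus> x)"
        using qnorm_add[of "a n \<ominus> a (r k)" "a (r k) \<ominus> x"] by simp
      moreover have "qnorm (a n \<ominus> a (r k)) < (1/2) ^ k" using n rM[of k] by (intro M) auto
      moreover have "qnorm (a (r k) \<ominus> x) = qnorm (y k \<ominus> x)"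
      proof (intro qnorm_cong)
        from coefficients_ex[OF xc a y a a] obtain L where
          "coefficients L x (a (r k)) (y k) (a 0) (a 0)" .
        note L = coefficientsD[OF this]
        have "a (r k) \<ominus> x \<ominus> (y k \<ominus> x) = a (r k) \<ominus> y k" unfolding L(5-7) by (simp add: L(1-4))
        then show "a (r k) \<ominus> x \<ominus> (y k \<ominus> x) \<in> J" using yJ diff_mem_sym by auto
      qed auto
      moreover have "qnorm (y k \<ominus> x) \<le> cnorm N (y k \<ominus> x)" by (rule qnorm_le_norm) simp
      ultimately show ?thesis using k by linarith
    qed
    then show "\<exists>n0. \<forall>n\<ge>n0. norm (qnorm (a n \<ominus> x) - 0) < e"
      by (intro exI[of _ "r k"]) (simp add: qnorm_nonneg)
  qed
  then have "(\<lambda>n. cnorm quotient (s n \<ominus>\<^bsub>quotient\<^esub> rep x)) \<longlonglongrightarrow> 0" by (simp add: sa df)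
  moreover have "rep x \<in> carrier quotient" by (simp add: quotient_def)
  ultimately show ?thesis by blast
qed

theorem cstar_algebra_quotient: "cstar_algebra quotient"
proof -
  note hom = star_homD(2-5)[OF rep_hom, symmetric]
  have car: "\<exists>a. a \<in> carrier N \<and> x = rep a" if "x \<in> carrier quotient" for x
    using that by (auto simp: quotient_def)
  have zero: "\<zero>\<^bsub>quotient\<^esub> = rep \<zero>" by (simp add: quotient_def)
  have nonneg: "0 \<le> cnorm quotient x" if "x \<in> carrier quotient" for x
    using car[OF that] by (auto simp: cnorm_quotient_rep qnorm_nonneg)
  have eq0: "cnorm quotient x = 0 \<longleftrightarrow> x = \<zero>\<^bsub>quotient\<^esub>" if "x \<in> carrier quotient" for x
    using car[OF that] by (auto simp: cnorm_quotient_rep qnorm_eq_0_iff zero rep_eq_iff)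
  have tri: "cnorm quotient (x \<oplus>\<^bsub>quotient\<^esub> y) \<le> cnorm quotient x + cnorm quotient y"
    if "x \<in> carrier quotient" "y \<in> carrier quotient" for x y
    using car[OF that(1)] car[OF that(2)] by (auto simp: hom cnorm_quotient_rep qnorm_add)
  have sm: "cnorm quotient (c \<odot>\<^bsub>quotient\<^esub> x) = cmod c * cnorm quotient x" if "x \<in> carrier quotient" for c x
    using car[OF that] by (auto simp: hom cnorm_quotient_rep qnorm_scale)
  have mu: "cnorm quotient (x \<otimes>\<^bsub>quotient\<^esub> y) \<le> cnorm quotient x * cnorm quotient y"
    if "x \<in> carrier quotient" "y \<in> carrier quotient" for x y
    using car[OF that(1)] car[OF that(2)] by (auto simp: hom cnorm_quotient_rep qnorm_mult)
  have cs: "cnorm quotient (invol quotient x \<otimes>\<^bsub>quotient\<^esub> x) = (cnorm quotient x)\<^sup>2"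
    if "x \<in> carrier quotient" for x
    using car[OF that] by (auto simp: hom cnorm_quotient_rep qnorm_cstar_identity)
  have MS: "Metric_space (carrier quotient) (cdist quotient)"
    using star_algebra_quotient nonneg eq0 tri sm by (rule Metric_space_cdist)
  have "Metric_space.mcomplete (carrier quotient) (cdist quotient)"
    unfolding mcomplete_cdist_iff[OF star_algebra_quotient MS] using quotient_complete by blast
  then show ?thesis
    using nonneg eq0 tri sm mu cs
    by (intro cstar_algebra.intro star_algebra_quotient cstar_algebra_axioms.intro) auto
qed

end

text \<open>Let J be the closure of the image of the kernel of r. The map sending \<open>r b\<close>
  to the class of \<open>iB b\<close> extends to H on \<open>Dbar\<close>, and H after
  \<open>rb\<close> is the quotient map, as both agree on the image of B. Contractivity of H then
  bounds the distance from x to J by the norm of \<open>rb x\<close>. The quotient has its carrier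
  in the type of \<open>Bbar\<close>, so the universal property of \<open>Dbar\<close> reaches
  it.\<close>

lemma completion_surj_dist:
  fixes Bbar Dbar :: "'u cstar_alg"
  assumes cB: "is_cstar_completion B Bbar iB" and cD: "is_cstar_completion D Dbar iD"
    and B: "star_algebra B" and D: "star_algebra D"
    and r: "r \<in> star_hom B D" and surj: "r ` carrier B = carrier D"
    and x: "x \<in> carrier Bbar" and less: "cnorm Dbar (completion_map B Bbar iB Dbar iD r x) < e"
  obtains k where "k \<in> carrier B" "r k = \<zero>\<^bsub>D\<^esub>" "cnorm Bbar (x \<ominus>\<^bsub>Bbar\<^esub> iB k) < e"
proof -
  interpret B: star_algebra B by fact
  interpret D: star_algebra D by fact
  have iB: "iB \<in> star_hom B Bbar" and Bb: "cstar_algebra Bbar"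
    and iD: "iD \<in> star_hom D Dbar" and Db: "cstar_algebra Dbar"
    using cB cD by (auto simp: is_cstar_completion_def)
  interpret Bb: cstar_algebra Bbar by fact
  interpret Db: cstar_algebra Dbar by fact
  note r_hom = star_homD[OF r] and iB_hom = star_homD[OF iB]
  define K where "K = {k \<in> carrier B. r k = \<zero>\<^bsub>D\<^esub>}"
  define S where "S = iB ` K"
  define J where "J = Bb.closure_set S"
  have "star_subalgebra K B"
    by (rule B.star_subalgebraI) (use star_hom_zero[OF B D r] in \<open>auto simp: K_def r_hom\<close>)
  then have "star_algebra (B\<lparr>carrier := K\<rparr>)" by (rule B.star_algebra_subalgebra)
  moreover have "iB \<in> star_hom (B\<lparr>carrier := K\<rparr>) Bbar"
    by (rule star_homI) (auto simp: K_def iB_hom)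
  ultimately have S: "star_subalgebra S Bbar"
    using star_subalgebra_image[OF _ Bb.star_algebra_axioms] by (fastforce simp: S_def)
  have SB: "S \<subseteq> carrier Bbar" by (rule Bb.star_subalgebraD(1)[OF S])
  have seq: "\<exists>b. (\<forall>n. b n \<in> carrier B) \<and> Bb.tends (\<lambda>n. iB (b n)) y" if y: "y \<in> carrier Bbar" for y
  proof -
    have "y \<in> Bb.closure_set (iB ` carrier B)"
      unfolding Bb.closure_set_def using y completion_dense[OF cB B y] by blast
    then obtain s where s: "\<forall>n. s n \<in> iB ` carrier B" "Bb.tends s y"
      using Bb.closure_set_iff[of "iB ` carrier B"] iB_hom(1) by (metis image_subsetI)
    from s(1) have "\<forall>n. \<exists>b. b \<in> carrier B \<and> s n = iB b" by blast
    then obtain b where "\<forall>n. b n \<in> carrier B \<and> s n = iB (b n)" by metis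
    then have "s = (\<lambda>n. iB (b n))" "\<forall>n. b n \<in> carrier B" by auto
    with s(2) show ?thesis by blast
  qed
  have Jseq: "\<exists>k. (\<forall>n. k n \<in> K) \<and> Bb.tends (\<lambda>n. iB (k n)) j" if "j \<in> J" for j
  proof -
    from that obtain s where s: "\<forall>n. s n \<in> S" "Bb.tends s j"
      unfolding J_def Bb.closure_set_iff[OF SB] by blast
    from s(1) have "\<forall>n. \<exists>b. b \<in> K \<and> s n = iB b" unfolding S_def by blast
    then obtain k where "\<forall>n. k n \<in> K \<and> s n = iB (k n)" by metis
    then have "s = (\<lambda>n. iB (k n))" "\<forall>n. k n \<in> K" by auto
    with s(2) show ?thesis by blast
  qed
  have KB: "k \<in> carrier B" if "k \<in> K" for k using that by (simp add: K_def)
  have memJ: "y \<in> J" if "\<And>n. k n \<in> K" "Bb.tends (\<lambda>n. iB (k n)) y" for y k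
    unfolding J_def Bb.closure_set_iff[OF SB] using that by (intro exI[of _ "\<lambda>n. iB (k n)"]) (auto simp: S_def)
  interpret I: cstar_ideal Bbar J
  proof
    show "star_subalgebra J Bbar" unfolding J_def by (rule Bb.star_subalgebra_closure_set[OF S])
    show "y \<in> J" if "\<And>n. s n \<in> J" "Bb.tends s y" for s y
      using that Bb.closure_set_closed[OF SB] unfolding J_def by blast
    fix y j assume y: "y \<in> carrier Bbar" and j: "j \<in> J"
    obtain b where b: "\<forall>n. b n \<in> carrier B" "Bb.tends (\<lambda>n. iB (b n)) y" using seq[OF y] by (elim exE conjE)
    obtain k where k: "\<forall>n. k n \<in> K" "Bb.tends (\<lambda>n. iB (k n)) j" using Jseq[OF j] by (elim exE conjE)
    have kB: "k n \<in> carrier B" for n using k KB by blast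
    have r0: "r (k n) = \<zero>\<^bsub>D\<^esub>" for n using k by (simp add: K_def)
    show "y \<otimes>\<^bsub>Bbar\<^esub> j \<in> J"
    proof (rule memJ)
      show "b n \<otimes>\<^bsub>B\<^esub> k n \<in> K" for n using b kB r0 by (simp add: K_def r_hom)
      show "Bb.tends (\<lambda>n. iB (b n \<otimes>\<^bsub>B\<^esub> k n)) (y \<otimes>\<^bsub>Bbar\<^esub> j)"
        using Bb.tends_mult[OF b(2) k(2)] b kB by (simp add: iB_hom)
    qed
    show "j \<otimes>\<^bsub>Bbar\<^esub> y \<in> J"
    proof (rule memJ)
      show "k n \<otimes>\<^bsub>B\<^esub> b n \<in> K" for n using b kB r0 by (simp add: K_def r_hom)
      show "Bb.tends (\<lambda>n. iB (k n \<otimes>\<^bsub>B\<^esub> b n)) (j \<otimes>\<^bsub>Bbar\<^esub> y)"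
        using Bb.tends_mult[OF k(2) b(2)] b kB by (simp add: iB_hom)
    qed
  qed
  note rep = star_homD[OF I.rep_hom]
  \<comment> \<open>The chosen preimage does not matter: two preimages differ by an element of the
    kernel, which \<open>iB\<close> sends into J.\<close>
  define h where "h d = I.rep (iB (SOME b. b \<in> carrier B \<and> r b = d))" for d
  have h: "h (r b) = I.rep (iB b)" if b: "b \<in> carrier B" for b
  proof -
    define b' where "b' = (SOME b'. b' \<in> carrier B \<and> r b' = r b)"
    have "b' \<in> carrier B \<and> r b' = r b" unfolding b'_def by (rule someI[of _ b]) (use b in simp)
    then have b': "b' \<in> carrier B" "r b' = r b" by auto
    have "r (b' \<ominus>\<^bsub>B\<^esub> b) = \<zero>\<^bsub>D\<^esub>" using star_hom_diff[OF B D r b'(1) b] b' b r_hom(1) by simp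
    then have "b' \<ominus>\<^bsub>B\<^esub> b \<in> K" using b' b by (simp add: K_def)
    then have "iB (b' \<ominus>\<^bsub>B\<^esub> b) \<in> J"
      unfolding J_def using Bb.closure_set_superset[OF SB] by (auto simp: S_def)
    then have "I.rep (iB b') = I.rep (iB b)"
      using b b' star_hom_diff[OF B Bb.star_algebra_axioms iB b'(1) b] by (simp add: I.rep_eq_iff iB_hom)
    then show ?thesis by (simp add: h_def b'_def)
  qed
  have ex: "\<exists>b. b \<in> carrier B \<and> d = r b" if "d \<in> carrier D" for d using surj that by blast
  have "h \<in> star_hom D I.quotient"
  proof (rule star_homI)
    fix d assume "d \<in> carrier D"
    then obtain b where b: "b \<in> carrier B" "d = r b" using ex by blast
    show "h d \<in> carrier I.quotient" using b by (simp add: h rep iB_hom)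
    show "h (c \<odot>\<^bsub>D\<^esub> d) = c \<odot>\<^bsub>I.quotient\<^esub> h d" for c
      using b h[of "c \<odot>\<^bsub>B\<^esub> b"] by (simp add: h rep iB_hom r_hom)
    show "h (invol D d) = invol I.quotient (h d)"
      using b h[of "invol B b"] by (simp add: h rep iB_hom r_hom)
    fix d' assume "d' \<in> carrier D"
    then obtain b' where b': "b' \<in> carrier B" "d' = r b'" using ex by blast
    show "h (d \<oplus>\<^bsub>D\<^esub> d') = h d \<oplus>\<^bsub>I.quotient\<^esub> h d'"
      using b b' h[of "b \<oplus>\<^bsub>B\<^esub> b'"] by (simp add: h rep iB_hom r_hom)
    show "h (d \<otimes>\<^bsub>D\<^esub> d') = h d \<otimes>\<^bsub>I.quotient\<^esub> h d'"
      using b b' h[of "b \<otimes>\<^bsub>B\<^esub> b'"] by (simp add: h rep iB_hom r_hom)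
  qed
  with cD I.cstar_algebra_quotient obtain H where H: "H \<in> star_hom Dbar I.quotient"
    and HiD: "\<And>d. d \<in> carrier D \<Longrightarrow> H (iD d) = h d"
    unfolding is_cstar_completion_def by blast
  define rb where "rb = completion_map B Bbar iB Dbar iD r"
  note rb = completion_map[OF cB cD r, folded rb_def]
  have "H (rb x) = I.rep x"
  proof (rule completion_hom_eq[OF cB I.cstar_algebra_quotient _ I.rep_hom _ x])
    show "(\<lambda>y. H (rb y)) \<in> star_hom Bbar I.quotient" by (rule star_hom_comp[OF rb(1) H])
  qed (simp add: rb HiD h r_hom)
  then have "I.qnorm x = cnorm I.quotient (H (rb x))" using x by (simp add: I.cnorm_quotient_rep)
  also have "\<dots> \<le> cnorm Dbar (rb x)"
    by (rule star_hom_contractive[OF Db I.cstar_algebra_quotient H star_homD(1)[OF rb(1) x]])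
  also have "\<dots> < e" using less by (simp add: rb_def)
  finally obtain j where j: "j \<in> J" "cnorm Bbar (x \<ominus>\<^bsub>Bbar\<^esub> j) < e" using I.qnorm_less[OF x] by blast
  \<comment> \<open>The slack left below e is spent on replacing j by an element of the image
    itself.\<close>
  define d where "d = e - cnorm Bbar (x \<ominus>\<^bsub>Bbar\<^esub> j)"
  have "d > 0" using j by (simp add: d_def)
  with j(1) obtain k where k: "k \<in> K" "cnorm Bbar (j \<ominus>\<^bsub>Bbar\<^esub> iB k) < d"
    unfolding J_def Bb.closure_set_def S_def by blast
  have "cnorm Bbar (x \<ominus>\<^bsub>Bbar\<^esub> iB k) \<le> cnorm Bbar (x \<ominus>\<^bsub>Bbar\<^esub> j) + cnorm Bbar (j \<ominus>\<^bsub>Bbar\<^esub> iB k)"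
    using x j k KB iB_hom by (intro Bb.norm_diff_triangle) auto
  also have "\<dots> < e" using k by (simp add: d_def)
  finally show thesis using that[of k] k by (simp add: K_def)
qed

section \<open>Finite-dimensional subspaces\<close>

text \<open>Recursion over a list lets proofs adjoin one vector at a time; the vectors may be
  dependent.\<close>

primrec lspan :: "('a, 'm) star_alg_scheme \<Rightarrow> 'a list \<Rightarrow> 'a set" where
  "lspan A [] = {\<zero>\<^bsub>A\<^esub>}"
| "lspan A (v # vs) = {w \<oplus>\<^bsub>A\<^esub> c \<odot>\<^bsub>A\<^esub> v | w c. w \<in> lspan A vs}"

context star_algebra
begin

lemma lspan_closed: "set vs \<subseteq> carrier A \<Longrightarrow> lspan A vs \<subseteq> carrier A"
  by (induction vs) auto

lemma lspan_zero: "set vs \<subseteq> carrier A \<Longrightarrow> \<zero> \<in> lspan A vs"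
proof (induction vs)
  case (Cons v vs)
  then show ?case by (force intro: exI[of _ \<zero>] exI[of _ 0])
qed simp

lemma lspan_scale: "set vs \<subseteq> carrier A \<Longrightarrow> x \<in> lspan A vs \<Longrightarrow> c \<odot> x \<in> lspan A vs"
proof (induction vs arbitrary: x)
  case (Cons v vs)
  then obtain w d where w: "w \<in> lspan A vs" "x = w \<oplus> d \<odot> v" by auto
  moreover from this have "w \<in> carrier A" "v \<in> carrier A" using Cons.prems lspan_closed[of vs] by auto
  ultimately have "c \<odot> x = c \<odot> w \<oplus> (c * d) \<odot> v"
    by (simp add: scale_right_distrib scale_scale)
  moreover have "c \<odot> w \<in> lspan A vs" using Cons w by simp
  ultimately show ?case by auto
qed simp

lemma lspan_add: "set vs \<subseteq> carrier A \<Longrightarrow> x \<in> lspan A vs \<Longrightarrow> y \<in> lspan A vs \<Longrightarrow> x \<oplus> y \<in> lspan A vs"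
proof (induction vs arbitrary: x y)
  case (Cons v vs)
  then obtain w d where w: "w \<in> lspan A vs" "x = w \<oplus> d \<odot> v" by auto
  from Cons obtain w' d' where w': "w' \<in> lspan A vs" "y = w' \<oplus> d' \<odot> v" by auto
  have [simp]: "w \<in> carrier A" "w' \<in> carrier A" "v \<in> carrier A"
    using Cons.prems lspan_closed[of vs] w w' by auto
  have "x \<oplus> y = (w \<oplus> w') \<oplus> (d + d') \<odot> v"
    by (simp add: w w' scale_left_distrib a_ac)
  moreover have "w \<oplus> w' \<in> lspan A vs" using Cons w w' by simp
  ultimately show ?case by auto
qed simp

lemma lspan_mem: "set vs \<subseteq> carrier A \<Longrightarrow> v \<in> set vs \<Longrightarrow> v \<in> lspan A vs"
proof (induction vs)
  case (Cons u vs)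
  show ?case
  proof (cases "v = u")
    case True
    then show ?thesis using Cons.prems lspan_zero[of vs] by (force intro: exI[of _ \<zero>] exI[of _ 1])
  next
    case False
    then have "v \<in> lspan A vs" using Cons by simp
    moreover have "v = v \<oplus> 0 \<odot> u" using Cons.prems by auto
    ultimately show ?thesis by auto
  qed
qed simp

lemma finsum_mem_subspace:
  assumes "finite I" "\<zero> \<in> W" "W \<subseteq> carrier A" "\<And>x y. x \<in> W \<Longrightarrow> y \<in> W \<Longrightarrow> x \<oplus> y \<in> W"
    and "\<And>k. k \<in> I \<Longrightarrow> f k \<in> W"
  shows "(\<Oplus>k\<in>I. f k) \<in> W"
  using assms(1,5)
proof (induction I)
  case (insert k I)
  then have "f \<in> I \<rightarrow> carrier A" "f k \<in> carrier A" using assms(3) by auto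
  then show ?case using insert assms(4) by (simp add: finsum_insert)
qed (simp add: assms)

lemma lspan_subset:
  assumes "\<zero> \<in> W" "\<And>x y. x \<in> W \<Longrightarrow> y \<in> W \<Longrightarrow> x \<oplus> y \<in> W" "\<And>c x. x \<in> W \<Longrightarrow> c \<odot> x \<in> W" "set vs \<subseteq> W"
  shows "lspan A vs \<subseteq> W"
  using assms(4) by (induction vs) (auto simp: assms(1-3))

end

context cstar_algebra
begin

lemma tends_scale_left:
  assumes "c \<longlonglongrightarrow> d" "v \<in> carrier N"
  shows "tends (\<lambda>n. c n \<odot> v) (d \<odot> v)"
proof (rule tendsI)
  show "cnorm N (c n \<odot> v \<ominus> d \<odot> v) \<le> cmod (c n - d) * cnorm N v" for n
  proof -
    have "c n \<odot> v \<ominus> d \<odot> v = (c n - d) \<odot> v"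
      using assms(2) scale_left_distrib[of v "c n" "- d"] by (simp add: diff_eq_scale scale_scale)
    then show ?thesis using assms(2) by (simp add: norm_smult)
  qed
  have "(\<lambda>n. cmod (c n - d) * cnorm N v) \<longlonglongrightarrow> cmod (d - d) * cnorm N v"
    by (intro tendsto_intros assms(1))
  then show "(\<lambda>n. cmod (c n - d) * cnorm N v) \<longlonglongrightarrow> 0" by simp
qed (use assms(2) in auto)

lemma tends_Cauchy:
  assumes "tends s x" "e > 0"
  shows "\<exists>M. \<forall>m\<ge>M. \<forall>n\<ge>M. cnorm N (s m \<ominus> s n) < e"
proof -
  note D = tendsD[OF assms(1)]
  have "\<forall>\<^sub>F n in sequentially. cnorm N (s n \<ominus> x) < e / 2"
    using D(3) assms(2) by (intro order_tendstoD) auto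
  then obtain M where M: "\<And>n. n \<ge> M \<Longrightarrow> cnorm N (s n \<ominus> x) < e / 2" by (auto simp: eventually_sequentially)
  have "cnorm N (s m \<ominus> s n) < e" if "m \<ge> M" "n \<ge> M" for m n
    using norm_diff_triangle[OF D(1) D(2) D(1), of m n] norm_diff_commute[OF D(2) D(1), of n]
      M[OF that(1)] M[OF that(2)] by linarith
  then show ?thesis by blast
qed

text \<open>The comparison of norms and closedness are proved together. When v is adjoined to the
  span W, both properties of W give v a positive \<open>\<nu>\<close>-distance from W; this bounds
  the coefficient of v and yields both claims for the larger span. Definiteness is assumed on the
  span alone, matching a seminorm known to be definite only on an uncompleted algebra.\<close>

lemma lspan_bounded_and_closed:
  fixes \<nu> :: "'a \<Rightarrow> real"
  assumes vs: "set vs \<subseteq> carrier N"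
    and tri: "\<And>x y. x \<in> carrier N \<Longrightarrow> y \<in> carrier N \<Longrightarrow> \<nu> (x \<oplus> y) \<le> \<nu> x + \<nu> y"
    and sc: "\<And>c x. x \<in> carrier N \<Longrightarrow> \<nu> (c \<odot> x) = cmod c * \<nu> x"
    and le: "\<And>x. x \<in> carrier N \<Longrightarrow> \<nu> x \<le> cnorm N x"
    and nonneg: "\<And>x. x \<in> carrier N \<Longrightarrow> 0 \<le> \<nu> x"
    and def: "\<And>x. x \<in> lspan N vs \<Longrightarrow> \<nu> x = 0 \<Longrightarrow> x = \<zero>"
  shows "(\<exists>K. \<forall>x\<in>lspan N vs. cnorm N x \<le> K * \<nu> x) \<and>
    (\<forall>s x. (\<forall>n. s n \<in> lspan N vs) \<longrightarrow> tends s x \<longrightarrow> x \<in> lspan N vs)"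
  using vs def
proof (induction vs)
  case Nil
  have "x = \<zero>" if s: "\<forall>n. s n \<in> {\<zero>}" "tends s x" for s x
  proof -
    have "s = (\<lambda>n. \<zero>)" using s(1) by auto
    then have "tends s \<zero>" by simp
    then show ?thesis using tends_unique[OF s(2)] by simp
  qed
  then show ?case using nonneg by (auto intro: exI[of _ 0])
next
  case (Cons v vs)
  let ?W = "lspan N vs"
  have v [simp]: "v \<in> carrier N" and vs: "set vs \<subseteq> carrier N" using Cons.prems by auto
  have W [simp]: "w \<in> carrier N" if "w \<in> ?W" for w using lspan_closed[OF vs] that by auto
  have mem: "w \<oplus> c \<odot> v \<in> lspan N (v # vs)" if "w \<in> ?W" for w c using that by auto
  have WW: "w \<in> lspan N (v # vs)" if "w \<in> ?W" for w
    using mem[OF that, of 0] that by simp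
  have "x = \<zero>" if "x \<in> ?W" "\<nu> x = 0" for x using Cons.prems(2) WW that by blast
  with Cons.IH[OF vs] have IH: "\<exists>K. \<forall>x\<in>?W. cnorm N x \<le> K * \<nu> x"
    and cl: "\<And>s x. (\<forall>n. s n \<in> ?W) \<Longrightarrow> tends s x \<Longrightarrow> x \<in> ?W" by blast+
  from IH obtain K0 where K0: "\<And>x. x \<in> ?W \<Longrightarrow> cnorm N x \<le> K0 * \<nu> x" by blast
  define K where "K = max K0 0"
  have K: "cnorm N x \<le> K * \<nu> x" if "x \<in> ?W" for x
    using K0[OF that] mult_right_mono[of K0 K "\<nu> x"] nonneg[of x] that by (simp add: K_def)
  have Kp: "K \<ge> 0" by (simp add: K_def)
  have \<nu>d: "\<nu> (x \<ominus> z) \<le> \<nu> (x \<ominus> y) + \<nu> (y \<ominus> z)" if "x \<in> carrier N" "y \<in> carrier N" "z \<in> carrier N" for x y z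
  proof -
    from coefficients_ex[OF that that(1,1)] obtain L where "coefficients L x y z x x" .
    note L = coefficientsD[OF this]
    have "x \<ominus> z = (x \<ominus> y) \<oplus> (y \<ominus> z)" unfolding L(5-7) by (simp add: L(1-4))
    then show ?thesis using tri[of "x \<ominus> y" "y \<ominus> z"] that by simp
  qed
  have \<nu>c: "\<nu> (x \<ominus> y) = \<nu> (y \<ominus> x)" if "x \<in> carrier N" "y \<in> carrier N" for x y
  proof -
    from coefficients_ex[OF that that(1,1,1)] obtain L where "coefficients L x y x x x" .
    note L = coefficientsD[OF this]
    have "x \<ominus> y = (-1) \<odot> (y \<ominus> x)" unfolding L(5,6) by (simp add: L(1-4))
    then show ?thesis using sc[of "y \<ominus> x" "-1"] that by simp
  qed
  have Wd: "w \<ominus> w' \<in> ?W" if "w \<in> ?W" "w' \<in> ?W" for w w'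
    using that lspan_add[OF vs] lspan_scale[OF vs] by (simp add: diff_eq_scale)
  show ?case
  proof (cases "v \<in> ?W")
    case True
    have "lspan N (v # vs) = ?W"
      using WW lspan_add[OF vs] lspan_scale[OF vs True] by auto
    then show ?thesis using IH cl by metis
  next
    case False
    \<comment> \<open>At \<open>\<nu>\<close>-distance 0 a minimizing sequence in W would be Cauchy
      for \<open>\<nu>\<close>, hence in norm by the comparison on W. Its limit x lies in W, and
      \<nu> (v - x) = 0 contradicts definiteness.\<close>
    have "\<exists>\<delta>>0. \<forall>w\<in>?W. \<delta> \<le> \<nu> (v \<ominus> w)"
    proof (rule ccontr)
      assume "\<not> ?thesis"
      then have "\<forall>n. \<exists>w\<in>?W. \<nu> (v \<ominus> w) < inverse (real (Suc n))"
        by (metis inverse_positive_iff_positive not_less of_nat_0_less_iff zero_less_Suc)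
      then obtain w where w: "\<And>n. w n \<in> ?W" "\<And>n. \<nu> (v \<ominus> w n) < inverse (real (Suc n))" by metis
      have "\<exists>M. \<forall>m\<ge>M. \<forall>n\<ge>M. cnorm N (w m \<ominus> w n) < e" if e: "e > 0" for e
      proof -
        have "(\<lambda>n. 2 * K * inverse (real (Suc n))) \<longlonglongrightarrow> 2 * K * 0"
          by (intro tendsto_intros LIMSEQ_inverse_real_of_nat)
        then have "\<forall>\<^sub>F n in sequentially. 2 * K * inverse (real (Suc n)) < e" using e by (intro order_tendstoD) auto
        then obtain M where M: "2 * K * inverse (real (Suc M)) < e" by (auto simp: eventually_sequentially)
        have "cnorm N (w m \<ominus> w n) < e" if "m \<ge> M" "n \<ge> M" for m n
        proof -
          have inv: "inverse (real (Suc k)) \<le> inverse (real (Suc M))" if "k \<ge> M" for k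
            using that by (intro le_imp_inverse_le) auto
          have "cnorm N (w m \<ominus> w n) \<le> K * \<nu> (w m \<ominus> w n)" using w Wd by (intro K) auto
          also have "\<nu> (w m \<ominus> w n) \<le> \<nu> (w m \<ominus> v) + \<nu> (v \<ominus> w n)" using w by (intro \<nu>d) auto
          also have "\<nu> (w m \<ominus> v) = \<nu> (v \<ominus> w m)" using w by (intro \<nu>c) auto
          also have "\<nu> (v \<ominus> w m) + \<nu> (v \<ominus> w n) \<le> inverse (real (Suc M)) + inverse (real (Suc M))"
            using w(2)[of m] w(2)[of n] inv[OF that(1)] inv[OF that(2)] by linarith
          finally show ?thesis using M Kp by (simp add: mult_left_mono)
        qed
        then show ?thesis by blast
      qed
      from Cauchy_tends[OF W[OF w(1)] this] obtain x where x: "tends w x" by blast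
      then have xW: "x \<in> ?W" using cl w by blast
      have "\<nu> (v \<ominus> x) \<le> inverse (real (Suc n)) + cnorm N (w n \<ominus> x)" for n
      proof -
        have "\<nu> (v \<ominus> x) \<le> \<nu> (v \<ominus> w n) + \<nu> (w n \<ominus> x)" using w xW by (intro \<nu>d) auto
        moreover have "\<nu> (w n \<ominus> x) \<le> cnorm N (w n \<ominus> x)" using w xW by (intro le) auto
        ultimately show ?thesis using w(2)[of n] by linarith
      qed
      moreover have "(\<lambda>n. inverse (real (Suc n)) + cnorm N (w n \<ominus> x)) \<longlonglongrightarrow> 0"
        using tendsto_add_zero[OF LIMSEQ_inverse_real_of_nat tendsD(3)[OF x]] by simp
      ultimately have "\<nu> (v \<ominus> x) \<le> 0" by (intro LIMSEQ_le_const) blast+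
      then have "\<nu> (v \<ominus> x) = 0" using nonneg[of "v \<ominus> x"] xW by simp
      moreover have "v \<ominus> x \<in> lspan N (v # vs)"
        using mem[OF lspan_scale[OF vs xW, of "-1"], of 1] xW a_comm[of v "(-1) \<odot> x"] by (simp add: diff_eq_scale)
      ultimately have "v \<ominus> x = \<zero>" using Cons.prems(2) by blast
      then show False using False xW by (simp add: diff_eq_zero_iff)
    qed
    then obtain \<delta> where \<delta>: "\<delta> > 0" "\<And>w. w \<in> ?W \<Longrightarrow> \<delta> \<le> \<nu> (v \<ominus> w)" by blast
    \<comment> \<open>For c \<noteq> 0 the vector is c times the difference of v and a point of
      W.\<close>
    have coef: "cmod c * \<delta> \<le> \<nu> (w \<oplus> c \<odot> v)" if w: "w \<in> ?W" for w c
    proof (cases "c = 0")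
      case True
      then show ?thesis using w nonneg[of "w \<oplus> c \<odot> v"] by simp
    next
      case False
      have "w \<oplus> c \<odot> v = c \<odot> (v \<ominus> (- inverse c) \<odot> w)"
      proof -
        from coefficients_ex[OF v W[OF w] v v v] obtain L where "coefficients L v w v v v" .
        note L = coefficientsD[OF this]
        show ?thesis unfolding L(5,6) using False by (simp add: L(1-4))
      qed
      moreover have "\<delta> \<le> \<nu> (v \<ominus> (- inverse c) \<odot> w)" using lspan_scale[OF vs w] by (intro \<delta>)
      ultimately show ?thesis using sc[of "v \<ominus> (- inverse c) \<odot> w" c] w by (simp add: mult_left_mono)
    qed
    have "cnorm N x \<le> (K + (K * \<nu> v + cnorm N v) / \<delta>) * \<nu> x" if "x \<in> lspan N (v # vs)" for x
    proof -
      obtain w c where w: "w \<in> ?W" and x: "x = w \<oplus> c \<odot> v" using \<open>x \<in> lspan N (v # vs)\<close> by auto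
      have xN: "x \<in> carrier N" using w x by simp
      have c: "cmod c \<le> \<nu> x / \<delta>" using coef[OF w, of c] \<delta>(1) by (simp add: x field_simps)
      have "w = x \<oplus> (- c) \<odot> v"
        unfolding x using w scale_left_distrib[of v c "- c"] by (simp add: a_assoc)
      then have \<nu>w: "\<nu> w \<le> \<nu> x + cmod c * \<nu> v" using tri[of x "(- c) \<odot> v"] sc[of v "- c"] xN by simp
      have "cnorm N x \<le> cnorm N w + cmod c * cnorm N v"
        using norm_triangle[of w "c \<odot> v"] w by (simp add: x norm_smult)
      also have "\<dots> \<le> K * (\<nu> x + cmod c * \<nu> v) + cmod c * cnorm N v"
        using K[OF w] mult_left_mono[OF \<nu>w Kp] by simp
      also have "\<dots> = K * \<nu> x + cmod c * (K * \<nu> v + cnorm N v)" by (simp add: algebra_simps)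
      also have "\<dots> \<le> K * \<nu> x + \<nu> x / \<delta> * (K * \<nu> v + cnorm N v)"
        using c Kp nonneg[of v] by (intro add_left_mono mult_right_mono) auto
      also have "\<dots> = (K + (K * \<nu> v + cnorm N v) / \<delta>) * \<nu> x" by (simp add: algebra_simps add_divide_distrib)
      finally show ?thesis .
    qed
    moreover have "x \<in> lspan N (v # vs)" if s: "\<forall>n. s n \<in> lspan N (v # vs)" "tends s x" for s x
    proof -
      have "\<forall>n. \<exists>w c. w \<in> ?W \<and> s n = w \<oplus> c \<odot> v" using s(1) by auto
      then obtain w c where w: "\<And>n. w n \<in> ?W" and sn: "\<And>n. s n = w n \<oplus> c n \<odot> v" by metis
      \<comment> \<open>The coefficient bound makes the coefficients of v converge; subtracting
        these multiples leaves a convergent sequence in W, which is closed.\<close>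
      have "Cauchy c"
        unfolding Cauchy_def dist_norm
      proof (intro allI impI)
        fix e :: real assume "e > 0"
        then have "e * \<delta> > 0" using \<delta> by simp
        then obtain M where M: "\<And>m n. m \<ge> M \<Longrightarrow> n \<ge> M \<Longrightarrow> cnorm N (s m \<ominus> s n) < e * \<delta>"
          using tends_Cauchy[OF s(2)] by blast
        have "cmod (c m - c n) < e" if "m \<ge> M" "n \<ge> M" for m n
        proof -
          from coefficients_ex[OF W[OF w[of m]] W[OF w[of n]] v v v] obtain L where
            "coefficients L (w m) (w n) v v v" .
          note L = coefficientsD[OF this]
          have eq: "s m \<ominus> s n = (w m \<ominus> w n) \<oplus> (c m - c n) \<odot> v" unfolding sn L(5-7) by (simp add: L(1-4))
          have "cmod (c m - c n) * \<delta> \<le> \<nu> (s m \<ominus> s n)" unfolding eq by (intro coef Wd w)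
          also have "\<dots> \<le> cnorm N (s m \<ominus> s n)" using s by (intro le) (auto simp: tends_def)
          also have "\<dots> < e * \<delta>" using M that by blast
          finally show ?thesis using \<delta> by simp
        qed
        then show "\<exists>M. \<forall>m\<ge>M. \<forall>n\<ge>M. cmod (c m - c n) < e" by blast
      qed
      then obtain d where d: "c \<longlonglongrightarrow> d" using Cauchy_convergent convergentD by blast
      have "tends (\<lambda>n. s n \<ominus> c n \<odot> v) (x \<ominus> d \<odot> v)"
        by (intro tends_diff s(2) tends_scale_left[OF d] v)
      moreover have "s n \<ominus> c n \<odot> v = w n" for n using w sn by simp
      ultimately have "x \<ominus> d \<odot> v \<in> ?W" using cl[of w] w by simp
      from mem[OF this, of d] show ?thesis using tendsD(2)[OF s(2)] by simp
    qed
    ultimately show ?thesis by blast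
  qed
qed

end

text \<open>For b > 0 the powers of a / b stay below K, so a / b cannot exceed 1.\<close>

lemma le_of_powers_le:
  fixes a b K :: real
  assumes a: "0 \<le> a" and b: "0 \<le> b" and le: "\<And>n. a ^ (2 ^ n) \<le> K * b ^ (2 ^ n)"
  shows "a \<le> b"
proof (rule ccontr)
  assume "\<not> a \<le> b"
  then have ab: "b < a" by simp
  show False
  proof (cases "b = 0")
    case True
    then show False using le[of 0] ab by simp
  next
    case False
    then have b0: "b > 0" using b by simp
    then have q: "a / b > 1" using ab by simp
    then obtain n where "K < (a / b) ^ n" using real_arch_pow by blast
    also have "\<dots> \<le> (a / b) ^ (2 ^ n)" using q by (intro power_increasing) (auto intro: less_imp_le)
    also have "\<dots> \<le> K" using le[of n] b0 by (simp add: power_divide divide_le_eq)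
    finally show False by simp
  qed
qed

text \<open>On the span the norm is at most K' times \<open>\<nu>\<close>. For the powers h^(2^n)
  the norm is an exact power by the C*-identity while \<open>\<nu>\<close> is at most the
  corresponding power, so the constant disappears as n grows. Squaring is the only product taken
  inside F.\<close>

lemma (in cstar_algebra) norm_le_seminorm_finite_dimensional:
  fixes \<nu> :: "'a \<Rightarrow> real"
  assumes vs: "set vs \<subseteq> carrier N"
    and tri: "\<And>x y. x \<in> carrier N \<Longrightarrow> y \<in> carrier N \<Longrightarrow> \<nu> (x \<oplus> y) \<le> \<nu> x + \<nu> y"
    and sc: "\<And>c x. x \<in> carrier N \<Longrightarrow> \<nu> (c \<odot> x) = cmod c * \<nu> x"
    and le: "\<And>x. x \<in> carrier N \<Longrightarrow> \<nu> x \<le> cnorm N x"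
    and nonneg: "\<And>x. x \<in> carrier N \<Longrightarrow> 0 \<le> \<nu> x"
    and sq: "\<And>x. x \<in> carrier N \<Longrightarrow> \<nu> (x \<otimes> x) \<le> (\<nu> x)\<^sup>2"
    and def: "\<And>x. x \<in> lspan N vs \<Longrightarrow> \<nu> x = 0 \<Longrightarrow> x = \<zero>"
    and F: "F \<subseteq> lspan N vs" "\<And>x. x \<in> F \<Longrightarrow> x \<otimes> x \<in> F" and h: "h \<in> F" "invol N h = h"
  shows "cnorm N h \<le> \<nu> h"
proof -
  obtain K where K: "\<And>x. x \<in> lspan N vs \<Longrightarrow> cnorm N x \<le> K * \<nu> x"
    using lspan_bounded_and_closed[OF vs tri sc le nonneg def] by blast
  define K' where "K' = max K 0"
  have K': "cnorm N x \<le> K' * \<nu> x" "K' \<ge> 0" if "x \<in> F" for x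
    using K[of x] mult_right_mono[of K K' "\<nu> x"] nonneg[of x] that F(1) lspan_closed[OF vs]
    by (force simp: K'_def)+
  have FN: "F \<subseteq> carrier N" using F(1) lspan_closed[OF vs] by auto
  define s where "s n = ((\<lambda>x. x \<otimes> x) ^^ n) h" for n
  have s: "s n \<in> F \<and> invol N (s n) = s n \<and> cnorm N (s n) = cnorm N h ^ (2 ^ n) \<and> \<nu> (s n) \<le> \<nu> h ^ (2 ^ n)" for n
  proof (induction n)
    case (Suc n)
    have sS: "s (Suc n) = s n \<otimes> s n" by (simp add: s_def)
    have snN: "s n \<in> carrier N" using Suc FN by auto
    have "\<nu> (s n \<otimes> s n) \<le> (\<nu> (s n))\<^sup>2" by (rule sq[OF snN])
    also have "\<dots> \<le> (\<nu> h ^ (2 ^ n))\<^sup>2" using Suc nonneg[OF snN] by (intro power_mono) auto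
    finally show ?case
      using Suc snN F(2) unfolding sS by (simp add: invol_mult norm_square power_mult mult.commute flip: power_mult)
  qed (use h in \<open>simp add: s_def\<close>)
  have hN: "h \<in> carrier N" using h FN by auto
  show ?thesis
  proof (rule le_of_powers_le[of _ _ K'])
    fix n
    have "cnorm N h ^ (2 ^ n) \<le> K' * \<nu> (s n)" using s[of n] K'[of "s n"] by simp
    also have "\<dots> \<le> K' * \<nu> h ^ (2 ^ n)" using s[of n] K'(2)[of "s n"] by (intro mult_left_mono) auto
    finally show "cnorm N h ^ (2 ^ n) \<le> K' * \<nu> h ^ (2 ^ n)" .
  qed (use hN nonneg in auto)
qed

section \<open>Fixed points in convex hulls of orbits\<close>

lemma (in cstar_algebra) norm_convex_combination:
  assumes "p \<in> carrier N" "q \<in> carrier N" "0 \<le> t" "t \<le> 1"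
  shows "cnorm N (complex_of_real (1 - t) \<odot> p \<oplus> complex_of_real t \<odot> q) \<le> (1 - t) * cnorm N p + t * cnorm N q"
proof -
  have "cmod (complex_of_real (1 - t)) = 1 - t" "cmod (complex_of_real t) = t"
    using assms norm_of_real[where 'a = complex] by (metis abs_of_nonneg diff_ge_0_iff_ge)+
  then show ?thesis
    using norm_triangle[of "complex_of_real (1 - t) \<odot> p" "complex_of_real t \<odot> q"] assms(1,2)
    by (simp add: norm_smult)
qed

lemma (in cstar_algebra) diff_convex_combination:
  assumes "v \<in> carrier N" "p \<in> carrier N" "q \<in> carrier N"
  shows "v \<ominus> (complex_of_real (1 - t) \<odot> p \<oplus> complex_of_real t \<odot> q)
    = complex_of_real (1 - t) \<odot> (v \<ominus> p) \<oplus> complex_of_real t \<odot> (v \<ominus> q)"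
proof -
  from coefficients_ex[OF assms assms(1,1)] obtain L where "coefficients L v p q v v" .
  note L = coefficientsD[OF this]
  show ?thesis unfolding L(5-7) by (simp add: L(1-4))
qed

context completed_action
begin

text \<open>With binary combinations as generators, any property they preserve passes from the orbit
  to the hull by induction.\<close>

inductive_set orbit_hull :: "'u \<Rightarrow> 'u set" for y where
  orbit: "g \<in> carrier G \<Longrightarrow> act g y \<in> orbit_hull y"
| convex: "\<lbrakk>x \<in> orbit_hull y; z \<in> orbit_hull y; 0 \<le> t; t \<le> 1\<rbrakk> \<Longrightarrow>
    complex_of_real (1 - t) \<odot> x \<oplus> complex_of_real t \<odot> z \<in> orbit_hull y"

lemma hull_closed: "x \<in> orbit_hull y \<Longrightarrow> y \<in> carrier Mbar \<Longrightarrow> x \<in> carrier Mbar"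
  by (induction rule: orbit_hull.induct) auto

lemma hull_self: "y \<in> carrier Mbar \<Longrightarrow> y \<in> orbit_hull y"
  using orbit_hull.orbit[of "\<one>\<^bsub>G\<^esub>" y] by (simp add: act_one)

lemma hull_act:
  assumes "x \<in> orbit_hull y" "y \<in> carrier Mbar" "g \<in> carrier G"
  shows "act g x \<in> orbit_hull y"
  using assms
proof (induction rule: orbit_hull.induct)
  case (orbit h)
  then show ?case using orbit_hull.orbit[of "g \<otimes>\<^bsub>G\<^esub> h" y] by (simp add: act_mult)
next
  case (convex x z t)
  then show ?case
    using orbit_hull.convex[of "act g x" y "act g z" t] hull_closed[OF convex(1)] hull_closed[OF convex(2)]
    by (simp add: star_homD[OF act_hom[OF \<open>g \<in> carrier G\<close>]])
qed

lemma hull_trans: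
  assumes "x \<in> orbit_hull y" "w \<in> orbit_hull x" "y \<in> carrier Mbar"
  shows "w \<in> orbit_hull y"
  using assms(2)
  by (induction rule: orbit_hull.induct) (blast intro: hull_act[OF assms(1,3)] orbit_hull.convex)+

text \<open>This serves for distances to a point, for distances between two translates, for
  \<open>\<nu>\<close>, and for the sum of norms behind the lower bound on the fixed point.\<close>

lemma hull_convex_le:
  assumes "x \<in> orbit_hull y" "y \<in> carrier Mbar"
    and "\<And>g. g \<in> carrier G \<Longrightarrow> \<Phi> (act g y) \<le> (d :: real)"
    and conv: "\<And>p q t. \<lbrakk>p \<in> carrier Mbar; q \<in> carrier Mbar; 0 \<le> t; t \<le> 1\<rbrakk> \<Longrightarrow>
      \<Phi> (complex_of_real (1 - t) \<odot> p \<oplus> complex_of_real t \<odot> q) \<le> (1 - t) * \<Phi> p + t * \<Phi> q"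
  shows "\<Phi> x \<le> d"
  using assms(1)
proof (induction rule: orbit_hull.induct)
  case (convex x z t)
  have "\<Phi> (complex_of_real (1 - t) \<odot> x \<oplus> complex_of_real t \<odot> z) \<le> (1 - t) * \<Phi> x + t * \<Phi> z"
    using convex assms(2) hull_closed by (intro conv) auto
  also have "\<dots> \<le> (1 - t) * d + t * d" using convex by (intro add_mono mult_left_mono) auto
  also have "\<dots> = d" by (simp add: algebra_simps)
  finally show ?case .
qed (rule assms(3))

lemma hull_dist_le:
  assumes "x \<in> orbit_hull y" "y \<in> carrier Mbar" "v \<in> carrier Mbar"
    and "\<And>g. g \<in> carrier G \<Longrightarrow> cnorm Mbar (v \<ominus> act g y) \<le> d"
  shows "cnorm Mbar (v \<ominus> x) \<le> d"
proof (rule hull_convex_le[OF assms(1,2), where \<Phi> = "\<lambda>x. cnorm Mbar (v \<ominus> x)", OF assms(4)])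
  fix p q and t :: real
  assume "p \<in> carrier Mbar" "q \<in> carrier Mbar" "0 \<le> t" "t \<le> 1"
  then show "cnorm Mbar (v \<ominus> (complex_of_real (1 - t) \<odot> p \<oplus> complex_of_real t \<odot> q))
      \<le> (1 - t) * cnorm Mbar (v \<ominus> p) + t * cnorm Mbar (v \<ominus> q)"
    unfolding Mbar.diff_convex_combination[OF assms(3) \<open>p \<in> carrier Mbar\<close> \<open>q \<in> carrier Mbar\<close>]
    using assms(3) by (intro Mbar.norm_convex_combination) auto
qed

lemma hull_act_dist_le:
  assumes x: "x \<in> orbit_hull y" and y: "y \<in> carrier Mbar" and g: "g \<in> carrier G" and k: "k \<in> carrier G"
    and le: "\<And>h. h \<in> carrier G \<Longrightarrow> cnorm Mbar (act g (act h y) \<ominus> act k (act h y)) \<le> d"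
  shows "cnorm Mbar (act g x \<ominus> act k x) \<le> d"
proof (rule hull_convex_le[OF x y, where \<Phi> = "\<lambda>x. cnorm Mbar (act g x \<ominus> act k x)", OF le])
  fix p q and t :: real
  assume pq: "p \<in> carrier Mbar" "q \<in> carrier Mbar" "0 \<le> t" "t \<le> 1"
  have cl: "act g p \<in> carrier Mbar" "act g q \<in> carrier Mbar" "act k p \<in> carrier Mbar" "act k q \<in> carrier Mbar"
    using pq g k by auto
  from Mbar.coefficients_ex[OF cl cl(1)] obtain L where
    "Mbar.coefficients L (act g p) (act g q) (act k p) (act k q) (act g p)" .
  note L = Mbar.coefficientsD[OF this]
  let ?z = "complex_of_real (1 - t) \<odot> p \<oplus> complex_of_real t \<odot> q"
  have "act g ?z \<ominus> act k ?z = complex_of_real (1 - t) \<odot> (act g p \<ominus> act k p)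
      \<oplus> complex_of_real t \<odot> (act g q \<ominus> act k q)"
    using pq unfolding star_homD(2)[OF act_hom[OF g] Mbar.scale_closed Mbar.scale_closed, OF pq(1,2)]
      star_homD(2)[OF act_hom[OF k] Mbar.scale_closed Mbar.scale_closed, OF pq(1,2)]
      star_homD(3)[OF act_hom[OF g] pq(1)] star_homD(3)[OF act_hom[OF g] pq(2)]
      star_homD(3)[OF act_hom[OF k] pq(1)] star_homD(3)[OF act_hom[OF k] pq(2)]
    unfolding L(5-8) by (simp add: L(1-4))
  then show "cnorm Mbar (act g ?z \<ominus> act k ?z)
      \<le> (1 - t) * cnorm Mbar (act g p \<ominus> act k p) + t * cnorm Mbar (act g q \<ominus> act k q)"
    using pq cl Mbar.norm_convex_combination[of "act g p \<ominus> act k p" "act g q \<ominus> act k q" t] by simp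
qed

text \<open>The scalars are real because W is once a complex span and once the real subspace of
  self-adjoint elements.\<close>

lemma hull_subset:
  assumes "x \<in> orbit_hull y" "\<And>g. g \<in> carrier G \<Longrightarrow> act g y \<in> W"
    and "\<And>x y. x \<in> W \<Longrightarrow> y \<in> W \<Longrightarrow> x \<oplus> y \<in> W"
    and "\<And>t x. x \<in> W \<Longrightarrow> complex_of_real t \<odot> x \<in> W"
  shows "x \<in> W"
  using assms(1) by (induction rule: orbit_hull.induct) (use assms(2-4) in blast)+

text \<open>
  Successive midpoints give each of the \<open>n\<close> points \<open>act k w\<close> a weight of at least \<open>2 ^ (- n)\<close>, which accounts
  for the factor in the last estimate.
\<close>

lemma averaging:
  assumes "\<Gamma> \<noteq> []" "set \<Gamma> \<subseteq> carrier G" and w: "w \<in> carrier Mbar"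
  obtains z where "z \<in> orbit_hull w"
    and "\<And>v d. \<lbrakk>v \<in> carrier Mbar; \<And>k. k \<in> set \<Gamma> \<Longrightarrow> cnorm Mbar (v \<ominus> act k w) \<le> d\<rbrakk> \<Longrightarrow>
      cnorm Mbar (v \<ominus> z) \<le> d"
    and "\<And>v d k. \<lbrakk>v \<in> carrier Mbar; \<And>k. k \<in> set \<Gamma> \<Longrightarrow> cnorm Mbar (v \<ominus> act k w) \<le> d;
      k \<in> set \<Gamma>; cnorm Mbar (v \<ominus> act k w) \<le> d / 2\<rbrakk> \<Longrightarrow>
      cnorm Mbar (v \<ominus> z) \<le> d * (1 - (1/2) ^ length \<Gamma>)"
proof -
  have "\<exists>z\<in>orbit_hull w.
    (\<forall>v\<in>carrier Mbar. \<forall>d. (\<forall>k\<in>set \<Gamma>. cnorm Mbar (v \<ominus> act k w) \<le> d) \<longrightarrow>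
      cnorm Mbar (v \<ominus> z) \<le> d \<and>
      ((\<exists>k\<in>set \<Gamma>. cnorm Mbar (v \<ominus> act k w) \<le> d / 2) \<longrightarrow>
        cnorm Mbar (v \<ominus> z) \<le> d * (1 - (1/2) ^ length \<Gamma>)))"
    using assms(1,2)
  proof (induction \<Gamma> rule: list_nonempty_induct)
    case (single k)
    then show ?case using orbit_hull.orbit[of k w] by (intro bexI[of _ "act k w"]) auto
  next
    case (cons k \<Gamma>)
    then obtain z where z: "z \<in> orbit_hull w" and zd: "\<And>v d. v \<in> carrier Mbar \<Longrightarrow>
        (\<forall>k\<in>set \<Gamma>. cnorm Mbar (v \<ominus> act k w) \<le> d) \<Longrightarrow>
        cnorm Mbar (v \<ominus> z) \<le> d \<and>
        ((\<exists>k\<in>set \<Gamma>. cnorm Mbar (v \<ominus> act k w) \<le> d / 2) \<longrightarrow>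
          cnorm Mbar (v \<ominus> z) \<le> d * (1 - (1/2) ^ length \<Gamma>))"
      by auto
    have k: "k \<in> carrier G" using cons by simp
    have zM: "z \<in> carrier Mbar" using z w by (rule hull_closed)
    \<comment> \<open>With equal weights on the new point and the old average, half of the gain
      survives: d/2 + d (1 - 2^(-n)) / 2 = d (1 - 2^(-n-1)).\<close>
    define z' where "z' = complex_of_real (1 - 1/2) \<odot> act k w \<oplus> complex_of_real (1/2) \<odot> z"
    have z': "z' \<in> orbit_hull w" unfolding z'_def by (intro orbit_hull.convex orbit_hull.orbit k z) auto
    have conv: "cnorm Mbar (v \<ominus> z') \<le> cnorm Mbar (v \<ominus> act k w) / 2 + cnorm Mbar (v \<ominus> z) / 2"
      if v: "v \<in> carrier Mbar" for v
      using Mbar.norm_convex_combination[of "v \<ominus> act k w" "v \<ominus> z" "1/2"] v k w zM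
        Mbar.diff_convex_combination[of v "act k w" z "1/2"] by (simp add: z'_def)
    have len: "(1/2::real) ^ length \<Gamma> \<le> 1/2"
      using cons(1) power_decreasing[of 1 "length \<Gamma>" "1/2::real"] by (cases \<Gamma>) auto
    show ?case
    proof (intro bexI[OF _ z'] ballI allI impI)
      fix v d assume v: "v \<in> carrier Mbar" and all: "\<forall>k\<in>set (k # \<Gamma>). cnorm Mbar (v \<ominus> act k w) \<le> d"
      then have kd: "cnorm Mbar (v \<ominus> act k w) \<le> d" and
        rest: "\<forall>k\<in>set \<Gamma>. cnorm Mbar (v \<ominus> act k w) \<le> d" by auto
      have d: "0 \<le> d" by (rule order_trans[OF Mbar.norm_nonneg kd]) (use v k w in auto)
      note zd' = zd[OF v rest]
      have one: "cnorm Mbar (v \<ominus> z') \<le> d" using conv[OF v] kd zd' by linarith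
      have "cnorm Mbar (v \<ominus> z') \<le> d * (1 - (1/2) ^ length (k # \<Gamma>))"
        if k': "k' \<in> set (k # \<Gamma>)" "cnorm Mbar (v \<ominus> act k' w) \<le> d / 2" for k'
      proof (cases "k' \<in> set \<Gamma>")
        case True
        then have "cnorm Mbar (v \<ominus> z) \<le> d * (1 - (1/2) ^ length \<Gamma>)" using zd' k' by blast
        then show ?thesis using conv[OF v] kd by (simp add: algebra_simps)
      next
        case False
        then have "cnorm Mbar (v \<ominus> act k w) \<le> d / 2" using k' by simp
        \<comment> \<open>The new point contributes d/4 and the average d/2; as the tail is
          nonempty, \<open>(1/2) ^ length (k # \<Gamma>)\<close> is at most 1/4.\<close>
        then have "cnorm Mbar (v \<ominus> z') \<le> d * (3/4)" using conv[OF v] zd' by simp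
        also have "\<dots> \<le> d * (1 - (1/2) ^ length (k # \<Gamma>))" using len d by (intro mult_left_mono) auto
        finally show ?thesis .
      qed
      with one show "cnorm Mbar (v \<ominus> z') \<le> d \<and>
        ((\<exists>k\<in>set (k # \<Gamma>). cnorm Mbar (v \<ominus> act k w) \<le> d / 2) \<longrightarrow>
          cnorm Mbar (v \<ominus> z') \<le> d * (1 - (1/2) ^ length (k # \<Gamma>)))" by blast
    qed
  qed
  then obtain z where "z \<in> orbit_hull w" "\<forall>v\<in>carrier Mbar. \<forall>d. (\<forall>k\<in>set \<Gamma>. cnorm Mbar (v \<ominus> act k w) \<le> d) \<longrightarrow>
      cnorm Mbar (v \<ominus> z) \<le> d \<and>
      ((\<exists>k\<in>set \<Gamma>. cnorm Mbar (v \<ominus> act k w) \<le> d / 2) \<longrightarrow>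
        cnorm Mbar (v \<ominus> z) \<le> d * (1 - (1/2) ^ length \<Gamma>))" by blast
  then show thesis by (intro that[of z]) blast+
qed

definition oscillation_le :: "'u \<Rightarrow> real \<Rightarrow> bool" where
  "oscillation_le x d \<longleftrightarrow> (\<forall>g\<in>carrier G. cnorm Mbar (act g x \<ominus> x) \<le> d)"

text \<open>Translating by the inverse of k turns the distance of two orbit points into a
  displacement of w.\<close>

lemma oscillation_leD:
  assumes "oscillation_le w d" "w \<in> carrier Mbar" "g \<in> carrier G" "k \<in> carrier G"
  shows "cnorm Mbar (act g w \<ominus> act k w) \<le> d"
proof -
  have "act (inv\<^bsub>G\<^esub> k \<otimes>\<^bsub>G\<^esub> g) w \<ominus> w = act (inv\<^bsub>G\<^esub> k) (act g w \<ominus> act k w)"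
    using assms by (simp add: act_mult act_diff act_inv)
  then have "cnorm Mbar (act g w \<ominus> act k w) = cnorm Mbar (act (inv\<^bsub>G\<^esub> k \<otimes>\<^bsub>G\<^esub> g) w \<ominus> w)"
    using assms by simp
  then show ?thesis using assms by (simp add: oscillation_le_def)
qed

text \<open>Every orbit point of w is within d / 2 of one \<open>act k w\<close> and within d of the
  others, so it is closer than d to their weighted mean z. By convexity the bound extends from the
  orbit to the hull of w, which contains all translates of z.\<close>

lemma oscillation_shrink:
  assumes y: "y \<in> carrier Mbar" and \<Gamma>: "\<Gamma> \<noteq> []" "set \<Gamma> \<subseteq> carrier G"
    and net: "\<And>g. g \<in> carrier G \<Longrightarrow> \<exists>k\<in>set \<Gamma>. \<forall>x\<in>orbit_hull y. cnorm Mbar (act g x \<ominus> act k x) \<le> d / 2"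
    and w: "w \<in> orbit_hull y" "oscillation_le w d"
  obtains z where "z \<in> orbit_hull w" "oscillation_le z (d * (1 - (1/2) ^ length \<Gamma>))"
proof -
  have wM: "w \<in> carrier Mbar" using w(1) y by (rule hull_closed)
  obtain z where z: "z \<in> orbit_hull w" and zd: "\<And>v d k. \<lbrakk>v \<in> carrier Mbar; \<And>k. k \<in> set \<Gamma> \<Longrightarrow> cnorm Mbar (v \<ominus> act k w) \<le> d;
      k \<in> set \<Gamma>; cnorm Mbar (v \<ominus> act k w) \<le> d / 2\<rbrakk> \<Longrightarrow>
      cnorm Mbar (v \<ominus> z) \<le> d * (1 - (1/2) ^ length \<Gamma>)"
    using averaging[OF \<Gamma> wM] by metis
  have zM: "z \<in> carrier Mbar" using z wM by (rule hull_closed)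
  have orb: "cnorm Mbar (z \<ominus> act g w) \<le> d * (1 - (1/2) ^ length \<Gamma>)" if g: "g \<in> carrier G" for g
  proof -
    obtain k where k: "k \<in> set \<Gamma>" "cnorm Mbar (act g w \<ominus> act k w) \<le> d / 2"
      using net[OF g] w(1) by blast
    have "cnorm Mbar (act g w \<ominus> z) \<le> d * (1 - (1/2) ^ length \<Gamma>)"
      by (rule zd[OF _ _ k]) (use g \<Gamma> wM in \<open>auto intro: oscillation_leD[OF w(2)]\<close>)
    then show ?thesis using Mbar.norm_diff_commute[OF zM act_closed[OF g wM]] by simp
  qed
  have "oscillation_le z (d * (1 - (1/2) ^ length \<Gamma>))"
    unfolding oscillation_le_def
  proof
    fix h assume h: "h \<in> carrier G"
    have "cnorm Mbar (z \<ominus> act h z) \<le> d * (1 - (1/2) ^ length \<Gamma>)"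
      by (rule hull_dist_le[OF hull_act[OF z wM h] wM zM orb])
    then show "cnorm Mbar (act h z \<ominus> z) \<le> d * (1 - (1/2) ^ length \<Gamma>)"
      using Mbar.norm_diff_commute[OF zM act_closed[OF h zM]] by simp
  qed
  with z show thesis by (rule that)
qed

text \<open>A positive infimum D of the attainable oscillations is impossible: one net at scale D /
  2 serves all points of the hull at once, so the factor r < 1 is fixed, and a point of oscillation
  below D / r is improved to below D.\<close>

lemma oscillation_small:
  assumes y: "y \<in> carrier Mbar"
    and net: "\<And>\<epsilon>. \<epsilon> > 0 \<Longrightarrow> \<exists>\<Gamma>. \<Gamma> \<noteq> [] \<and> set \<Gamma> \<subseteq> carrier G \<and>
      (\<forall>g\<in>carrier G. \<exists>k\<in>set \<Gamma>. \<forall>x\<in>orbit_hull y. cnorm Mbar (act g x \<ominus> act k x) \<le> \<epsilon>)"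
    and e: "e > 0"
  obtains w where "w \<in> orbit_hull y" "oscillation_le w e"
proof -
  define S where "S = {d. \<exists>w\<in>orbit_hull y. oscillation_le w d}"
  have S0: "0 \<le> d" if "d \<in> S" for d
  proof -
    obtain w where w: "w \<in> orbit_hull y" "oscillation_le w d" using \<open>d \<in> S\<close> by (auto simp: S_def)
    then have "cnorm Mbar (act \<one>\<^bsub>G\<^esub> w \<ominus> w) \<le> d" by (simp add: oscillation_le_def)
    then show ?thesis using hull_closed[OF w(1) y] by (simp add: act_one)
  qed
  have bdd: "bdd_below S" using S0 by (intro bdd_belowI[of _ 0])
  have "oscillation_le y (2 * cnorm Mbar y)"
    unfolding oscillation_le_def
  proof
    fix g assume "g \<in> carrier G"
    then show "cnorm Mbar (act g y \<ominus> y) \<le> 2 * cnorm Mbar y"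
      using y Mbar.norm_diff_le[of "act g y" y] by simp
  qed
  then have ne: "S \<noteq> {}" using hull_self[OF y] by (auto simp: S_def)
  define D where "D = Inf S"
  have D0: "0 \<le> D" unfolding D_def using ne S0 by (intro cInf_greatest)
  have "D = 0"
  proof (rule ccontr)
    assume "D \<noteq> 0"
    then have D: "D > 0" using D0 by simp
    then obtain \<Gamma> where \<Gamma>: "\<Gamma> \<noteq> []" "set \<Gamma> \<subseteq> carrier G"
      and \<Gamma>n: "\<And>g. g \<in> carrier G \<Longrightarrow> \<exists>k\<in>set \<Gamma>. \<forall>x\<in>orbit_hull y. cnorm Mbar (act g x \<ominus> act k x) \<le> D / 2"
      using net[of "D/2"] by auto
    define r where "r = 1 - (1/2::real) ^ length \<Gamma>"
    have r: "0 < r" "r < 1"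
      using \<Gamma>(1) power_decreasing[of 1 "length \<Gamma>" "1/2::real"] by (cases \<Gamma>; auto simp: r_def)+
    have "D < D / r" using D r by (simp add: field_simps)
    then obtain d where d: "d \<in> S" "d < D / r" using cInf_lessD[OF ne] unfolding D_def by blast
    then obtain w where w: "w \<in> orbit_hull y" "oscillation_le w d" by (auto simp: S_def)
    have "D \<le> d" unfolding D_def using d(1) bdd by (rule cInf_lower)
    have "\<exists>k\<in>set \<Gamma>. \<forall>x\<in>orbit_hull y. cnorm Mbar (act g x \<ominus> act k x) \<le> d / 2" if "g \<in> carrier G" for g
      using \<Gamma>n[OF that] \<open>D \<le> d\<close> by (meson divide_right_mono order_trans zero_le_numeral)
    then obtain z where z: "z \<in> orbit_hull w" "oscillation_le z (d * r)"
      using oscillation_shrink[OF y \<Gamma> _ w] unfolding r_def by blast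
    then have "d * r \<in> S" using hull_trans[OF w(1) z(1) y] by (auto simp: S_def)
    then have "D \<le> d * r" unfolding D_def using bdd by (rule cInf_lower)
    with d(2) r show False by (simp add: field_simps)
  qed
  then have "Inf S < e" using e by (simp add: D_def)
  then obtain d where d: "d \<in> S" "d < e" using cInf_lessD[OF ne] by blast
  then obtain w where w: "w \<in> orbit_hull y" "oscillation_le w d" by (auto simp: S_def)
  moreover have "oscillation_le w e" using w(2) d(2) by (auto simp: oscillation_le_def)
  ultimately show thesis using that by blast
qed

text \<open>Each point is taken in the hull of its predecessor, which has oscillation at most
  2^(-n), so consecutive points differ by no more than that. The nesting makes the sequence Cauchy;
  vanishing oscillation makes its limit fixed.\<close>

lemma fixed_point_of_nets:
  assumes y: "y \<in> carrier Mbar"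
    and net: "\<And>\<epsilon>. \<epsilon> > 0 \<Longrightarrow> \<exists>\<Gamma>. \<Gamma> \<noteq> [] \<and> set \<Gamma> \<subseteq> carrier G \<and>
      (\<forall>g\<in>carrier G. \<exists>k\<in>set \<Gamma>. \<forall>x\<in>orbit_hull y. cnorm Mbar (act g x \<ominus> act k x) \<le> \<epsilon>)"
  obtains s e where "\<And>n. s n \<in> orbit_hull y" "Mbar.tends s e" "\<And>g. g \<in> carrier G \<Longrightarrow> act g e = e"
proof -
  have small: "\<exists>z. z \<in> orbit_hull w \<and> oscillation_le z d" if "w \<in> orbit_hull y" "d > 0" for w d
  proof -
    have wM: "w \<in> carrier Mbar" using that(1) y by (rule hull_closed)
    have "\<exists>\<Gamma>. \<Gamma> \<noteq> [] \<and> set \<Gamma> \<subseteq> carrier G \<and>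
      (\<forall>g\<in>carrier G. \<exists>k\<in>set \<Gamma>. \<forall>x\<in>orbit_hull w. cnorm Mbar (act g x \<ominus> act k x) \<le> \<epsilon>)"
      if "\<epsilon> > 0" for \<epsilon>
    proof -
      obtain \<Gamma> where \<Gamma>: "\<Gamma> \<noteq> []" "set \<Gamma> \<subseteq> carrier G" "\<forall>g\<in>carrier G. \<exists>k\<in>set \<Gamma>.
          \<forall>x\<in>orbit_hull y. cnorm Mbar (act g x \<ominus> act k x) \<le> \<epsilon>"
        using net[OF \<open>\<epsilon> > 0\<close>] by (elim exE conjE)
      have "orbit_hull w \<subseteq> orbit_hull y" using hull_trans[OF \<open>w \<in> orbit_hull y\<close> _ y] by blast
      with \<Gamma> show ?thesis by (intro exI[of _ \<Gamma>]) blast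
    qed
    then show ?thesis by (rule oscillation_small[OF wM _ that(2)]) blast+
  qed
  have "\<exists>s. \<forall>n. (s n \<in> orbit_hull y \<and> oscillation_le (s n) ((1/2) ^ n)) \<and> s (Suc n) \<in> orbit_hull (s n)"
  proof (rule dependent_nat_choice)
    show "\<exists>x. x \<in> orbit_hull y \<and> oscillation_le x ((1/2) ^ 0)" using small[OF hull_self[OF y], of 1] by auto
    fix x n assume x: "x \<in> orbit_hull y \<and> oscillation_le x ((1/2) ^ n)"
    then obtain z where "z \<in> orbit_hull x" "oscillation_le z ((1/2) ^ Suc n)" using small[of x "(1/2) ^ Suc n"] by auto
    then show "\<exists>z. (z \<in> orbit_hull y \<and> oscillation_le z ((1/2) ^ Suc n)) \<and> z \<in> orbit_hull x"
      using hull_trans[OF _ _ y] x by blast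
  qed
  then obtain s where "\<forall>n. (s n \<in> orbit_hull y \<and> oscillation_le (s n) ((1/2) ^ n)) \<and> s (Suc n) \<in> orbit_hull (s n)"
    by (elim exE)
  then have s: "\<And>n. s n \<in> orbit_hull y" "\<And>n. oscillation_le (s n) ((1/2) ^ n)"
    and sS: "\<And>n. s (Suc n) \<in> orbit_hull (s n)" by auto
  have sM: "s n \<in> carrier Mbar" for n using s(1) y by (rule hull_closed)
  have step: "cnorm Mbar (s (Suc n) \<ominus> s n) \<le> 1 * (1/2) ^ n" for n
  proof -
    have "cnorm Mbar (s n \<ominus> s (Suc n)) \<le> (1/2) ^ n"
    proof (rule hull_dist_le[OF sS sM sM])
      fix g assume g: "g \<in> carrier G"
      show "cnorm Mbar (s n \<ominus> act g (s n)) \<le> (1/2) ^ n"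
        using s(2)[of n] g Mbar.norm_diff_commute[OF sM act_closed[OF g sM], of n n]
        by (simp add: oscillation_le_def)
    qed
    then show ?thesis using Mbar.norm_diff_commute[OF sM sM, of n "Suc n"] by simp
  qed
  obtain e where e: "Mbar.tends s e" using Mbar.geometric_tends[OF sM step] by auto
  have eM: "e \<in> carrier Mbar" by (rule Mbar.tendsD[OF e])
  have "act g e = e" if g: "g \<in> carrier G" for g
  proof -
    have t: "Mbar.tends (\<lambda>n. act g (s n) \<ominus> s n) (act g e \<ominus> e)"
      by (intro Mbar.tends_diff e star_hom_tends[OF cstar_algebra_Mbar cstar_algebra_Mbar act_hom[OF g]])
    have "(\<lambda>n. cnorm Mbar (act g (s n) \<ominus> s n)) \<longlonglongrightarrow> 0"
    proof (rule tendsto_sandwich[OF _ _ tendsto_const])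
      show "(\<lambda>n. (1/2::real) ^ n) \<longlonglongrightarrow> 0" by (rule LIMSEQ_realpow_zero) auto
    qed (use s(2) g sM in \<open>auto simp: oscillation_le_def\<close>)
    with Mbar.tends_norm[OF t] have "cnorm Mbar (act g e \<ominus> e) = 0" by (rule LIMSEQ_unique)
    then show ?thesis using g eM by (simp add: Mbar.norm_eq_0 Mbar.diff_eq_zero_iff)
  qed
  with s(1) e show thesis by (rule that)
qed

text \<open>Covers for the single points are intersected to a common refinement.\<close>

lemma joint_cover:
  assumes "finite A" "A \<subseteq> carrier M" "\<epsilon> > 0"
  shows "\<exists>\<U>. finite \<U> \<and> \<Union>\<U> = carrier G \<and>
    (\<forall>U\<in>\<U>. \<forall>g\<in>U. \<forall>g'\<in>U. \<forall>a\<in>A. cnorm Mbar (act g (i a) \<ominus> act g' (i a)) \<le> \<epsilon>)"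
  using assms(1,2)
proof (induction A)
  case empty
  show ?case by (intro exI[of _ "{carrier G}"]) auto
next
  case (insert a A)
  then obtain \<U> where \<U>: "finite \<U>" "\<Union>\<U> = carrier G"
    "\<forall>U\<in>\<U>. \<forall>g\<in>U. \<forall>g'\<in>U. \<forall>a\<in>A. cnorm Mbar (act g (i a) \<ominus> act g' (i a)) \<le> \<epsilon>" by auto
  obtain n :: nat where n: "1 / \<epsilon> < n" using reals_Archimedean2 by blast
  moreover have "0 < 1 / \<epsilon>" using assms(3) by simp
  ultimately have n0: "0 < real n" by linarith
  then have n1: "n \<ge> 1" "1 / n \<le> \<epsilon>" using n assms(3) by (simp_all add: field_simps)
  have "a \<in> carrier M" using insert by simp
  from orbit_cover[OF this] n1(1) obtain \<V> where \<V>: "finite \<V>" "\<Union>\<V> = carrier G"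
    "\<forall>U\<in>\<V>. \<forall>g\<in>U. \<forall>g'\<in>U. cnorm Mbar (act g (i a) \<ominus> act g' (i a)) \<le> 1 / n" by metis
  let ?W = "(\<lambda>(U, V). U \<inter> V) ` (\<U> \<times> \<V>)"
  have "finite ?W" using \<U> \<V> by simp
  moreover have "\<Union>?W = carrier G" using \<U>(2) \<V>(2) by blast
  moreover have "cnorm Mbar (act g (i b) \<ominus> act g' (i b)) \<le> \<epsilon>"
    if "U \<in> \<U>" "V \<in> \<V>" "g \<in> U \<inter> V" "g' \<in> U \<inter> V" "b \<in> insert a A" for U V g g' b
    using that \<U>(3) \<V>(3) n1(2) by (metis IntE insertE order_trans)
  ultimately show ?case by (intro exI[of _ ?W]) blast
qed

text \<open>Two nets are combined: a finite H follows the orbit of a up to \<epsilon> / 3, and K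
  follows the action on the finitely many points \<open>act h (i a)\<close> with h in H. Three
  errors of \<epsilon> / 3 cover the orbit, and convexity covers the hull.\<close>

lemma hull_net:
  assumes a: "a \<in> carrier M" and \<epsilon>: "\<epsilon> > 0"
  shows "\<exists>\<Gamma>. \<Gamma> \<noteq> [] \<and> set \<Gamma> \<subseteq> carrier G \<and>
    (\<forall>g\<in>carrier G. \<exists>k\<in>set \<Gamma>. \<forall>x\<in>orbit_hull (i a). cnorm Mbar (act g x \<ominus> act k x) \<le> \<epsilon>)"
proof -
  have y: "i a \<in> carrier Mbar" using a i_homD by blast
  have pick: "\<exists>H. finite H \<and> H \<subseteq> carrier G \<and> (\<forall>g\<in>carrier G. \<exists>h\<in>H. \<forall>b\<in>B.
      cnorm Mbar (act g (i b) \<ominus> act h (i b)) \<le> \<epsilon> / 3)" if "finite B" "B \<subseteq> carrier M" for B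
  proof -
    obtain \<U> where \<U>: "finite \<U>" "\<Union>\<U> = carrier G"
      "\<forall>U\<in>\<U>. \<forall>g\<in>U. \<forall>g'\<in>U. \<forall>b\<in>B. cnorm Mbar (act g (i b) \<ominus> act g' (i b)) \<le> \<epsilon> / 3"
      using joint_cover[OF \<open>finite B\<close> \<open>B \<subseteq> carrier M\<close>, of "\<epsilon> / 3"] \<epsilon> by auto
    define H where "H = (\<lambda>U. SOME g. g \<in> U) ` (\<U> - {{}})"
    have H: "(SOME g. g \<in> U) \<in> U" if "U \<in> \<U> - {{}}" for U using that by (simp add: some_in_eq)
    have "\<exists>h\<in>H. \<forall>b\<in>B. cnorm Mbar (act g (i b) \<ominus> act h (i b)) \<le> \<epsilon> / 3" if g: "g \<in> carrier G" for g
    proof -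
      obtain U where U: "U \<in> \<U>" "g \<in> U" using g \<U>(2) by blast
      then have U': "U \<in> \<U> - {{}}" by auto
      show ?thesis using \<U>(3) U H[OF U'] U' by (intro bexI[of _ "SOME g. g \<in> U"]) (auto simp: H_def)
    qed
    moreover have "finite H" using \<U>(1) by (simp add: H_def)
    moreover have "H \<subseteq> carrier G" using H \<U>(2) by (fastforce simp: H_def)
    ultimately show ?thesis by blast
  qed
  obtain H where H: "finite H" "H \<subseteq> carrier G"
    and Hn: "\<And>g. g \<in> carrier G \<Longrightarrow> \<exists>h\<in>H. cnorm Mbar (act g (i a) \<ominus> act h (i a)) \<le> \<epsilon> / 3"
    using pick[of "{a}"] a by auto
  \<comment> \<open>Translates of a lie in M again, so covers for their orbits are
    available.\<close>
  have "finite ((\<lambda>h. \<rho> a h) ` H)" "(\<lambda>h. \<rho> a h) ` H \<subseteq> carrier M" using H a \<rho>_closed by auto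
  from pick[OF this] obtain K where K: "finite K" "K \<subseteq> carrier G"
    and Kn0: "\<And>g. g \<in> carrier G \<Longrightarrow> \<exists>k\<in>K. \<forall>b\<in>(\<lambda>h. \<rho> a h) ` H.
      cnorm Mbar (act g (i b) \<ominus> act k (i b)) \<le> \<epsilon> / 3" by metis
  have Kn: "\<exists>k\<in>K. \<forall>h\<in>H. cnorm Mbar (act g (act h (i a)) \<ominus> act k (act h (i a))) \<le> \<epsilon> / 3"
    if g: "g \<in> carrier G" for g
  proof -
    obtain k where "k \<in> K" "\<forall>b\<in>(\<lambda>h. \<rho> a h) ` H. cnorm Mbar (act g (i b) \<ominus> act k (i b)) \<le> \<epsilon> / 3"
      using Kn0[OF g] by blast
    moreover have "act h (i a) = i (\<rho> a h)" if "h \<in> H" for h using that H(2) a by (intro act_i) auto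
    ultimately show ?thesis by (intro bexI[of _ k]) auto
  qed
  obtain \<Gamma> where \<Gamma>: "set \<Gamma> = K" using finite_list[OF K(1)] by blast
  have "K \<noteq> {}" using Kn[OF G.one_closed] by blast
  then have "\<Gamma> \<noteq> []" using \<Gamma> by auto
  moreover have "\<exists>k\<in>K. \<forall>x\<in>orbit_hull (i a). cnorm Mbar (act g x \<ominus> act k x) \<le> \<epsilon>" if g: "g \<in> carrier G" for g
  proof -
    obtain k where k: "k \<in> K"
      "\<forall>h\<in>H. cnorm Mbar (act g (act h (i a)) \<ominus> act k (act h (i a))) \<le> \<epsilon> / 3" using Kn[OF g] by blast
    have kG: "k \<in> carrier G" using k K by auto
    have "cnorm Mbar (act g (act h (i a)) \<ominus> act k (act h (i a))) \<le> \<epsilon>" if h: "h \<in> carrier G" for h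
    proof -
      obtain h' where h': "h' \<in> H" "cnorm Mbar (act h (i a) \<ominus> act h' (i a)) \<le> \<epsilon> / 3" using Hn[OF h] by blast
      have hG: "h' \<in> carrier G" using h' H by auto
      define p where "p = act h (i a)"
      define q where "q = act h' (i a)"
      have pq [simp]: "p \<in> carrier Mbar" "q \<in> carrier Mbar" using h hG y by (auto simp: p_def q_def)
      have near: "cnorm Mbar (p \<ominus> q) \<le> \<epsilon> / 3" using h' by (simp add: p_def q_def)
      have "cnorm Mbar (act g p \<ominus> act g q) \<le> \<epsilon> / 3" "cnorm Mbar (act k p \<ominus> act k q) \<le> \<epsilon> / 3"
        using near g kG by (simp_all flip: act_diff)
      moreover have "cnorm Mbar (act g q \<ominus> act k q) \<le> \<epsilon> / 3" using k(2) h' by (simp add: q_def)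
      moreover have "cnorm Mbar (act g p \<ominus> act k p)
          \<le> cnorm Mbar (act g p \<ominus> act g q) + cnorm Mbar (act g q \<ominus> act k p)"
        using g kG by (intro Mbar.norm_diff_triangle) auto
      moreover have "cnorm Mbar (act g q \<ominus> act k p)
          \<le> cnorm Mbar (act g q \<ominus> act k q) + cnorm Mbar (act k q \<ominus> act k p)"
        using g kG by (intro Mbar.norm_diff_triangle) auto
      moreover have "cnorm Mbar (act k q \<ominus> act k p) = cnorm Mbar (act k p \<ominus> act k q)"
        using kG by (intro Mbar.norm_diff_commute) auto
      ultimately show ?thesis unfolding p_def[symmetric] by linarith
    qed
    then have "\<forall>x\<in>orbit_hull (i a). cnorm Mbar (act g x \<ominus> act k x) \<le> \<epsilon>"
      using hull_act_dist_le[OF _ y g kG] by blast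
    with k(1) show ?thesis by blast
  qed
  ultimately show ?thesis using K(2) \<Gamma> by (intro exI[of _ \<Gamma>]) simp
qed

theorem fixed_point_in_closed_hull:
  assumes a: "a \<in> carrier M"
  obtains s e where "\<And>n. s n \<in> orbit_hull (i a)" "Mbar.tends s e" "\<And>g. g \<in> carrier G \<Longrightarrow> act g e = e"
  using fixed_point_of_nets[OF i_homD(1)[OF a] hull_net[OF a]] by blast

end

section \<open>Invariant C*-seminorms\<close>

lemma polynomial_times_power_tendsto_0:
  fixes t :: real
  assumes t: "0 \<le> t" "t < 1"
  shows "(\<lambda>n. (c * real n) ^ d * t ^ n) \<longlonglongrightarrow> 0"
proof -
  \<comment> \<open>With t = u^(d+1), one factor u^n is spent on each of the d factors n and one is
    left over. The exponent d + 1 also keeps the root meaningful for d = 0.\<close>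
  define u where "u = root (Suc d) t"
  have u: "0 \<le> u" "u < 1" using t by (simp_all add: u_def)
  have tu: "t = u ^ Suc d" using t by (simp add: u_def real_root_pow_pos2 del: power_Suc)
  have "(\<lambda>n. c ^ d * (real n * u ^ n) ^ d * u ^ n) \<longlonglongrightarrow> c ^ d * 0 ^ d * 0"
    using u by (intro tendsto_intros powser_times_n_limit_0 LIMSEQ_realpow_zero) auto
  moreover have "(c * real n) ^ d * t ^ n = c ^ d * (real n * u ^ n) ^ d * u ^ n" for n
  proof -
    have "t ^ n = (u ^ n) ^ d * u ^ n"
      unfolding tu by (metis mult.commute power_Suc power_mult)
    then show ?thesis by (simp add: power_mult_distrib)
  qed
  ultimately show ?thesis by simp
qed

lemma star_hom_lspan:
  assumes "f \<in> star_hom M N" "star_algebra M" "star_algebra N" "set vs \<subseteq> carrier M" "x \<in> lspan M vs"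
  shows "f x \<in> lspan N (map f vs)"
  using assms(4,5)
proof (induction vs arbitrary: x)
  case Nil
  then show ?case using star_hom_zero[OF assms(2,3,1)] by simp
next
  case (Cons v vs)
  interpret M: star_algebra M by fact
  obtain w c where w: "w \<in> lspan M vs" "x = w \<oplus>\<^bsub>M\<^esub> c \<odot>\<^bsub>M\<^esub> v" using Cons.prems by auto
  have "w \<in> carrier M" "v \<in> carrier M" using M.lspan_closed[of vs] w(1) Cons.prems by auto
  then have "f x = f w \<oplus>\<^bsub>N\<^esub> c \<odot>\<^bsub>N\<^esub> f v" using w(2) by (simp add: star_homD[OF assms(1)])
  moreover have "f w \<in> lspan N (map f vs)" using Cons w(1) by simp
  ultimately show ?case by auto
qed

lemma (in cstar_algebra) norm_square_diff_square:
  assumes "x \<in> carrier N" "y \<in> carrier N" "cnorm N x \<le> 1" "cnorm N y \<le> 1"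
  shows "cnorm N (x \<otimes> x \<ominus> y \<otimes> y) \<le> 2 * cnorm N (x \<ominus> y)"
proof -
  have "cnorm N (x \<otimes> x \<ominus> y \<otimes> y) \<le> cnorm N (x \<ominus> y) * cnorm N x + cnorm N y * cnorm N (x \<ominus> y)"
    using assms by (intro norm_mult_diff_mult)
  also have "\<dots> \<le> cnorm N (x \<ominus> y) * 1 + 1 * cnorm N (x \<ominus> y)"
    using assms by (intro add_mono mult_left_mono mult_right_mono) auto
  finally show ?thesis by simp
qed

text \<open>Abstract form of the larger of the norms of the images in \<open>Abar\<close> and
  \<open>Bbar\<close>. Definiteness is postulated on the image of M; on all of \<open>Mbar\<close>
  it is part of the outcome.\<close>

locale invariant_seminorm = completed_action G T M \<rho> Mbar i
  for G :: "'g monoid" and T :: "'g topology" and M :: "'a star_alg" and \<rho> :: "'a \<Rightarrow> 'g \<Rightarrow> 'a"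
    and Mbar :: "'u cstar_alg" (structure) and i :: "'a \<Rightarrow> 'u" +
  fixes \<nu> :: "'u \<Rightarrow> real"
  assumes inj: "inj_on i (carrier M)"
    and AF: "AF_algebra TYPE('u) (invariant_subalgebra G M (coaction_action \<rho>))"
    and \<nu>_add: "\<lbrakk>x \<in> carrier Mbar; y \<in> carrier Mbar\<rbrakk> \<Longrightarrow> \<nu> (x \<oplus> y) \<le> \<nu> x + \<nu> y"
    and \<nu>_scale: "x \<in> carrier Mbar \<Longrightarrow> \<nu> (c \<odot> x) = cmod c * \<nu> x"
    and \<nu>_mult: "\<lbrakk>x \<in> carrier Mbar; y \<in> carrier Mbar\<rbrakk> \<Longrightarrow> \<nu> (x \<otimes> y) \<le> \<nu> x * \<nu> y"
    and \<nu>_invol: "x \<in> carrier Mbar \<Longrightarrow> \<nu> (invol Mbar x) = \<nu> x"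
    and \<nu>_le: "x \<in> carrier Mbar \<Longrightarrow> \<nu> x \<le> cnorm Mbar x"
    and \<nu>_nonneg: "x \<in> carrier Mbar \<Longrightarrow> 0 \<le> \<nu> x"
    and \<nu>_act: "\<lbrakk>g \<in> carrier G; x \<in> carrier Mbar\<rbrakk> \<Longrightarrow> \<nu> (act g x) \<le> \<nu> x"
    and \<nu>_definite: "\<lbrakk>a \<in> carrier M; \<nu> (i a) = 0\<rbrakk> \<Longrightarrow> i a = \<zero>"
begin

lemma image_subalgebra: "star_subalgebra (i ` carrier M) Mbar"
  by (rule star_subalgebra_image[OF star_algebra_M Mbar.star_algebra_axioms i_hom])

lemmas image_D = Mbar.star_subalgebraD[OF image_subalgebra]

lemma lspan_subset_image:
  assumes "set vs \<subseteq> i ` carrier M"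
  shows "lspan Mbar vs \<subseteq> i ` carrier M"
  using image_D(2-4) assms by (intro Mbar.lspan_subset) auto

lemma \<nu>_definite_lspan:
  assumes "set vs \<subseteq> i ` carrier M" "x \<in> lspan Mbar vs" "\<nu> x = 0"
  shows "x = \<zero>"
proof -
  have "x \<in> i ` carrier M" using lspan_subset_image[OF assms(1)] assms(2) by blast
  then obtain a where "a \<in> carrier M" "x = i a" by blast
  then show ?thesis using \<nu>_definite[of a] assms(3) by simp
qed

text \<open>Injectivity of i carries the invariance of \<open>i c\<close> back to c. Hence c lies in
  a finite-dimensional *-subalgebra F of the invariants, and on the image of F the power argument
  compares the norm with \<open>\<nu>\<close>.\<close>

lemma norm_le_of_invariant:
  assumes c: "c \<in> carrier M" and inv: "\<And>g. g \<in> carrier G \<Longrightarrow> act g (i c) = i c"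
    and sa: "invol Mbar (i c) = i c"
  shows "cnorm Mbar (i c) \<le> \<nu> (i c)"
proof -
  define I where "I = invariant_subalgebra G M (coaction_action \<rho>)"
  have I: "star_algebra I" using AF by (simp add: AF_algebra_def I_def)
  interpret I: star_algebra I by (rule I)
  have IM: "carrier I \<subseteq> carrier M" by (auto simp: I_def invariant_subalgebra_def)
  have "\<rho> c g = c" if g: "g \<in> carrier G" for g
    using inv[OF g] act_i[OF g c] inj_onD[OF inj _ \<rho>_closed[OF g c] c] by simp
  then have "c \<in> carrier I" using c by (simp add: I_def invariant_subalgebra_def coaction_action_def)
  with AF obtain F where F: "star_subalgebra F I" "finite_dimensional F I" "c \<in> F"
    unfolding AF_algebra_def I_def[symmetric] by blast
  obtain S where S: "finite S" "S \<subseteq> F" "\<And>x. x \<in> F \<Longrightarrow> \<exists>k. x = (\<Oplus>\<^bsub>I\<^esub>s\<in>S. k s \<odot>\<^bsub>I\<^esub> s)"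
    using F(2) unfolding finite_dimensional_def by blast
  note FD = I.star_subalgebraD[OF F(1)]
  obtain ss where ss: "set ss = S" using finite_list[OF S(1)] by blast
  have ssI: "set ss \<subseteq> carrier I" using ss S(2) FD(1) by blast
  have ops: "x \<oplus>\<^bsub>I\<^esub> y = x \<oplus>\<^bsub>M\<^esub> y" "k \<odot>\<^bsub>I\<^esub> x = k \<odot>\<^bsub>M\<^esub> x" "x \<otimes>\<^bsub>I\<^esub> y = x \<otimes>\<^bsub>M\<^esub> y" "\<zero>\<^bsub>I\<^esub> = \<zero>\<^bsub>M\<^esub>" for x y k
    by (simp_all add: I_def invariant_subalgebra_def)
  have lsp: "lspan I vs = lspan M vs" for vs by (induction vs) (simp_all add: ops)
  have FL: "x \<in> lspan M ss" if x: "x \<in> F" for x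
  proof -
    obtain k where k: "x = (\<Oplus>\<^bsub>I\<^esub>s\<in>S. k s \<odot>\<^bsub>I\<^esub> s)" using S(3)[OF x] by blast
    have "(\<Oplus>\<^bsub>I\<^esub>s\<in>S. k s \<odot>\<^bsub>I\<^esub> s) \<in> lspan I ss"
    proof (rule I.finsum_mem_subspace[OF S(1) I.lspan_zero[OF ssI] I.lspan_closed[OF ssI] I.lspan_add[OF ssI]])
      fix s assume "s \<in> S"
      then show "k s \<odot>\<^bsub>I\<^esub> s \<in> lspan I ss" using I.lspan_scale[OF ssI I.lspan_mem[OF ssI]] ss by simp
    qed
    then show ?thesis by (simp add: k lsp)
  qed
  have ssM: "set ss \<subseteq> carrier M" using ssI IM by blast
  have vs: "set (map i ss) \<subseteq> i ` carrier M" using ssM by auto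
  show ?thesis
  proof (rule Mbar.norm_le_seminorm_finite_dimensional[where vs = "map i ss" and F = "i ` F"])
    show "set (map i ss) \<subseteq> carrier Mbar" using vs image_D(1) by blast
    show "i ` F \<subseteq> lspan Mbar (map i ss)"
      using star_hom_lspan[OF i_hom star_algebra_M Mbar.star_algebra_axioms ssM] FL by blast
    show "x \<otimes> x \<in> i ` F" if "x \<in> i ` F" for x
    proof -
      obtain a where a: "a \<in> F" "x = i a" using \<open>x \<in> i ` F\<close> by blast
      then have "a \<in> carrier M" using FD(1) IM by blast
      then have "x \<otimes> x = i (a \<otimes>\<^bsub>I\<^esub> a)" using a by (simp add: i_homD ops)
      then show ?thesis using FD(5)[OF a(1) a(1)] by blast
    qed
    show "\<nu> (x \<otimes> x) \<le> (\<nu> x)\<^sup>2" if "x \<in> carrier Mbar" for x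
      using \<nu>_mult[OF that that] by (simp add: power2_eq_square)
  qed (use \<nu>_add \<nu>_scale \<nu>_le \<nu>_nonneg \<nu>_definite_lspan[OF vs] F(3) sa in auto)
qed

lemma orbit_hull_\<nu>_le:
  assumes "x \<in> orbit_hull y" "y \<in> carrier Mbar"
  shows "\<nu> x \<le> \<nu> y"
proof (rule hull_convex_le[OF assms])
  show "\<nu> (act g y) \<le> \<nu> y" if "g \<in> carrier G" for g by (rule \<nu>_act[OF that assms(2)])
  fix p q and t :: real
  assume pq: "p \<in> carrier Mbar" "q \<in> carrier Mbar" "0 \<le> t" "t \<le> 1"
  have "cmod (complex_of_real (1 - t)) = 1 - t" "cmod (complex_of_real t) = t"
    using pq norm_of_real[where 'a = complex] by (metis abs_of_nonneg diff_ge_0_iff_ge)+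
  then show "\<nu> (complex_of_real (1 - t) \<odot> p \<oplus> complex_of_real t \<odot> q) \<le> (1 - t) * \<nu> p + t * \<nu> q"
    using \<nu>_add[of "complex_of_real (1 - t) \<odot> p" "complex_of_real t \<odot> q"] pq
      \<nu>_scale[of p "complex_of_real (1 - t)"] \<nu>_scale[of q "complex_of_real t"] by simp
qed

text \<open>Orbit and hull lie in a finite-dimensional subspace of the image of M, and this subspace
  is closed; so e is \<open>i c\<close> for some c in M, where the AF hypothesis can be applied. On
  the hull \<open>\<nu>\<close> does not grow, and being dominated by the norm it does not grow in
  the limit either.\<close>

lemma norm_fixed_point_le:
  assumes b: "b \<in> carrier M" and sa: "invol Mbar (i b) = i b"
    and s: "\<And>n. s n \<in> orbit_hull (i b)" "Mbar.tends s e" and fixed: "\<And>g. g \<in> carrier G \<Longrightarrow> act g e = e"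
  shows "cnorm Mbar e \<le> \<nu> (i b)"
proof -
  have y: "i b \<in> carrier Mbar" using b i_homD by blast
  have sM: "s n \<in> carrier Mbar" for n using hull_closed[OF s(1) y] .
  have eM: "e \<in> carrier Mbar" by (rule Mbar.tendsD[OF s(2)])
  obtain m v f where v: "\<And>k. k < m \<Longrightarrow> v k \<in> carrier M"
    and eq: "\<And>g. g \<in> carrier G \<Longrightarrow> act g (i b) = (\<Oplus>k\<in>{..<m::nat}. f k g \<odot> i (v k))"
    using orbit_expansion[OF b] by metis
  define vs where "vs = map (\<lambda>k. i (v k)) [0..<m]"
  have vs: "set vs \<subseteq> i ` carrier M" using v by (auto simp: vs_def)
  then have vsM: "set vs \<subseteq> carrier Mbar" using image_D(1) by blast
  have orb: "act g (i b) \<in> lspan Mbar vs" if g: "g \<in> carrier G" for g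
    unfolding eq[OF g]
  proof (rule Mbar.finsum_mem_subspace[OF _ Mbar.lspan_zero[OF vsM] Mbar.lspan_closed[OF vsM] Mbar.lspan_add[OF vsM]])
    fix k assume "k \<in> {..<m}"
    then have "i (v k) \<in> set vs" by (auto simp: vs_def)
    then show "f k g \<odot> i (v k) \<in> lspan Mbar vs"
      by (intro Mbar.lspan_scale[OF vsM] Mbar.lspan_mem[OF vsM])
  qed auto
  have "s n \<in> lspan Mbar vs" for n
    by (rule hull_subset[OF s(1) orb Mbar.lspan_add[OF vsM] Mbar.lspan_scale[OF vsM]])
  moreover have "\<forall>s x. (\<forall>n. s n \<in> lspan Mbar vs) \<longrightarrow> Mbar.tends s x \<longrightarrow> x \<in> lspan Mbar vs"
    using Mbar.lspan_bounded_and_closed[OF vsM \<nu>_add \<nu>_scale \<nu>_le \<nu>_nonneg \<nu>_definite_lspan[OF vs]] by (rule conjunct2)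
  ultimately have "e \<in> lspan Mbar vs" using s(2) by (elim allE impE) auto
  then have "e \<in> i ` carrier M" using lspan_subset_image[OF vs] by blast
  then obtain c where c: "c \<in> carrier M" "e = i c" by blast
  \<comment> \<open>Self-adjoint elements form a real subspace stable under the action, so e
    inherits self-adjointness from \<open>i b\<close>.\<close>
  define W where "W = {x \<in> carrier Mbar. invol Mbar x = x}"
  have "s n \<in> W" for n
    by (rule hull_subset[OF s(1)])
      (use y sa in \<open>auto simp: W_def Mbar.invol_add Mbar.invol_smult star_homD(5)[OF act_hom, symmetric]\<close>)
  then have "Mbar.tends s (invol Mbar e)" using Mbar.tends_invol[OF s(2)] by (simp add: W_def)
  then have "invol Mbar e = e" using Mbar.tends_unique[OF _ s(2)] by blast
  then have "cnorm Mbar e \<le> \<nu> e" using norm_le_of_invariant[OF c(1)] fixed by (simp add: c(2))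
  moreover have "\<nu> e \<le> \<nu> (i b)"
  proof (rule LIMSEQ_le_const)
    show "(\<lambda>n. \<nu> (i b) + cnorm Mbar (s n \<ominus> e)) \<longlonglongrightarrow> \<nu> (i b)"
      using tendsto_add[OF tendsto_const Mbar.tendsD(3)[OF s(2)]] by simp
    have "\<nu> e \<le> \<nu> (i b) + cnorm Mbar (s n \<ominus> e)" for n
    proof -
      have "e = (e \<ominus> s n) \<oplus> s n" using eM sM by simp
      then have "\<nu> e \<le> \<nu> (e \<ominus> s n) + \<nu> (s n)" using \<nu>_add[OF Mbar.diff_closed[OF eM sM] sM] by metis
      moreover have "\<nu> (e \<ominus> s n) \<le> cnorm Mbar (s n \<ominus> e)"
        using \<nu>_le[OF Mbar.diff_closed[OF eM sM]] Mbar.norm_diff_commute[OF eM sM] by simp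
      moreover have "\<nu> (s n) \<le> \<nu> (i b)" by (rule orbit_hull_\<nu>_le[OF s(1) y])
      ultimately show ?thesis by linarith
    qed
    then show "\<exists>N. \<forall>n\<ge>N. \<nu> e \<le> \<nu> (i b) + cnorm Mbar (s n \<ominus> e)" by blast
  qed
  ultimately show ?thesis by linarith
qed

text \<open>
  With \<open>A = w\<^sup>2\<close> and \<open>x = A\<^sup>2\<close>, the functional \<open>z \<mapsto> \<Sum> \<parallel>x\<^sub>U - z x\<^sub>U\<parallel>\<close>, where \<open>x\<^sub>U\<close> is the translate
  of \<open>x\<close> by an element of the member \<open>U\<close> of the cover, is at most \<open>card \<U> - 1/4\<close> on the orbit of \<open>A\<close>
  and hence on its closed convex hull, but at least \<open>card \<U> * (1 - \<parallel>z\<parallel>)\<close> everywhere.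
\<close>

lemma norm_hull_ge:
  assumes w: "w \<in> carrier Mbar" "invol Mbar w = w" "cnorm Mbar w = 1"
    and \<U>: "finite \<U>" "\<Union>\<U> = carrier G"
    and near: "\<And>U g g'. \<lbrakk>U \<in> \<U>; g \<in> U; g' \<in> U\<rbrakk> \<Longrightarrow>
      cnorm Mbar (act g (w \<otimes> w) \<ominus> act g' (w \<otimes> w)) \<le> 1 / 4"
    and z: "z \<in> orbit_hull (w \<otimes> w)"
  shows "1 / 4 \<le> card \<U> * cnorm Mbar z"
proof -
  \<comment> \<open>Dropping empty members gives every piece a representative
    \<open>k U\<close>.\<close>
  define \<V> where "\<V> = \<U> - {{}}"
  define A where "A = w \<otimes> w"
  define k where "k U = (SOME g. g \<in> U)" for U :: "'g set"
  have k: "k U \<in> U" if "U \<in> \<V>" for U using that by (simp add: k_def \<V>_def some_in_eq)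
  have kG: "k U \<in> carrier G" if "U \<in> \<V>" for U using k[OF that] that \<U>(2) by (auto simp: \<V>_def)
  have AM [simp]: "A \<in> carrier Mbar" using w by (simp add: A_def)
  have A: "invol Mbar A = A" "cnorm Mbar A = 1"
    using w by (simp_all add: A_def Mbar.invol_mult Mbar.norm_square)
  define B where "B = A \<otimes> A"
  have BM [simp]: "B \<in> carrier Mbar" by (simp add: B_def)
  have B: "cnorm Mbar B = 1" using A by (simp add: B_def Mbar.norm_square)
  \<comment> \<open>B - A B = w^2 A - w^4 A, so the bound 1/2 for h^2 - h^4 applies with h =
    w.\<close>
  have AB: "cnorm Mbar (B \<ominus> A \<otimes> B) \<le> 1 / 2"
    using Mbar.norm_square_diff_fourth_le[OF w(1,2) _ AM] w A by (simp add: B_def A_def Mbar.mult_assoc)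
  define x where "x U = act (k U) B" for U
  have x [simp]: "x U \<in> carrier Mbar" "cnorm Mbar (x U) = 1" if "U \<in> \<V>" for U
    using kG[OF that] B by (simp_all add: x_def)
  define \<Phi> where "\<Phi> y = (\<Sum>U\<in>\<V>. cnorm Mbar (x U \<ominus> y \<otimes> x U))" for y
  have fin: "finite \<V>" using \<U> by (simp add: \<V>_def)
  have zM: "z \<in> carrier Mbar" using hull_closed[OF z] w by simp
  have "\<Phi> z \<le> card \<V> - 1 / 4"
  proof (rule hull_convex_le[OF z[folded A_def] AM])
    fix g assume g: "g \<in> carrier G"
    then obtain U where U: "U \<in> \<V>" "g \<in> U" using \<U>(2) by (auto simp: \<V>_def)
    have gw: "act g w \<in> carrier Mbar" "invol Mbar (act g w) = act g w" "cnorm Mbar (act g w) \<le> 1"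
      using g w by (simp_all add: star_homD(5)[OF act_hom, symmetric])
    have gA: "act g A = act g w \<otimes> act g w" using g w by (simp add: A_def star_homD(4)[OF act_hom])
    \<comment> \<open>\<open>act g A\<close> is the square of the self-adjoint contraction
      \<open>act g w\<close>, so 1 minus it is a contraction; the positivity of A enters in this
      form.\<close>
    have le1: "cnorm Mbar (x V \<ominus> act g A \<otimes> x V) \<le> 1" if "V \<in> \<V>" for V
      using Mbar.norm_diff_square_le[OF gw x(1)[OF that]] x[OF that] gw by (simp add: gA Mbar.mult_assoc)
    \<comment> \<open>The translate at \<open>k U\<close> contributes 1/2, and moving from
      \<open>k U\<close> to g inside the piece U costs 1/4.\<close>
    have "cnorm Mbar (x U \<ominus> act g A \<otimes> x U) \<le> 3 / 4"
    proof -
      have kU: "k U \<in> carrier G" by (rule kG[OF U(1)])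
      have "cnorm Mbar (x U \<ominus> act g A \<otimes> x U)
          \<le> cnorm Mbar (x U \<ominus> act (k U) A \<otimes> x U)
            + cnorm Mbar (act (k U) A \<otimes> x U \<ominus> act g A \<otimes> x U)"
        using U g kU by (intro Mbar.norm_diff_triangle) auto
      moreover have "x U \<ominus> act (k U) A \<otimes> x U = act (k U) (B \<ominus> A \<otimes> B)"
        using kU by (simp add: x_def act_diff star_homD(4)[OF act_hom])
      then have "cnorm Mbar (x U \<ominus> act (k U) A \<otimes> x U) \<le> 1 / 2" using AB kU by simp
      moreover have "cnorm Mbar (act (k U) A \<otimes> x U \<ominus> act g A \<otimes> x U)
          \<le> cnorm Mbar (act (k U) A \<ominus> act g A) * cnorm Mbar (x U)"
        using U g kU Mbar.norm_mult[of "act (k U) A \<ominus> act g A" "x U"] by (simp add: Mbar.diff_mult_left)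
      moreover have "cnorm Mbar (act (k U) A \<ominus> act g A) \<le> 1 / 4"
        using near[of U "k U" g] U k[OF U(1)] by (simp add: A_def \<V>_def)
      ultimately show ?thesis using U by simp
    qed
    moreover have "(\<Sum>V\<in>\<V> - {U}. cnorm Mbar (x V \<ominus> act g A \<otimes> x V)) \<le> (\<Sum>V\<in>\<V> - {U}. 1)"
      using le1 by (intro sum_mono) auto
    moreover have "\<Phi> (act g A) = cnorm Mbar (x U \<ominus> act g A \<otimes> x U)
        + (\<Sum>V\<in>\<V> - {U}. cnorm Mbar (x V \<ominus> act g A \<otimes> x V))"
      unfolding \<Phi>_def by (rule sum.remove[OF fin U(1)])
    moreover have "real (card \<V>) = 1 + real (card (\<V> - {U}))"
      using card_Suc_Diff1[OF fin U(1)] by linarith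
    ultimately show "\<Phi> (act g A) \<le> card \<V> - 1 / 4" by simp
  next
    fix p q and t :: real
    assume pq: "p \<in> carrier Mbar" "q \<in> carrier Mbar" "0 \<le> t" "t \<le> 1"
    let ?y = "complex_of_real (1 - t) \<odot> p \<oplus> complex_of_real t \<odot> q"
    have "cnorm Mbar (x U \<ominus> ?y \<otimes> x U)
        \<le> (1 - t) * cnorm Mbar (x U \<ominus> p \<otimes> x U) + t * cnorm Mbar (x U \<ominus> q \<otimes> x U)"
      if U: "U \<in> \<V>" for U
    proof -
      have "?y \<otimes> x U = complex_of_real (1 - t) \<odot> (p \<otimes> x U) \<oplus> complex_of_real t \<odot> (q \<otimes> x U)"
        using pq x(1)[OF U]
        by (simp only: Mbar.distr_l Mbar.smult_mult_l Mbar.scale_closed Mbar.mult_closed)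
      then show ?thesis
        using pq x(1)[OF U] Mbar.diff_convex_combination[of "x U" "p \<otimes> x U" "q \<otimes> x U" t]
          Mbar.norm_convex_combination[of "x U \<ominus> p \<otimes> x U" "x U \<ominus> q \<otimes> x U" t]
        by simp
    qed
    then have "\<Phi> ?y \<le> (\<Sum>U\<in>\<V>. (1 - t) * cnorm Mbar (x U \<ominus> p \<otimes> x U)
        + t * cnorm Mbar (x U \<ominus> q \<otimes> x U))"
      unfolding \<Phi>_def by (intro sum_mono)
    then show "\<Phi> ?y \<le> (1 - t) * \<Phi> p + t * \<Phi> q"
      by (simp add: \<Phi>_def sum.distrib sum_distrib_left)
  qed
  moreover have "\<Phi> z \<ge> (\<Sum>U\<in>\<V>. 1 - cnorm Mbar z)"
    unfolding \<Phi>_def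
  proof (rule sum_mono)
    fix U assume U: "U \<in> \<V>"
    have "cnorm Mbar (x U) \<le> cnorm Mbar (x U \<ominus> z \<otimes> x U) + cnorm Mbar (z \<otimes> x U)"
      using U zM by (intro Mbar.norm_le_diff_add) auto
    moreover have "cnorm Mbar (z \<otimes> x U) \<le> cnorm Mbar z * cnorm Mbar (x U)"
      using U zM by (intro Mbar.norm_mult) auto
    ultimately show "1 - cnorm Mbar z \<le> cnorm Mbar (x U \<ominus> z \<otimes> x U)" using x(2)[OF U] by simp
  qed
  ultimately have "1 / 4 \<le> card \<V> * cnorm Mbar z" by (simp add: algebra_simps)
  also have "\<dots> \<le> card \<U> * cnorm Mbar z"
    using \<U>(1) zM by (intro mult_right_mono) (auto simp: \<V>_def intro: card_mono)
  finally show ?thesis .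
qed

text \<open>Exponents run through powers of 2: the norms are then exact by the C*-identity, and
  every element from \<open>b (Suc n)\<close> on is a square of a self-adjoint one, as the lower
  bound on the hull requires.\<close>

lemma norm_le_\<nu>_unit:
  assumes a: "a \<in> carrier M" and sa: "invol Mbar (i a) = i a" and n1: "cnorm Mbar (i a) = 1"
  shows "1 \<le> \<nu> (i a)"
proof (rule ccontr)
  define t where "t = \<nu> (i a)"
  have iaM: "i a \<in> carrier Mbar" using a i_homD by blast
  assume "\<not> 1 \<le> \<nu> (i a)"
  then have t: "0 \<le> t" "t < 1" using \<nu>_nonneg[OF iaM] by (auto simp: t_def)
  obtain K d :: nat where cover: "\<And>n::nat. n \<ge> 1 \<Longrightarrow> \<exists>\<U>. finite \<U> \<and> card \<U> \<le> (K * n) ^ d \<and> \<Union>\<U> = carrier G \<and>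
      (\<forall>U\<in>\<U>. \<forall>g\<in>U. \<forall>g'\<in>U. cnorm Mbar (act g (i a) \<ominus> act g' (i a)) \<le> 1 / n)"
    using orbit_cover[OF a] by blast
  define b where "b n = ((\<lambda>x. x \<otimes>\<^bsub>M\<^esub> x) ^^ n) a" for n
  have bS: "b (Suc n) = b n \<otimes>\<^bsub>M\<^esub> b n" for n by (simp add: b_def)
  have b: "b n \<in> carrier M" for n by (induction n) (use a in \<open>auto simp: b_def\<close>)
  have ibM: "i (b n) \<in> carrier Mbar" for n using b i_homD by blast
  have ibS: "i (b (Suc n)) = i (b n) \<otimes> i (b n)" for n using b by (simp add: bS i_homD)
  have bp: "invol Mbar (i (b n)) = i (b n) \<and> cnorm Mbar (i (b n)) = 1 \<and> \<nu> (i (b n)) \<le> t ^ (2 ^ n)" for n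
  proof (induction n)
    case (Suc n)
    have "\<nu> (i (b (Suc n))) \<le> \<nu> (i (b n)) * \<nu> (i (b n))" unfolding ibS by (intro \<nu>_mult ibM)
    also have "\<dots> \<le> t ^ (2 ^ n) * t ^ (2 ^ n)" using Suc \<nu>_nonneg[OF ibM] t by (intro mult_mono) auto
    also have "\<dots> = t ^ (2 ^ Suc n)" by (simp add: mult_2 power_add)
    finally show ?case using Suc ibM by (simp add: ibS Mbar.invol_mult Mbar.norm_square)
  qed (use sa n1 in \<open>simp add: b_def t_def\<close>)
  \<comment> \<open>Squaring at most doubles distances between elements of norm at most 1, so n
    squarings cost a factor 2^n. This loss is linear in the exponent 2^n, hence the number of pieces
    stays polynomial in it.\<close>
  have dist: "cnorm Mbar (act g (i (b n)) \<ominus> act g' (i (b n))) \<le> 2 ^ n * cnorm Mbar (act g (i a) \<ominus> act g' (i a))"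
    if g: "g \<in> carrier G" "g' \<in> carrier G" for g g' n
  proof (induction n)
    case (Suc n)
    have "cnorm Mbar (act g (i (b (Suc n))) \<ominus> act g' (i (b (Suc n))))
        \<le> 2 * cnorm Mbar (act g (i (b n)) \<ominus> act g' (i (b n)))"
      using Mbar.norm_square_diff_square[of "act g (i (b n))" "act g' (i (b n))"] g ibM bp[of n]
      by (simp add: ibS star_homD(4)[OF act_hom])
    then show ?case using Suc by simp
  qed (simp add: b_def)
  have key: "1 / 4 \<le> (4 * real K * real (2 ^ Suc n)) ^ d * t ^ (2 ^ Suc n)" for n
  proof -
    \<comment> \<open>Pieces of diameter 1 / m for the orbit of a have diameter at most 1/4 after
      \<open>Suc n\<close> squarings.\<close>
    define m :: nat where "m = 4 * 2 ^ Suc n"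
    have "m \<ge> 1" by (simp add: m_def)
    from cover[OF this] obtain \<U> where \<U>: "finite \<U>" "card \<U> \<le> (K * m) ^ d" "\<Union>\<U> = carrier G"
      and near: "\<forall>U\<in>\<U>. \<forall>g\<in>U. \<forall>g'\<in>U. cnorm Mbar (act g (i a) \<ominus> act g' (i a)) \<le> 1 / m" by blast
    obtain s e where s: "\<And>k. s k \<in> orbit_hull (i (b (Suc n)))" "Mbar.tends s e"
      and fixed: "\<And>g. g \<in> carrier G \<Longrightarrow> act g e = e"
      using fixed_point_in_closed_hull[OF b] by blast
    have "cnorm Mbar e \<le> \<nu> (i (b (Suc n)))"
      by (rule norm_fixed_point_le[OF b _ s fixed]) (use bp in blast)
    also have "\<dots> \<le> t ^ (2 ^ Suc n)" using bp by blast
    finally have e: "cnorm Mbar e \<le> t ^ (2 ^ Suc n)" .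
    have near': "cnorm Mbar (act g (i (b (Suc n))) \<ominus> act g' (i (b (Suc n)))) \<le> 1 / 4"
      if "U \<in> \<U>" "g \<in> U" "g' \<in> U" for U g g'
    proof -
      have "g \<in> carrier G" "g' \<in> carrier G" using that \<U>(3) by blast+
      then have "cnorm Mbar (act g (i (b (Suc n))) \<ominus> act g' (i (b (Suc n))))
          \<le> 2 ^ Suc n * cnorm Mbar (act g (i a) \<ominus> act g' (i a))" by (rule dist)
      also have "\<dots> \<le> 2 ^ Suc n * (1 / m)" using near that by (intro mult_left_mono) auto
      also have "\<dots> = 1 / 4" by (simp add: m_def)
      finally show ?thesis .
    qed
    \<comment> \<open>Here w is \<open>i (b n)\<close>, whose square is
      \<open>i (b (Suc n))\<close>. The bound holds on the hull and passes to the limit e.\<close>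
    have "1 / 4 \<le> card \<U> * cnorm Mbar (s k)" for k
      by (rule norm_hull_ge[OF ibM[of n] _ _ \<U>(1,3) near'[unfolded ibS] s(1)[unfolded ibS]])
        (use bp[of n] in auto)
    moreover have "(\<lambda>k. card \<U> * cnorm Mbar (s k)) \<longlonglongrightarrow> card \<U> * cnorm Mbar e"
      by (intro tendsto_intros Mbar.tends_norm s(2))
    ultimately have "1 / 4 \<le> card \<U> * cnorm Mbar e" by (intro LIMSEQ_le_const) blast+
    also have "\<dots> \<le> real ((K * m) ^ d) * t ^ (2 ^ Suc n)"
    proof (intro mult_mono)
      show "real (card \<U>) \<le> real ((K * m) ^ d)" using \<U>(2) by (rule of_nat_mono)
      show "0 \<le> cnorm Mbar e" using Mbar.tendsD(2)[OF s(2)] by simp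
    qed (use e in auto)
    also have "real ((K * m) ^ d) = (4 * real K * real (2 ^ Suc n)) ^ d" by (simp add: m_def mult_ac)
    finally show ?thesis .
  qed
  have "\<forall>\<^sub>F n in sequentially. (4 * real K * real n) ^ d * t ^ n < 1 / 4"
    by (rule order_tendstoD(2)[OF polynomial_times_power_tendsto_0[OF t]]) simp
  then obtain n0 where n0: "\<And>n. n \<ge> n0 \<Longrightarrow> (4 * real K * real n) ^ d * t ^ n < 1 / 4"
    by (auto simp: eventually_sequentially)
  \<comment> \<open>The decay covers all exponents from n0 on, in particular this power of
    2.\<close>
  have "n0 \<le> 2 ^ Suc n0" using less_exp[of "Suc n0"] by linarith
  from n0[OF this] key[of n0] show False by linarith
qed

text \<open>Self-adjoint elements are rescaled to norm 1. For general a the norm of a* a is the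
  square of the norm of a, while \<open>\<nu>\<close> of a* a is at most the square of
  \<open>\<nu>\<close> of a.\<close>

lemma norm_le_\<nu>_image:
  assumes a: "a \<in> carrier M"
  shows "cnorm Mbar (i a) \<le> \<nu> (i a)"
proof -
  have sa: "cnorm Mbar (i b) \<le> \<nu> (i b)" if b: "b \<in> carrier M" "invol Mbar (i b) = i b" for b
  proof (cases "cnorm Mbar (i b) = 0")
    case True
    then show ?thesis using \<nu>_nonneg b i_homD by simp
  next
    case False
    have ib: "i b \<in> carrier Mbar" using b i_homD by blast
    define c where "c = complex_of_real (1 / cnorm Mbar (i b))"
    have pos: "cnorm Mbar (i b) > 0" using False Mbar.norm_nonneg[OF ib] by linarith
    have "1 \<le> \<nu> (i (c \<odot>\<^bsub>M\<^esub> b))"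
    proof (rule norm_le_\<nu>_unit)
      show "invol Mbar (i (c \<odot>\<^bsub>M\<^esub> b)) = i (c \<odot>\<^bsub>M\<^esub> b)"
        using b ib by (simp add: i_homD(3) Mbar.invol_smult c_def)
      show "cnorm Mbar (i (c \<odot>\<^bsub>M\<^esub> b)) = 1"
        using b ib pos by (simp add: i_homD(3) Mbar.norm_smult c_def norm_divide)
    qed (use b in auto)
    then show ?thesis using b ib pos by (simp add: i_homD(3) \<nu>_scale c_def norm_divide)
  qed
  have ia: "i a \<in> carrier Mbar" using a i_homD by blast
  have eq: "i (invol M a \<otimes>\<^bsub>M\<^esub> a) = invol Mbar (i a) \<otimes> i a" using a by (simp add: i_homD)
  have "(cnorm Mbar (i a))\<^sup>2 = cnorm Mbar (i (invol M a \<otimes>\<^bsub>M\<^esub> a))"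
    using ia by (simp add: eq Mbar.cstar_identity)
  also have "\<dots> \<le> \<nu> (i (invol M a \<otimes>\<^bsub>M\<^esub> a))"
    using a ia by (intro sa) (auto simp: eq Mbar.invol_mult)
  also have "\<dots> \<le> \<nu> (i a) * \<nu> (i a)" using \<nu>_mult[of "invol Mbar (i a)" "i a"] ia by (simp add: eq \<nu>_invol)
  finally have "(cnorm Mbar (i a))\<^sup>2 \<le> (\<nu> (i a))\<^sup>2" by (simp add: power2_eq_square)
  then show ?thesis by (rule power2_le_imp_le) (rule \<nu>_nonneg[OF ia])
qed

text \<open>\<open>\<nu>\<close> is continuous, being dominated by the norm, and the image of M is
  dense.\<close>

theorem norm_le_\<nu>:
  assumes x: "x \<in> carrier Mbar"
  shows "cnorm Mbar x \<le> \<nu> x"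
proof (rule field_le_epsilon)
  fix e :: real assume "e > 0"
  then obtain a where a: "a \<in> carrier M" "cnorm Mbar (x \<ominus> i a) < e / 2" using dense[OF x, of "e/2"] by auto
  have ia: "i a \<in> carrier Mbar" using a i_homD by blast
  have "cnorm Mbar x \<le> cnorm Mbar (x \<ominus> i a) + cnorm Mbar (i a)" by (rule Mbar.norm_le_diff_add[OF x ia])
  moreover have "cnorm Mbar (i a) \<le> \<nu> (i a)" by (rule norm_le_\<nu>_image[OF a(1)])
  moreover have "\<nu> (i a) \<le> \<nu> (i a \<ominus> x) + \<nu> x"
    using \<nu>_add[of "i a \<ominus> x" x] ia x by simp
  moreover have "\<nu> (i a \<ominus> x) \<le> cnorm Mbar (x \<ominus> i a)"
    using \<nu>_le[of "i a \<ominus> x"] Mbar.norm_diff_commute[OF ia x] ia x by simp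
  ultimately show "cnorm Mbar x \<le> \<nu> x + e" using a(2) by linarith
qed

end

section \<open>Completed pullback squares\<close>

text \<open>Both sides of the equivariance identity are homomorphisms out of the completion, so they
  are compared on the image of M.\<close>

lemma equivariant_hom_completion:
  assumes M: "completed_action G T M \<rho> Mbar i" and N: "completed_action G T N \<sigma> Nbar j"
    and f: "equivariant_hom G M (coaction_action \<rho>) N (coaction_action \<sigma>) f"
  shows "equivariant_hom G Mbar (completion_action M \<rho> Mbar i) Nbar (completion_action N \<sigma> Nbar j)
    (completion_map M Mbar i Nbar j f)"
proof -
  interpret M: completed_action G T M \<rho> Mbar i by fact
  interpret N: completed_action G T N \<sigma> Nbar j by fact
  have fh: "f \<in> star_hom M N" and fe: "\<And>g a. g \<in> carrier G \<Longrightarrow> a \<in> carrier M \<Longrightarrow> f (\<rho> a g) = \<sigma> (f a) g"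
    using f by (auto simp: equivariant_hom_def coaction_action_def)
  define F where "F = completion_map M Mbar i Nbar j f"
  note F = completion_map[OF M.completion N.completion fh, folded F_def]
  have "F (M.act g x) = N.act g (F x)" if g: "g \<in> carrier G" and x: "x \<in> carrier Mbar" for g x
  proof (rule M.hom_eq[OF N.cstar_algebra_Mbar _ _ _ x])
    show "(\<lambda>x. F (M.act g x)) \<in> star_hom Mbar Nbar" by (rule star_hom_comp[OF M.act_hom[OF g] F(1)])
    show "(\<lambda>x. N.act g (F x)) \<in> star_hom Mbar Nbar" by (rule star_hom_comp[OF F(1) N.act_hom[OF g]])
    show "F (M.act g (i a)) = N.act g (F (i a))" if a: "a \<in> carrier M" for a
      using g a star_homD(1)[OF fh a] by (simp add: M.act_i N.act_i F(3) M.\<rho>_closed fe)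
  qed
  then show ?thesis using F(1) by (simp add: equivariant_hom_def F_def)
qed

text \<open>The comparison of norms gives injectivity at once. It also turns dense range into
  surjectivity: approximants from C that converge in both components are Cauchy in
  \<open>Cbar\<close>.\<close>

lemma equivariant_pullback_completion:
  fixes Abar Bbar Cbar Dbar :: "'u cstar_alg"
  assumes A: "completed_action G T A \<rho>A Abar iA" and B: "completed_action G T B \<rho>B Bbar iB"
    and C: "completed_action G T C \<rho>C Cbar iC" and D: "completed_action G T D \<rho>D Dbar iD"
    and pullback: "equivariant_pullback G A (coaction_action \<rho>A) B (coaction_action \<rho>B)
           C (coaction_action \<rho>C) D (coaction_action \<rho>D) l r p q"
    and r_surj: "r ` carrier B = carrier D"
    and AF: "AF_algebra TYPE('u) (invariant_subalgebra G C (coaction_action \<rho>C))"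
    and iA_inj: "inj_on iA (carrier A)" and iB_inj: "inj_on iB (carrier B)" and iC_inj: "inj_on iC (carrier C)"
  shows "equivariant_pullback G
           Abar (completion_action A \<rho>A Abar iA) Bbar (completion_action B \<rho>B Bbar iB)
           Cbar (completion_action C \<rho>C Cbar iC) Dbar (completion_action D \<rho>D Dbar iD)
           (completion_map A Abar iA Dbar iD l) (completion_map B Bbar iB Dbar iD r)
           (completion_map C Cbar iC Abar iA p) (completion_map C Cbar iC Bbar iB q)"
proof -
  interpret A: completed_action G T A \<rho>A Abar iA by fact
  interpret B: completed_action G T B \<rho>B Bbar iB by fact
  interpret C: completed_action G T C \<rho>C Cbar iC by fact
  interpret D: completed_action G T D \<rho>D Dbar iD by fact
  have eq_l: "equivariant_hom G A (coaction_action \<rho>A) D (coaction_action \<rho>D) l"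
    and eq_r: "equivariant_hom G B (coaction_action \<rho>B) D (coaction_action \<rho>D) r"
    and eq_p: "equivariant_hom G C (coaction_action \<rho>C) A (coaction_action \<rho>A) p"
    and eq_q: "equivariant_hom G C (coaction_action \<rho>C) B (coaction_action \<rho>B) q"
    and comm: "\<And>c. c \<in> carrier C \<Longrightarrow> l (p c) = r (q c)"
    and bij: "bij_betw (\<lambda>c. (p c, q c)) (carrier C) (carrier (fibre_product A B l r))"
    using pullback by (auto simp: equivariant_pullback_def equivariant_square_def equivariant_iso_def)
  have l: "l \<in> star_hom A D" and r: "r \<in> star_hom B D" and p: "p \<in> star_hom C A" and q: "q \<in> star_hom C B"
    using eq_l eq_r eq_p eq_q by (auto simp: equivariant_hom_def)
  define lb where "lb = completion_map A Abar iA Dbar iD l"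
  define rb where "rb = completion_map B Bbar iB Dbar iD r"
  define pb where "pb = completion_map C Cbar iC Abar iA p"
  define qb where "qb = completion_map C Cbar iC Bbar iB q"
  note lb = completion_map[OF A.completion D.completion l, folded lb_def]
  note rb = completion_map[OF B.completion D.completion r, folded rb_def]
  note pb = completion_map[OF C.completion A.completion p, folded pb_def]
  note qb = completion_map[OF C.completion B.completion q, folded qb_def]
  note pbD = star_homD[OF pb(1)] and qbD = star_homD[OF qb(1)]
  note eq_lb = equivariant_hom_completion[OF A D eq_l, folded lb_def]
  note eq_rb = equivariant_hom_completion[OF B D eq_r, folded rb_def]
  note eq_pb = equivariant_hom_completion[OF C A eq_p, folded pb_def]
  note eq_qb = equivariant_hom_completion[OF C B eq_q, folded qb_def]
  have pb_act: "pb (C.act g x) = A.act g (pb x)" and qb_act: "qb (C.act g x) = B.act g (qb x)"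
    if "g \<in> carrier G" "x \<in> carrier Cbar" for g x
    using eq_pb eq_qb that by (auto simp: equivariant_hom_def)
  have comm_bar: "lb (pb x) = rb (qb x)" if x: "x \<in> carrier Cbar" for x
  proof (rule C.hom_eq[OF D.cstar_algebra_Mbar _ _ _ x])
    show "(\<lambda>x. lb (pb x)) \<in> star_hom Cbar Dbar" by (rule star_hom_comp[OF pb(1) lb(1)])
    show "(\<lambda>x. rb (qb x)) \<in> star_hom Cbar Dbar" by (rule star_hom_comp[OF qb(1) rb(1)])
    show "lb (pb (iC c)) = rb (qb (iC c))" if c: "c \<in> carrier C" for c
      using c star_homD(1)[OF p c] star_homD(1)[OF q c] by (simp add: pb(3) qb(3) lb(3) rb(3) comm)
  qed
  define \<nu> where "\<nu> x = max (cnorm Abar (pb x)) (cnorm Bbar (qb x))" for x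
  interpret C: invariant_seminorm G T C \<rho>C Cbar iC \<nu>
  proof unfold_locales
    fix x y assume x: "x \<in> carrier Cbar" and y: "y \<in> carrier Cbar"
    note xy = pbD(1)[OF x] qbD(1)[OF x] pbD(1)[OF y] qbD(1)[OF y]
    show "\<nu> (x \<oplus>\<^bsub>Cbar\<^esub> y) \<le> \<nu> x + \<nu> y"
      using A.Mbar.norm_triangle[OF xy(1,3)] B.Mbar.norm_triangle[OF xy(2,4)] x y
      by (simp add: \<nu>_def pbD(2) qbD(2)) linarith
    have "cnorm Abar (pb x) * cnorm Abar (pb y) \<le> \<nu> x * \<nu> y" "cnorm Bbar (qb x) * cnorm Bbar (qb y) \<le> \<nu> x * \<nu> y"
      unfolding \<nu>_def using xy by (intro mult_mono; simp add: le_max_iff_disj)+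
    then show "\<nu> (x \<otimes>\<^bsub>Cbar\<^esub> y) \<le> \<nu> x * \<nu> y"
      using A.Mbar.norm_mult[OF xy(1,3)] B.Mbar.norm_mult[OF xy(2,4)] x y
      unfolding \<nu>_def[of "x \<otimes>\<^bsub>Cbar\<^esub> y"] by (simp add: pbD(4) qbD(4))
  next
    fix x c assume x: "x \<in> carrier Cbar"
    show "\<nu> (c \<odot>\<^bsub>Cbar\<^esub> x) = cmod c * \<nu> x"
      using x pbD(1)[OF x] qbD(1)[OF x]
      by (simp add: \<nu>_def pbD(3) qbD(3) A.Mbar.norm_smult B.Mbar.norm_smult max_mult_distrib_left)
  next
    fix x assume x: "x \<in> carrier Cbar"
    show "\<nu> (invol Cbar x) = \<nu> x" using x pbD(1)[OF x] qbD(1)[OF x] by (simp add: \<nu>_def pbD(5) qbD(5))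
    show "\<nu> x \<le> cnorm Cbar x"
      using star_hom_contractive[OF C.cstar_algebra_Mbar A.cstar_algebra_Mbar pb(1) x]
        star_hom_contractive[OF C.cstar_algebra_Mbar B.cstar_algebra_Mbar qb(1) x] by (simp add: \<nu>_def)
    show "0 \<le> \<nu> x" using pbD(1)[OF x] by (simp add: \<nu>_def le_max_iff_disj)
    fix g assume g: "g \<in> carrier G"
    show "\<nu> (C.act g x) \<le> \<nu> x"
      using pbD(1)[OF x] qbD(1)[OF x] g x by (simp add: \<nu>_def pb_act qb_act)
  next
    fix c assume c: "c \<in> carrier C" and 0: "\<nu> (iC c) = 0"
    have pc: "p c \<in> carrier A" and qc: "q c \<in> carrier B" using c star_homD(1)[OF p] star_homD(1)[OF q] by auto
    \<comment> \<open>Injectivity of \<open>iA\<close> and \<open>iB\<close> and of c \<mapsto> (p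
      c, q c) together make \<open>\<nu>\<close> definite on the image of C.\<close>
    have "cnorm Abar (iA (p c)) = 0" "cnorm Bbar (iB (q c)) = 0"
      using 0 c A.Mbar.norm_nonneg[OF A.i_homD(1)[OF pc]] B.Mbar.norm_nonneg[OF B.i_homD(1)[OF qc]]
      by (auto simp: \<nu>_def pb(3) qb(3) max_def split: if_splits)
    then have "iA (p c) = iA \<zero>\<^bsub>A\<^esub>" "iB (q c) = iB \<zero>\<^bsub>B\<^esub>"
      using pc qc A.i_homD B.i_homD star_hom_zero[OF A.star_algebra_M A.Mbar.star_algebra_axioms A.i_hom]
        star_hom_zero[OF B.star_algebra_M B.Mbar.star_algebra_axioms B.i_hom]
      by (simp_all add: A.Mbar.norm_eq_0 B.Mbar.norm_eq_0)
    then have "p c = \<zero>\<^bsub>A\<^esub>" "q c = \<zero>\<^bsub>B\<^esub>"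
      using inj_onD[OF iA_inj _ pc] inj_onD[OF iB_inj _ qc] A.M.zero_closed B.M.zero_closed by blast+
    then have "(p c, q c) = (p \<zero>\<^bsub>C\<^esub>, q \<zero>\<^bsub>C\<^esub>)"
      using star_hom_zero[OF C.star_algebra_M A.star_algebra_M p] star_hom_zero[OF C.star_algebra_M B.star_algebra_M q]
      by simp
    then have "c = \<zero>\<^bsub>C\<^esub>"
      using inj_onD[OF bij_betw_imp_inj_on[OF bij] _ c C.M.zero_closed] by simp
    then show "iC c = \<zero>\<^bsub>Cbar\<^esub>"
      using star_hom_zero[OF C.star_algebra_M C.Mbar.star_algebra_axioms C.i_hom] by simp
  qed (use iC_inj AF in auto)
  have inj: "inj_on (\<lambda>x. (pb x, qb x)) (carrier Cbar)"
  proof (rule inj_onI)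
    fix x y assume x: "x \<in> carrier Cbar" and y: "y \<in> carrier Cbar" and eq: "(pb x, qb x) = (pb y, qb y)"
    have "pb (x \<ominus>\<^bsub>Cbar\<^esub> y) = \<zero>\<^bsub>Abar\<^esub>" "qb (x \<ominus>\<^bsub>Cbar\<^esub> y) = \<zero>\<^bsub>Bbar\<^esub>"
      using eq pbD(1)[OF y] qbD(1)[OF y]
        star_hom_diff[OF C.Mbar.star_algebra_axioms A.Mbar.star_algebra_axioms pb(1) x y]
        star_hom_diff[OF C.Mbar.star_algebra_axioms B.Mbar.star_algebra_axioms qb(1) x y] by simp_all
    then have "\<nu> (x \<ominus>\<^bsub>Cbar\<^esub> y) = 0" by (simp add: \<nu>_def)
    then have "cnorm Cbar (x \<ominus>\<^bsub>Cbar\<^esub> y) \<le> 0" using C.norm_le_\<nu>[of "x \<ominus>\<^bsub>Cbar\<^esub> y"] x y by simp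
    then have "cnorm Cbar (x \<ominus>\<^bsub>Cbar\<^esub> y) = 0" using C.Mbar.norm_nonneg[of "x \<ominus>\<^bsub>Cbar\<^esub> y"] x y by (intro antisym) auto
    then show "x = y" using x y by (simp add: C.Mbar.norm_eq_0 C.Mbar.diff_eq_zero_iff)
  qed
  \<comment> \<open>A point a0 near a is lifted through r to some b0, which need not be near b. But
    \<open>iB b0\<close> and b have close images in \<open>Dbar\<close>, so b0 can be corrected by
    an element k of the kernel of r; the pair of a0 and b0 - k is still compatible and comes from
    C.\<close>
  have approx: "\<exists>c\<in>carrier C. cnorm Abar (iA (p c) \<ominus>\<^bsub>Abar\<^esub> a) \<le> \<epsilon> \<and> cnorm Bbar (iB (q c) \<ominus>\<^bsub>Bbar\<^esub> b) \<le> \<epsilon>"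
    if a: "a \<in> carrier Abar" and b: "b \<in> carrier Bbar" and ab: "lb a = rb b" and \<epsilon>: "\<epsilon> > 0" for a b \<epsilon>
  proof -
    obtain a0 where a0: "a0 \<in> carrier A" "cnorm Abar (a \<ominus>\<^bsub>Abar\<^esub> iA a0) < \<epsilon>" using A.dense[OF a \<epsilon>] .
    have ia0: "iA a0 \<in> carrier Abar" by (rule A.i_homD(1)[OF a0(1)])
    have "l a0 \<in> r ` carrier B" using r_surj star_homD(1)[OF l a0(1)] by simp
    then obtain b0 where b0: "b0 \<in> carrier B" "r b0 = l a0" by (metis imageE)
    have ib0: "iB b0 \<in> carrier Bbar" by (rule B.i_homD(1)[OF b0(1)])
    have "rb (iB b0 \<ominus>\<^bsub>Bbar\<^esub> b) = lb (iA a0 \<ominus>\<^bsub>Abar\<^esub> a)"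
      using star_hom_diff[OF B.Mbar.star_algebra_axioms D.Mbar.star_algebra_axioms rb(1) ib0 b]
        star_hom_diff[OF A.Mbar.star_algebra_axioms D.Mbar.star_algebra_axioms lb(1) ia0 a]
        ab a0(1) b0 by (simp add: lb(3) rb(3))
    then have "cnorm Dbar (rb (iB b0 \<ominus>\<^bsub>Bbar\<^esub> b)) \<le> cnorm Abar (iA a0 \<ominus>\<^bsub>Abar\<^esub> a)"
      using star_hom_contractive[OF A.cstar_algebra_Mbar D.cstar_algebra_Mbar lb(1)] ia0 a by simp
    also have "\<dots> < \<epsilon>" using a0(2) A.Mbar.norm_diff_commute[OF ia0 a] by simp
    finally have "cnorm Dbar (completion_map B Bbar iB Dbar iD r (iB b0 \<ominus>\<^bsub>Bbar\<^esub> b)) < \<epsilon>" by (simp add: rb_def)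
    with completion_surj_dist[OF B.completion D.completion B.star_algebra_M D.star_algebra_M r r_surj
        B.Mbar.diff_closed[OF ib0 b]]
    obtain k where k: "k \<in> carrier B" "r k = \<zero>\<^bsub>D\<^esub>" "cnorm Bbar (iB b0 \<ominus>\<^bsub>Bbar\<^esub> b \<ominus>\<^bsub>Bbar\<^esub> iB k) < \<epsilon>" by metis
    have ik: "iB k \<in> carrier Bbar" by (rule B.i_homD(1)[OF k(1)])
    define b1 where "b1 = b0 \<ominus>\<^bsub>B\<^esub> k"
    have b1: "b1 \<in> carrier B" using b0 k by (simp add: b1_def)
    have "r b1 = l a0"
      using star_hom_diff[OF B.star_algebra_M D.star_algebra_M r b0(1) k(1)] b0 k star_homD(1)[OF l a0(1)]
      by (simp add: b1_def)
    then have "(a0, b1) \<in> carrier (fibre_product A B l r)" using a0 b1 by (simp add: fibre_product_def)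
    then have "(a0, b1) \<in> (\<lambda>c. (p c, q c)) ` carrier C" using bij by (simp add: bij_betw_def)
    then obtain c where c: "c \<in> carrier C" "p c = a0" "q c = b1" by auto
    have "iB b1 \<ominus>\<^bsub>Bbar\<^esub> b = iB b0 \<ominus>\<^bsub>Bbar\<^esub> b \<ominus>\<^bsub>Bbar\<^esub> iB k"
    proof -
      have "iB b1 = iB b0 \<ominus>\<^bsub>Bbar\<^esub> iB k"
        using star_hom_diff[OF B.star_algebra_M B.Mbar.star_algebra_axioms B.i_hom b0(1) k(1)] by (simp add: b1_def)
      moreover obtain L where "B.Mbar.coefficients L (iB b0) b (iB k) b b"
        using B.Mbar.coefficients_ex[OF ib0 b ik b b] .
      note L = B.Mbar.coefficientsD[OF this]
      have "iB b0 \<ominus>\<^bsub>Bbar\<^esub> iB k \<ominus>\<^bsub>Bbar\<^esub> b = iB b0 \<ominus>\<^bsub>Bbar\<^esub> b \<ominus>\<^bsub>Bbar\<^esub> iB k"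
        unfolding L(5-7) by (simp add: L(1-4))
      ultimately show ?thesis by simp
    qed
    then have "cnorm Bbar (iB (q c) \<ominus>\<^bsub>Bbar\<^esub> b) \<le> \<epsilon>" using k(3) c by simp
    moreover have "cnorm Abar (iA (p c) \<ominus>\<^bsub>Abar\<^esub> a) \<le> \<epsilon>"
      using a0(2) A.Mbar.norm_diff_commute[OF ia0 a] c by simp
    ultimately show ?thesis using c(1) by blast
  qed
  have surj: "\<exists>x\<in>carrier Cbar. pb x = a \<and> qb x = b"
    if a: "a \<in> carrier Abar" and b: "b \<in> carrier Bbar" and ab: "lb a = rb b" for a b
  proof -
    have "\<forall>n. \<exists>c\<in>carrier C. cnorm Abar (iA (p c) \<ominus>\<^bsub>Abar\<^esub> a) \<le> inverse (real (Suc n)) \<and>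
        cnorm Bbar (iB (q c) \<ominus>\<^bsub>Bbar\<^esub> b) \<le> inverse (real (Suc n))"
      using approx[OF a b ab] by simp
    then obtain c where c: "\<And>n. c n \<in> carrier C"
      and ca: "\<And>n. cnorm Abar (iA (p (c n)) \<ominus>\<^bsub>Abar\<^esub> a) \<le> inverse (real (Suc n))"
      and cb: "\<And>n. cnorm Bbar (iB (q (c n)) \<ominus>\<^bsub>Bbar\<^esub> b) \<le> inverse (real (Suc n))" by metis
    have ic: "iC (c n) \<in> carrier Cbar" for n by (rule C.i_homD(1)[OF c])
    have pbc: "pb (iC (c n)) = iA (p (c n))" and qbc: "qb (iC (c n)) = iB (q (c n))" for n
      using c by (simp_all add: pb(3) qb(3))
    have tA: "A.Mbar.tends (\<lambda>n. pb (iC (c n))) a"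
      by (rule A.Mbar.tendsI[OF pbD(1)[OF ic] a _ LIMSEQ_inverse_real_of_nat]) (simp add: pbc ca del: of_nat_Suc)
    have tB: "B.Mbar.tends (\<lambda>n. qb (iC (c n))) b"
      by (rule B.Mbar.tendsI[OF qbD(1)[OF ic] b _ LIMSEQ_inverse_real_of_nat]) (simp add: qbc cb del: of_nat_Suc)
    \<comment> \<open>Convergence of both components controls \<open>\<nu>\<close> of the
      differences, and \<open>\<nu>\<close> dominates the norm of \<open>Cbar\<close>.\<close>
    have "\<exists>K. \<forall>m\<ge>K. \<forall>n\<ge>K. cnorm Cbar (iC (c m) \<ominus>\<^bsub>Cbar\<^esub> iC (c n)) < e" if e: "e > 0" for e
    proof -
      obtain K1 where K1: "\<And>m n. m \<ge> K1 \<Longrightarrow> n \<ge> K1 \<Longrightarrow> cnorm Abar (pb (iC (c m)) \<ominus>\<^bsub>Abar\<^esub> pb (iC (c n))) < e"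
        using A.Mbar.tends_Cauchy[OF tA e] by blast
      obtain K2 where K2: "\<And>m n. m \<ge> K2 \<Longrightarrow> n \<ge> K2 \<Longrightarrow> cnorm Bbar (qb (iC (c m)) \<ominus>\<^bsub>Bbar\<^esub> qb (iC (c n))) < e"
        using B.Mbar.tends_Cauchy[OF tB e] by blast
      have "cnorm Cbar (iC (c m) \<ominus>\<^bsub>Cbar\<^esub> iC (c n)) < e" if "m \<ge> max K1 K2" "n \<ge> max K1 K2" for m n
      proof -
        have "\<nu> (iC (c m) \<ominus>\<^bsub>Cbar\<^esub> iC (c n)) < e"
          using K1[of m n] K2[of m n] that
            star_hom_diff[OF C.Mbar.star_algebra_axioms A.Mbar.star_algebra_axioms pb(1) ic ic]
            star_hom_diff[OF C.Mbar.star_algebra_axioms B.Mbar.star_algebra_axioms qb(1) ic ic]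
          by (simp add: \<nu>_def)
        moreover have "cnorm Cbar (iC (c m) \<ominus>\<^bsub>Cbar\<^esub> iC (c n)) \<le> \<nu> (iC (c m) \<ominus>\<^bsub>Cbar\<^esub> iC (c n))"
          by (rule C.norm_le_\<nu>[OF C.Mbar.diff_closed[OF ic ic]])
        ultimately show ?thesis by linarith
      qed
      then show ?thesis by blast
    qed
    from C.Mbar.Cauchy_tends[OF ic this] obtain x where x: "C.Mbar.tends (\<lambda>n. iC (c n)) x" by blast
    have "pb x = a"
      by (rule A.Mbar.tends_unique[OF star_hom_tends[OF C.cstar_algebra_Mbar A.cstar_algebra_Mbar pb(1) x] tA])
    moreover have "qb x = b"
      by (rule B.Mbar.tends_unique[OF star_hom_tends[OF C.cstar_algebra_Mbar B.cstar_algebra_Mbar qb(1) x] tB])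
    ultimately show ?thesis using C.Mbar.tendsD(2)[OF x] by blast
  qed
  have "(\<lambda>x. (pb x, qb x)) ` carrier Cbar = carrier (fibre_product Abar Bbar lb rb)"
  proof (intro equalityI subsetI)
    fix z assume "z \<in> (\<lambda>x. (pb x, qb x)) ` carrier Cbar"
    then show "z \<in> carrier (fibre_product Abar Bbar lb rb)"
      using comm_bar pbD(1) qbD(1) by (auto simp: fibre_product_def)
  next
    fix z assume "z \<in> carrier (fibre_product Abar Bbar lb rb)"
    then obtain a b where "z = (a, b)" "a \<in> carrier Abar" "b \<in> carrier Bbar" "lb a = rb b"
      by (auto simp: fibre_product_def)
    then show "z \<in> (\<lambda>x. (pb x, qb x)) ` carrier Cbar" using surj by force
  qed
  with inj have "bij_betw (\<lambda>x. (pb x, qb x)) (carrier Cbar) (carrier (fibre_product Abar Bbar lb rb))"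
    by (simp add: bij_betw_def)
  moreover have "(\<lambda>x. (pb x, qb x)) \<in> star_hom Cbar (fibre_product Abar Bbar lb rb)"
    by (rule star_homI) (use comm_bar in \<open>simp_all add: fibre_product_def pbD qbD\<close>)
  ultimately show ?thesis
    unfolding equivariant_pullback_def equivariant_square_def equivariant_iso_def lb_def[symmetric]
      rb_def[symmetric] pb_def[symmetric] qb_def[symmetric]
    using eq_lb eq_rb eq_pb eq_qb comm_bar pb_act qb_act by (simp add: equivariant_hom_def)
qed

theorem theorem2p5:
  fixes G :: "'g monoid" and T :: "'g topology"
    and A :: "'a star_alg" and B :: "'b star_alg" and C :: "'c star_alg" and D :: "'d star_alg"
    and \<rho>A :: "'a \<Rightarrow> 'g \<Rightarrow> 'a" and \<rho>B :: "'b \<Rightarrow> 'g \<Rightarrow> 'b"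
    and \<rho>C :: "'c \<Rightarrow> 'g \<Rightarrow> 'c" and \<rho>D :: "'d \<Rightarrow> 'g \<Rightarrow> 'd"
    and l :: "'a \<Rightarrow> 'd" and r :: "'b \<Rightarrow> 'd" and p :: "'c \<Rightarrow> 'a" and q :: "'c \<Rightarrow> 'b"
    and Abar Bbar Cbar Dbar :: "'u cstar_alg"
    and iA :: "'a \<Rightarrow> 'u" and iB :: "'b \<Rightarrow> 'u" and iC :: "'c \<Rightarrow> 'u" and iD :: "'d \<Rightarrow> 'u"
  assumes "compact_group G T"
    and "G_star_algebra G T A \<rho>A" and "G_star_algebra G T B \<rho>B"
    and "G_star_algebra G T C \<rho>C" and "G_star_algebra G T D \<rho>D"
    and "equivariant_square G A (coaction_action \<rho>A) B (coaction_action \<rho>B)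
           C (coaction_action \<rho>C) D (coaction_action \<rho>D) l r p q"
    and "equivariant_pullback G A (coaction_action \<rho>A) B (coaction_action \<rho>B)
           C (coaction_action \<rho>C) D (coaction_action \<rho>D) l r p q"
    and "r ` carrier B = carrier D"
    and "AF_algebra TYPE('u) (invariant_subalgebra G C (coaction_action \<rho>C))"
    and "is_cstar_completion A Abar iA" and "inj_on iA (carrier A)"
    and "is_cstar_completion B Bbar iB" and "inj_on iB (carrier B)"
    and "is_cstar_completion C Cbar iC" and "inj_on iC (carrier C)"
    and "is_cstar_completion D Dbar iD" and "inj_on iD (carrier D)"
  shows "G_cstar_algebra G T Abar (completion_action A \<rho>A Abar iA) \<and>
         G_cstar_algebra G T Bbar (completion_action B \<rho>B Bbar iB) \<and>
         G_cstar_algebra G T Cbar (completion_action C \<rho>C Cbar iC) \<and>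
         G_cstar_algebra G T Dbar (completion_action D \<rho>D Dbar iD) \<and>
         equivariant_pullback G
           Abar (completion_action A \<rho>A Abar iA) Bbar (completion_action B \<rho>B Bbar iB)
           Cbar (completion_action C \<rho>C Cbar iC) Dbar (completion_action D \<rho>D Dbar iD)
           (completion_map A Abar iA Dbar iD l) (completion_map B Bbar iB Dbar iD r)
           (completion_map C Cbar iC Abar iA p) (completion_map C Cbar iC Bbar iB q)"
proof -
  note A = completed_action.intro[OF assms(1,2,10)] and B = completed_action.intro[OF assms(1,3,12)]
    and C = completed_action.intro[OF assms(1,4,14)] and D = completed_action.intro[OF assms(1,5,16)]
  show ?thesis
    using completed_action.G_cstar_algebra_completion[OF A] completed_action.G_cstar_algebra_completion[OF B]
      completed_action.G_cstar_algebra_completion[OF C] completed_action.G_cstar_algebra_completion[OF D]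
      equivariant_pullback_completion[OF A B C D assms(7,8,9,11,13,15)]
    by blast
qed

end
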